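(* In the setting described in the context, suppose that $h,G$ satisfy (C.2) and (C.3), that $\kappa\ge1$ satisfies $\frac{\mu\lambda_1}{2}-\kappa>0$, and that $$\int_{-\infty}^\tau e^{\kappa s}\|f(s)\|_{V'}^2\,ds<\infty\qquad\text{for all }\tau\in\mathbb R .$$ Let $\varepsilon_0=\min\{1,\sqrt{\mu\lambda_1/(2L_g)}\}$ and $\varepsilon_1,\varepsilon_2\in(0,\varepsilon_0]$. Then the mean random dynamical system $\Phi=\{\Phi(t,\tau):t\in\mathbb R^+,\tau\in\mathbb R\}$ generated by $$du(t)+\mu\mathcal A u(t)\,dt+B(u(t),u(t))\,dt=f(t)\,dt+\varepsilon_1h(t,u(t))\,dW(t)+\varepsilon_2\int_{\mathcal Z}G(u(t-),z)\,\widetilde N(dt,dz)$$ possesses a unique weak $\mathfrak D$-pullback mean random attractor $\mathscr A=\{\mathscr A(\tau)\}_{\tau\in\mathbb R}\in\mathfrak D$ on $L^2(\Omega,\mathscr F;H)$ over $(\Omega,\mathscr F,\{\mathscr F_t\}_{t\in\mathbb R},\mathbb P)$, and for every $\tau\in\mathbb R$ $$\mathscr A(\tau)=\bigcap_{s\ge0}\overline{\bigcup_{t\ge s}\Phi(t,\tau-t)K(\tau-t)}^{\,w},$$ where the closure is taken in the weak topology of $L^2(\Omega,\mathscr F_\tau;H)$ and $K=\{K(\tau)\}_{\tau\in\mathbb R}$ is the weakly compact $\mathfrak D$-pullback absorbing set described in the context.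
   Context: Setting. $\mu>0$. $H$ is a separable Hilbert space with inner product $\langle\cdot,\cdot\rangle$ and norm $\|\cdot\|_H$. $\mathcal A$ is a positive self-adjoint linear operator in $H$ whose domain $D(\mathcal A)$ (graph norm) is densely and compactly embedded in $H$. $V=\mathrm{dom}(\mathcal A^{1/2})$ with $\|y\|_V=\|\mathcal A^{1/2}y\|_H$, $V'$ is its dual, $V\subset H\cong H'\subset V'$, and $\langle\cdot,\cdot\rangle$ also denotes the $V'$–$V$ pairing. $\lambda_1>0$ satisfies $\lambda_1\|u\|_H^2\le\|u\|_V^2$ for $u\in V$. $B:V\times V\to V'$ is continuous bilinear with: (B.1) $\langle B(u,v),w\rangle=-\langle B(u,w),v\rangle$ for all $u,v,w\in V$; (B.2) there are a reflexive separable Banach space $Q$ with $V\subset Q\subset H$ and $\mathbf c_0>0$ with $\|u\|_Q^2\le\mathbf c_0\|u\|_H\|u\|_V$ for $u\in V$; (B.3) there is $C>0$ with $|\langle B(u,v),w\rangle|\le C\|u\|_Q\|v\|_V\|w\|_Q$ for all $u,v,w\in V$. $(\Omega,\mathscr F,\{\mathscr F_t\}_{t\in\mathbb R},\mathbb P)$ is a filtered probability space satisfying the usual conditions; $W$ is a two-sided cylindrical Wiener process on a separable Hilbert space $U$; $(\mathcal Z,\mathcal B(\mathcal Z))$ carries a $\sigma$-finite measure $\nu$ with $\nu(\{0\})=0$; $N$ is a time-homogeneous Poisson random measure with intensity $\nu$, $\widetilde N(dt,dz)=N(dt,dz)-\nu(dz)dt$; $W$ and $\widetilde N$ are independent. $\mathcal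 L_2(U;H)$: Hilbert–Schmidt operators. $h:\mathbb R\times H\to\mathcal L_2(U;H)$, $G:H\times\mathcal Z\to H$ are measurable. (C.2): there is $L_g>0$ with $\|h(t,u)\|_{\mathcal L_2(U;H)}^2+\int_{\mathcal Z}\|G(u,z)\|_H^2\nu(dz)\le L_g(1+\|u\|_H^2)$ for all $t,u$. (C.3): for every $r>0$ there is $L_r>0$ with $\|h(t,u)-h(t,v)\|_{\mathcal L_2(U;H)}^2+\int_{\mathcal Z}\|G(u,z)-G(v,z)\|_H^2\nu(dz)\le L_r\|u-v\|_H^2$ for all $t\in\mathbb R$, $\|u\|_H\vee\|v\|_H\le r$. A solution with $u(\tau)=u_\tau$ is an $H$-valued càdlàg adapted process lying a.s. in $L^2([\tau,\tau+T],V)$ for every $T>0$ and satisfying the integrated equation in $V'$ for all $t\ge\tau$, a.s. For each $u_\tau\in L^2(\Omega,\mathscr F_\tau;H)$ there is a unique solution $u(t,\tau,u_\tau)$, and $\Phi(t,\tau):L^2(\Omega,\mathscr F_\tau;H)\to L^2(\Omega,\mathscr F_{t+\tau};H)$ is $\Phi(t,\tau)(u_\tau)=u(t+\tau,\tau,u_\tau)$, $t\ge0$. $\mathfrak D$ is the collection of all families $D=\{D(\tau)\subseteq L^2(\Omega,\mathscr F_\tau;H):\tau\in\mathbb R\}$ of nonempty bounded sets with $\lim_{\tau\to-\infty}e^{\kappa\tau}\|D(\tau)\|^2_{L^2(\Omega,\mathscr F_\tau;H)}=0$, where $\|D(\tau)\|_{L^2(\Omega,\mathscr F_\tau;H)}=\sup_{u\in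 D(\tau)}\|u\|_{L^2(\Omega,\mathscr F_\tau;H)}$. Weak $\mathfrak D$-pullback mean random attractor: a family $\mathscr A=\{\mathscr A(\tau)\}_{\tau\in\mathbb R}\in\mathfrak D$ such that (i) each $\mathscr A(\tau)$ is a weakly compact subset of $L^2(\Omega,\mathscr F_\tau;H)$; (ii) for every $\tau\in\mathbb R$, $D\in\mathfrak D$ and every neighbourhood $\mathcal N^w$ of $\mathscr A(\tau)$ in the weak topology of $L^2(\Omega,\mathscr F_\tau;H)$ there is $T>0$ such that $\Phi(t,\tau-t)(D(\tau-t))\subseteq\mathcal N^w$ for all $t\ge T$; (iii) $\mathscr A$ is minimal: any $E\in\mathfrak D$ satisfying (i) and (ii) has $\mathscr A(\tau)\subseteq E(\tau)$ for all $\tau$. Absorbing set: $K(\tau)=\{u\in L^2(\Omega,\mathscr F_\tau;H):\mathbb E[\|u\|_H^2]\le R(\tau)\}$, $R(\tau)=\rho_0+\rho_0e^{-\kappa\tau}\int_{-\infty}^\tau e^{\kappa s}\|f(s)\|_{V'}^2ds$, where $\rho_0>0$ is a constant independent of $\tau$ such that for every $\tau\in\mathbb R$ and $D\in\mathfrak D$ there is $T=T(\tau,D)>0$ with $\mathbb E[\|u(\tau,\tau-t,u_{\tau-t})\|_H^2]\le R(\tau)$ for all $t\ge T$ and $u_{\tau-t}\in D(\tau-t)$ (such a constant exists). *)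

theory Defs
  imports "HOL-Probability.Probability"
begin

text \<open>
  Conventions.  A separable (real) Hilbert space is a type of sort
  \<open>{real_inner, banach, second_countable_topology}\<close>.  The space \<open>V\<close> is a type of that sort together
  with its embedding \<open>j\<close> into the Hilbert space \<open>H\<close>; its dual is \<open>V \<Rightarrow>\<^sub>L real\<close> with the operator norm.
\<close>


section \<open>Unbounded operators\<close>

text \<open>The last clause says that the graph of the adjoint of \<open>A\<close> is the graph of \<open>A\<close>.\<close>

definition self_adjoint_op :: "'h::real_inner set \<Rightarrow> ('h \<Rightarrow> 'h) \<Rightarrow> bool" where
  "self_adjoint_op D A \<longleftrightarrow>
     subspace D \<and> closure D = UNIV \<and>
     (\<forall>x\<in>D. \<forall>y\<in>D. A (x + y) = A x + A y) \<and> (\<forall>c. \<forall>x\<in>D. A (c *\<^sub>R x) = c *\<^sub>R A x) \<and>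
     (\<forall>y z. (\<forall>x\<in>D. A x \<bullet> y = x \<bullet> z) \<longleftrightarrow> (y \<in> D \<and> A y = z))"

definition positive_self_adjoint_op :: "'h::real_inner set \<Rightarrow> ('h \<Rightarrow> 'h) \<Rightarrow> bool" where
  "positive_self_adjoint_op D A \<longleftrightarrow> self_adjoint_op D A \<and> (\<forall>x\<in>D. 0 \<le> A x \<bullet> x)"

definition compactly_embedded_domain :: "'h::real_inner set \<Rightarrow> ('h \<Rightarrow> 'h) \<Rightarrow> bool" where
  "compactly_embedded_domain D A \<longleftrightarrow>
     compact (closure {x \<in> D. (norm x)\<^sup>2 + (norm (A x))\<^sup>2 \<le> 1})"

definition is_sqrt_op ::
    "'h::real_inner set \<Rightarrow> ('h \<Rightarrow> 'h) \<Rightarrow> 'h set \<Rightarrow> ('h \<Rightarrow> 'h) \<Rightarrow> bool" where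
  "is_sqrt_op D A D' S \<longleftrightarrow>
     positive_self_adjoint_op D' S \<and> D = {x \<in> D'. S x \<in> D'} \<and> (\<forall>x\<in>D. A x = S (S x))"


section \<open>The triple \<open>V \<subseteq> H \<subseteq> V'\<close>\<close>

definition H_to_dual ::
    "('v::real_normed_vector \<Rightarrow>\<^sub>L 'h::real_inner) \<Rightarrow> 'h \<Rightarrow> ('v \<Rightarrow>\<^sub>L real)" where
  "H_to_dual j x = blinfun_inner_left x o\<^sub>L j"

text \<open>
  The continuous extension \<open>V \<rightarrow> V'\<close> of \<open>A\<close>, where \<open>S\<close> is the square root of \<open>A\<close>.
\<close>

definition A_to_dual ::
    "('v::real_normed_vector \<Rightarrow>\<^sub>L 'h::real_inner) \<Rightarrow> ('h \<Rightarrow> 'h) \<Rightarrow> 'v \<Rightarrow> ('v \<Rightarrow>\<^sub>L real)" where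
  "A_to_dual j S y = Blinfun (\<lambda>v. S (blinfun_apply j y) \<bullet> S (blinfun_apply j v))"

text \<open>
  The clauses of \<^const>\<open>has_bochner_integral\<close>, which is not available for values in the type
  \<open>V \<Rightarrow>\<^sub>L real\<close> because that type is not an instance of \<open>second_countable_topology\<close>
  (although \<open>V'\<close> is separable here).
\<close>

definition has_dual_integral ::
    "(real \<Rightarrow> 'b::real_normed_vector) \<Rightarrow> 'b \<Rightarrow> real set \<Rightarrow> bool" where
  "has_dual_integral g y I \<longleftrightarrow>
     (\<lambda>x. indicator I x *\<^sub>R g x) \<in> borel_measurable lborel \<and>
     (\<exists>s. (\<forall>i. Bochner_Integration.simple_bochner_integrable lborel (s i)) \<and>
        (\<lambda>i::nat. \<integral>\<^sup>+x. ennreal (norm (indicator I x *\<^sub>R g x - s i x)) \<partial>lborel) \<longlonglongrightarrow> 0 \<and>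
        (\<lambda>i. Bochner_Integration.simple_bochner_integral lborel (s i)) \<longlonglongrightarrow> y)"

definition reflexive_space :: "'q::real_normed_vector itself \<Rightarrow> bool" where
  "reflexive_space _ \<longleftrightarrow>
     (\<forall>\<phi> :: ('q \<Rightarrow>\<^sub>L real) \<Rightarrow>\<^sub>L real. \<exists>x. \<forall>g. blinfun_apply \<phi> g = blinfun_apply g x)"


section \<open>Hilbert--Schmidt operators\<close>

definition orthonormal_basis :: "'u::real_inner set \<Rightarrow> bool" where
  "orthonormal_basis E \<longleftrightarrow>
     pairwise orthogonal E \<and> (\<forall>e\<in>E. norm e = 1) \<and> closure (span E) = UNIV"

text \<open>
  The squared Hilbert--Schmidt norm, infinite if the operator is not Hilbert--Schmidt; by Parseval's
  identity it does not depend on the orthonormal basis.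
\<close>

definition hs_norm_sq :: "('u::real_inner \<Rightarrow>\<^sub>L 'h::real_normed_vector) \<Rightarrow> ennreal" where
  "hs_norm_sq T = (\<Sum>\<^sub>\<infinity>e\<in>(SOME E. orthonormal_basis E). ennreal ((norm (blinfun_apply T e))\<^sup>2))"

definition hilbert_schmidt :: "('u::real_inner \<Rightarrow>\<^sub>L 'h::real_normed_vector) set" where
  "hilbert_schmidt = {T. hs_norm_sq T < \<infinity>}"

text \<open>The Borel \<open>\<sigma>\<close>-algebra of the Hilbert--Schmidt norm topology.\<close>

definition hs_borel :: "('u::real_inner \<Rightarrow>\<^sub>L 'h::real_normed_vector) measure" where
  "hs_borel = sigma hilbert_schmidt
     {X. X \<subseteq> hilbert_schmidt \<and>
         (\<forall>T\<in>X. \<exists>e>0. \<forall>T'. hs_norm_sq (T' - T) < ennreal e \<longrightarrow> T' \<in> X)}"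


section \<open>Stochastic basis and noise\<close>

definition stochastic_basis :: "'w measure \<Rightarrow> (real \<Rightarrow> 'w measure) \<Rightarrow> bool" where
  "stochastic_basis M F \<longleftrightarrow>
     prob_space M \<and> filtration (space M) F \<and> (\<forall>t. subalgebra M (F t)) \<and>
     complete_measure M \<and> (\<forall>t. null_sets M \<subseteq> sets (F t)) \<and>
     (\<forall>t. sets (F t) = (\<Inter>s\<in>{t<..}. sets (F s)))"

text \<open>
  \<open>W t x\<close> stands for the pairing of \<open>W(t)\<close> with \<open>x\<close>.  As \<open>W\<close> is two-sided with \<open>W(0) = 0\<close>,
  only its increments (and not its values at negative times) are compatible with the filtration.
\<close>

definition cylindrical_wiener ::
    "'w measure \<Rightarrow> (real \<Rightarrow> 'w measure) \<Rightarrow> (real \<Rightarrow> 'u::real_inner \<Rightarrow> 'w \<Rightarrow> real) \<Rightarrow> bool" where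
  "cylindrical_wiener M F W \<longleftrightarrow>
     (\<forall>t x. W t x \<in> borel_measurable M) \<and>
     (\<forall>x. AE \<omega> in M. W 0 x \<omega> = 0) \<and>
     (\<forall>x. AE \<omega> in M. continuous_on UNIV (\<lambda>t. W t x \<omega>)) \<and>
     (\<forall>t a b x y. AE \<omega> in M. W t (a *\<^sub>R x + b *\<^sub>R y) \<omega> = a * W t x \<omega> + b * W t y \<omega>) \<and>
     (\<forall>s t x. s < t \<longrightarrow>
        (\<lambda>\<omega>. W t x \<omega> - W s x \<omega>) \<in> borel_measurable (F t) \<and>
        prob_space.indep_set M (sets (F s))
          {(\<lambda>\<omega>. W t x \<omega> - W s x \<omega>) -` C \<inter> space M | C. C \<in> sets borel} \<and>
        (x \<noteq> 0 \<longrightarrow> distributed M lborel (\<lambda>\<omega>. W t x \<omega> - W s x \<omega>)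
                       (normal_density 0 (sqrt (t - s) * norm x))))"

text \<open>
  A Poisson random measure on \<open>\<real> \<times> Z\<close> with intensity \<open>dt \<otimes> \<nu>\<close>, compatible with the filtration.
\<close>

definition poisson_random_measure ::
    "'w measure \<Rightarrow> (real \<Rightarrow> 'w measure) \<Rightarrow> 'z measure \<Rightarrow> ('w \<Rightarrow> (real \<times> 'z) measure) \<Rightarrow> bool" where
  "poisson_random_measure M F \<nu> N \<longleftrightarrow>
     (\<forall>\<omega>\<in>space M. sets (N \<omega>) = sets (lborel \<Otimes>\<^sub>M \<nu>)) \<and>
     (\<forall>C\<in>sets (lborel \<Otimes>\<^sub>M \<nu>). (\<lambda>\<omega>. emeasure (N \<omega>) C) \<in> borel_measurable M) \<and>
     (\<forall>C\<in>sets (lborel \<Otimes>\<^sub>M \<nu>). emeasure (lborel \<Otimes>\<^sub>M \<nu>) C < \<infinity> \<longrightarrow>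
        (\<forall>k::nat. measure M {\<omega>\<in>space M. emeasure (N \<omega>) C = of_nat k} =
           measure (lborel \<Otimes>\<^sub>M \<nu>) C ^ k / fact k * exp (- measure (lborel \<Otimes>\<^sub>M \<nu>) C))) \<and>
     (\<forall>C\<in>sets (lborel \<Otimes>\<^sub>M \<nu>). emeasure (lborel \<Otimes>\<^sub>M \<nu>) C = \<infinity> \<longrightarrow>
        (AE \<omega> in M. emeasure (N \<omega>) C = \<infinity>)) \<and>
     (\<forall>(n::nat) C. (\<forall>i<n. C i \<in> sets (lborel \<Otimes>\<^sub>M \<nu>)) \<and> disjoint_family_on C {..<n} \<longrightarrow>
        prob_space.indep_vars M (\<lambda>_. borel) (\<lambda>i \<omega>. emeasure (N \<omega>) (C i)) {..<n}) \<and>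
     (\<forall>t. \<forall>C\<in>sets (lborel \<Otimes>\<^sub>M \<nu>). C \<subseteq> {..t} \<times> UNIV \<longrightarrow>
        (\<lambda>\<omega>. emeasure (N \<omega>) C) \<in> borel_measurable (F t)) \<and>
     (\<forall>t. prob_space.indep_set M (sets (F t))
        (sigma_sets (space M) {(\<lambda>\<omega>. emeasure (N \<omega>) C) -` E \<inter> space M | C E.
           C \<in> sets (lborel \<Otimes>\<^sub>M \<nu>) \<and> C \<subseteq> {t<..} \<times> UNIV \<and> E \<in> sets borel}))"

text \<open>
  The compensator is deterministic, so that the independence of \<open>W\<close> and of the compensated measure
  is the independence of \<open>W\<close> and \<open>N\<close>.
\<close>

definition independent_noises ::
    "'w measure \<Rightarrow> 'z measure \<Rightarrow> (real \<Rightarrow> 'u \<Rightarrow> 'w \<Rightarrow> real) \<Rightarrow> ('w \<Rightarrow> (real \<times> 'z) measure) \<Rightarrow> bool" where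
  "independent_noises M \<nu> W N \<longleftrightarrow>
     prob_space.indep_set M
       (sigma_sets (space M) {W t x -` E \<inter> space M | t x E. E \<in> sets borel})
       (sigma_sets (space M) {(\<lambda>\<omega>. emeasure (N \<omega>) C) -` E \<inter> space M | C E.
          C \<in> sets (lborel \<Otimes>\<^sub>M \<nu>) \<and> E \<in> sets borel})"


section \<open>Stochastic integrals\<close>

text \<open>
  Both integrals are the usual localized Ito integrals.  A list entry \<open>(a, b, \<Lambda>, x, y)\<close> stands for
  the elementary predictable integrand \<open>1_{(a,b]}(s) 1_\<Lambda>(\<omega>) \<langle>x, \<cdot>\<rangle> y\<close>.  A process \<open>I\<close> is the
  integral of \<open>X\<close> over \<open>(\<tau>, \<cdot>]\<close> if it is the locally uniform limit of integrals of simple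
  processes converging to \<open>X\<close> pathwise in the natural \<open>L\<^sup>2\<close> sense.  Almost sure convergence
  gives the same notion as convergence in probability, by passing to a subsequence, and determines
  \<open>I\<close> up to indistinguishability.
\<close>

definition wiener_simple ::
    "(real \<Rightarrow> 'w measure) \<Rightarrow> real \<Rightarrow> (real \<times> real \<times> 'w set \<times> 'u \<times> 'h) list \<Rightarrow> bool" where
  "wiener_simple F \<tau> L \<longleftrightarrow> (\<forall>(a, b, \<Lambda>, x, y) \<in> set L. \<tau> \<le> a \<and> a \<le> b \<and> \<Lambda> \<in> sets (F a))"

definition wiener_simple_process ::
    "(real \<times> real \<times> 'w set \<times> 'u::real_inner \<times> 'h::real_normed_vector) list \<Rightarrow>
     real \<Rightarrow> 'w \<Rightarrow> ('u \<Rightarrow>\<^sub>L 'h)" where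
  "wiener_simple_process L s \<omega> =
     (\<Sum>(a, b, \<Lambda>, x, y)\<leftarrow>L. (indicator {a<..b} s * indicator \<Lambda> \<omega>) *\<^sub>R
        (blinfun_scaleR_left y o\<^sub>L blinfun_inner_left x))"

definition wiener_simple_integral ::
    "(real \<Rightarrow> 'u \<Rightarrow> 'w \<Rightarrow> real) \<Rightarrow> (real \<times> real \<times> 'w set \<times> 'u \<times> 'h::real_normed_vector) list \<Rightarrow>
     real \<Rightarrow> 'w \<Rightarrow> 'h" where
  "wiener_simple_integral W L t \<omega> =
     (\<Sum>(a, b, \<Lambda>, x, y)\<leftarrow>L. (indicator \<Lambda> \<omega> * (W (min b t) x \<omega> - W (min a t) x \<omega>)) *\<^sub>R y)"

definition has_wiener_integral ::
    "'w measure \<Rightarrow> (real \<Rightarrow> 'w measure) \<Rightarrow> (real \<Rightarrow> 'u::real_inner \<Rightarrow> 'w \<Rightarrow> real) \<Rightarrow> real \<Rightarrow>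
     (real \<Rightarrow> 'w \<Rightarrow> ('u \<Rightarrow>\<^sub>L 'h::real_normed_vector)) \<Rightarrow> (real \<Rightarrow> 'w \<Rightarrow> 'h) \<Rightarrow> bool" where
  "has_wiener_integral M F W \<tau> X I \<longleftrightarrow>
     (\<exists>L :: nat \<Rightarrow> (real \<times> real \<times> 'w set \<times> 'u \<times> 'h) list.
        (\<forall>n. wiener_simple F \<tau> (L n)) \<and>
        (AE \<omega> in M. \<forall>T\<ge>\<tau>.
           (\<lambda>n. \<integral>\<^sup>+s\<in>{\<tau>..T}. hs_norm_sq (wiener_simple_process (L n) s \<omega> - X s \<omega>) \<partial>lborel)
             \<longlonglongrightarrow> 0 \<and>
           uniform_limit {\<tau>..T} (\<lambda>n t. wiener_simple_integral W (L n) t \<omega>) (\<lambda>t. I t \<omega>)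
             sequentially))"

text \<open>Here an entry \<open>(a, b, \<Lambda>, C, y)\<close> stands for \<open>1_{(a,b]}(s) 1_\<Lambda>(\<omega>) 1_C(z) y\<close>.\<close>

definition poisson_simple ::
    "(real \<Rightarrow> 'w measure) \<Rightarrow> 'z measure \<Rightarrow> real \<Rightarrow> (real \<times> real \<times> 'w set \<times> 'z set \<times> 'h) list \<Rightarrow>
     bool" where
  "poisson_simple F \<nu> \<tau> L \<longleftrightarrow>
     (\<forall>(a, b, \<Lambda>, C, y) \<in> set L.
        \<tau> \<le> a \<and> a \<le> b \<and> \<Lambda> \<in> sets (F a) \<and> C \<in> sets \<nu> \<and> emeasure \<nu> C < \<infinity>)"

definition poisson_simple_process ::
    "(real \<times> real \<times> 'w set \<times> 'z set \<times> 'h::real_normed_vector) list \<Rightarrow>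
     real \<Rightarrow> 'z \<Rightarrow> 'w \<Rightarrow> 'h" where
  "poisson_simple_process L s z \<omega> =
     (\<Sum>(a, b, \<Lambda>, C, y)\<leftarrow>L. (indicator {a<..b} s * indicator \<Lambda> \<omega> * indicator C z) *\<^sub>R y)"

definition poisson_simple_integral ::
    "'z measure \<Rightarrow> ('w \<Rightarrow> (real \<times> 'z) measure) \<Rightarrow>
     (real \<times> real \<times> 'w set \<times> 'z set \<times> 'h::real_normed_vector) list \<Rightarrow> real \<Rightarrow> 'w \<Rightarrow> 'h" where
  "poisson_simple_integral \<nu> N L t \<omega> =
     (\<Sum>(a, b, \<Lambda>, C, y)\<leftarrow>L.
        (indicator \<Lambda> \<omega> * (measure (N \<omega>) ({min a t<..min b t} \<times> C)
                             - (min b t - min a t) * measure \<nu> C)) *\<^sub>R y)"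

definition has_poisson_integral ::
    "'w measure \<Rightarrow> (real \<Rightarrow> 'w measure) \<Rightarrow> 'z measure \<Rightarrow> ('w \<Rightarrow> (real \<times> 'z) measure) \<Rightarrow> real \<Rightarrow>
     (real \<Rightarrow> 'z \<Rightarrow> 'w \<Rightarrow> 'h::real_normed_vector) \<Rightarrow> (real \<Rightarrow> 'w \<Rightarrow> 'h) \<Rightarrow> bool" where
  "has_poisson_integral M F \<nu> N \<tau> X I \<longleftrightarrow>
     (\<exists>L :: nat \<Rightarrow> (real \<times> real \<times> 'w set \<times> 'z set \<times> 'h) list.
        (\<forall>n. poisson_simple F \<nu> \<tau> (L n)) \<and>
        (AE \<omega> in M. \<forall>T\<ge>\<tau>.
           (\<lambda>n. \<integral>\<^sup>+s\<in>{\<tau>..T}.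
                 (\<integral>\<^sup>+z. ennreal ((norm (poisson_simple_process (L n) s z \<omega> - X s z \<omega>))\<^sup>2) \<partial>\<nu>)
                 \<partial>lborel) \<longlonglongrightarrow> 0 \<and>
           uniform_limit {\<tau>..T} (\<lambda>n t. poisson_simple_integral \<nu> N (L n) t \<omega>) (\<lambda>t. I t \<omega>)
             sequentially))"


section \<open>Solutions\<close>

definition cadlag_from :: "real \<Rightarrow> (real \<Rightarrow> 'h::topological_space) \<Rightarrow> bool" where
  "cadlag_from \<tau> x \<longleftrightarrow>
     (\<forall>t\<ge>\<tau>. (x \<longlongrightarrow> x t) (at_right t)) \<and> (\<forall>t>\<tau>. \<exists>l. (x \<longlongrightarrow> l) (at_left t))"

text \<open>
  A solution on \<open>[\<tau>, \<infinity>)\<close> with initial value \<open>\<xi>\<close>.  For almost every \<open>\<omega>\<close>, the function \<open>v\<close> is the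
  path of \<open>u\<close> regarded as an element of \<open>L\<^sup>2([\<tau>, \<tau> + T], V)\<close>; it is determined almost everywhere.
\<close>

definition is_solution ::
    "'w measure \<Rightarrow> (real \<Rightarrow> 'w measure) \<Rightarrow> (real \<Rightarrow> 'u::real_inner \<Rightarrow> 'w \<Rightarrow> real) \<Rightarrow>
     'z measure \<Rightarrow> ('w \<Rightarrow> (real \<times> 'z) measure) \<Rightarrow>
     ('v::real_normed_vector \<Rightarrow>\<^sub>L 'h::{real_inner, banach, second_countable_topology}) \<Rightarrow>
     ('h \<Rightarrow> 'h) \<Rightarrow> real \<Rightarrow> ('v \<Rightarrow> 'v \<Rightarrow> ('v \<Rightarrow>\<^sub>L real)) \<Rightarrow> (real \<Rightarrow> ('v \<Rightarrow>\<^sub>L real)) \<Rightarrow>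
     real \<Rightarrow> (real \<Rightarrow> 'h \<Rightarrow> ('u \<Rightarrow>\<^sub>L 'h)) \<Rightarrow> real \<Rightarrow> ('h \<Rightarrow> 'z \<Rightarrow> 'h) \<Rightarrow>
     real \<Rightarrow> ('w \<Rightarrow> 'h) \<Rightarrow> (real \<Rightarrow> 'w \<Rightarrow> 'h) \<Rightarrow> bool" where
  "is_solution M F W \<nu> N j S
     \<mu> B f \<epsilon>\<^sub>1 h \<epsilon>\<^sub>2 G \<tau> \<xi> u \<longleftrightarrow>
     (\<forall>t\<ge>\<tau>. u t \<in> borel_measurable (F t)) \<and>
     (\<forall>\<omega>\<in>space M. cadlag_from \<tau> (\<lambda>t. u t \<omega>)) \<and>
     (AE \<omega> in M. u \<tau> \<omega> = \<xi> \<omega>) \<and>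
     (\<exists>I J.
        has_wiener_integral M F W \<tau> (\<lambda>s \<omega>. h s (u s \<omega>)) I \<and>
        has_poisson_integral M F \<nu> N \<tau> (\<lambda>s z \<omega>. G (Lim (at_left s) (\<lambda>r. u r \<omega>)) z) J \<and>
        (AE \<omega> in M. \<exists>v.
           v \<in> borel_measurable lborel \<and>
           (AE s in lborel. \<tau> \<le> s \<longrightarrow> blinfun_apply j (v s) = u s \<omega>) \<and>
           (\<forall>T>0. (\<integral>\<^sup>+s\<in>{\<tau>..\<tau> + T}. ennreal ((norm (v s))\<^sup>2) \<partial>lborel) < \<infinity>) \<and>
           (\<forall>t\<ge>\<tau>. \<exists>a b c.
              has_dual_integral (\<lambda>s. A_to_dual j S (v s)) a {\<tau>..t} \<and>
              has_dual_integral (\<lambda>s. B (v s) (v s)) b {\<tau>..t} \<and>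
              has_dual_integral f c {\<tau>..t} \<and>
              H_to_dual j (u t \<omega>) + \<mu> *\<^sub>R a + b =
                H_to_dual j (\<xi> \<omega>) + c + \<epsilon>\<^sub>1 *\<^sub>R H_to_dual j (I t \<omega>) + \<epsilon>\<^sub>2 *\<^sub>R H_to_dual j (J t \<omega>))))"


section \<open>The spaces \<open>L\<^sup>2(\<Omega>, F\<^sub>\<tau>; H)\<close>\<close>

definition L2_fun ::
    "'w measure \<Rightarrow> 'w measure \<Rightarrow> ('w \<Rightarrow> 'h::{real_normed_vector, second_countable_topology}) set" where
  "L2_fun M F\<^sub>0 = {g \<in> borel_measurable F\<^sub>0. integrable M (\<lambda>\<omega>. (norm (g \<omega>))\<^sup>2)}"

definition L2_norm :: "'w measure \<Rightarrow> ('w \<Rightarrow> 'h::real_normed_vector) \<Rightarrow> real" where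
  "L2_norm M g = sqrt (\<integral>\<omega>. (norm (g \<omega>))\<^sup>2 \<partial>M)"

text \<open>
  Elements of \<open>L\<^sup>2(\<Omega>, F\<^sub>\<tau>; H)\<close> are classes of almost surely equal random variables.  Under the
  usual conditions all members of the class of an \<open>F\<^sub>\<tau>\<close>-measurable function are
  \<open>F\<^sub>\<tau>\<close>-measurable, so that the spaces increase with \<open>\<tau>\<close>.
\<close>

definition ae_class :: "'w measure \<Rightarrow> ('w \<Rightarrow> 'h::topological_space) \<Rightarrow> ('w \<Rightarrow> 'h) set" where
  "ae_class M g = {g' \<in> borel_measurable M. AE \<omega> in M. g' \<omega> = g \<omega>}"

definition L2_space ::
    "'w measure \<Rightarrow> 'w measure \<Rightarrow>
     ('w \<Rightarrow> 'h::{real_normed_vector, second_countable_topology}) set set" where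
  "L2_space M F\<^sub>0 = ae_class M ` L2_fun M F\<^sub>0"

definition class_norm :: "'w measure \<Rightarrow> ('w \<Rightarrow> 'h::real_normed_vector) set \<Rightarrow> real" where
  "class_norm M X = L2_norm M (SOME g. g \<in> X)"

text \<open>
  The continuous linear functionals, given on representatives; by boundedness they are constant on
  classes.
\<close>

definition L2_functional ::
    "'w measure \<Rightarrow> 'w measure \<Rightarrow>
     (('w \<Rightarrow> 'h::{real_normed_vector, second_countable_topology}) \<Rightarrow> real) \<Rightarrow> bool" where
  "L2_functional M F\<^sub>0 \<psi> \<longleftrightarrow>
     (\<forall>g\<in>L2_fun M F\<^sub>0. \<forall>g'\<in>L2_fun M F\<^sub>0. \<psi> (\<lambda>\<omega>. g \<omega> + g' \<omega>) = \<psi> g + \<psi> g') \<and>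
     (\<forall>c. \<forall>g\<in>L2_fun M F\<^sub>0. \<psi> (\<lambda>\<omega>. c *\<^sub>R g \<omega>) = c * \<psi> g) \<and>
     (\<exists>C. \<forall>g\<in>L2_fun M F\<^sub>0. \<bar>\<psi> g\<bar> \<le> C * L2_norm M g)"

definition weak_topology ::
    "'w measure \<Rightarrow> 'w measure \<Rightarrow>
     ('w \<Rightarrow> 'h::{real_normed_vector, second_countable_topology}) set topology" where
  "weak_topology M F\<^sub>0 =
     topology_generated_by
       {ae_class M ` {g \<in> L2_fun M F\<^sub>0. \<psi> g \<in> E} | \<psi> E. L2_functional M F\<^sub>0 \<psi> \<and> open E}"


section \<open>Mean random dynamical systems and weak pullback attractors\<close>

text \<open>
  The argument \<open>sol \<tau> \<xi> u\<close> means that \<open>u\<close> is a solution with initial value \<open>\<xi>\<close> at time \<open>\<tau>\<close>.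
\<close>

definition well_posed ::
    "'w measure \<Rightarrow> (real \<Rightarrow> 'w measure) \<Rightarrow>
     (real \<Rightarrow> ('w \<Rightarrow> 'h::{real_normed_vector, second_countable_topology}) \<Rightarrow>
        (real \<Rightarrow> 'w \<Rightarrow> 'h) \<Rightarrow> bool) \<Rightarrow> bool" where
  "well_posed M F sol \<longleftrightarrow>
     (\<forall>\<tau>. \<forall>\<xi>\<in>L2_fun M (F \<tau>).
        (\<exists>u. sol \<tau> \<xi> u) \<and>
        (\<forall>u u'. sol \<tau> \<xi> u \<and> sol \<tau> \<xi> u' \<longrightarrow> (AE \<omega> in M. \<forall>t\<ge>\<tau>. u t \<omega> = u' t \<omega>)) \<and>
        (\<forall>u. sol \<tau> \<xi> u \<longrightarrow> (\<forall>t\<ge>\<tau>. u t \<in> L2_fun M (F t))))"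

definition solution_map ::
    "'w measure \<Rightarrow> (real \<Rightarrow> 'w measure) \<Rightarrow>
     (real \<Rightarrow> ('w \<Rightarrow> 'h::{real_normed_vector, second_countable_topology}) \<Rightarrow>
        (real \<Rightarrow> 'w \<Rightarrow> 'h) \<Rightarrow> bool) \<Rightarrow>
     real \<Rightarrow> real \<Rightarrow> ('w \<Rightarrow> 'h) set \<Rightarrow> ('w \<Rightarrow> 'h) set" where
  "solution_map M F sol t \<tau> X =
     (let \<xi> = (SOME \<xi>. \<xi> \<in> X \<and> \<xi> \<in> L2_fun M (F \<tau>)); u = (SOME u. sol \<tau> \<xi> u)
      in ae_class M (u (t + \<tau>)))"

definition mean_random_dynamical_system ::
    "'w measure \<Rightarrow> (real \<Rightarrow> 'w measure) \<Rightarrow>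
     (real \<Rightarrow> real \<Rightarrow> ('w \<Rightarrow> 'h::{real_normed_vector, second_countable_topology}) set \<Rightarrow>
        ('w \<Rightarrow> 'h) set) \<Rightarrow> bool" where
  "mean_random_dynamical_system M F \<Phi> \<longleftrightarrow>
     (\<forall>t\<ge>0. \<forall>\<tau>. \<Phi> t \<tau> ` L2_space M (F \<tau>) \<subseteq> L2_space M (F (t + \<tau>))) \<and>
     (\<forall>\<tau>. \<forall>X\<in>L2_space M (F \<tau>). \<Phi> 0 \<tau> X = X) \<and>
     (\<forall>s\<ge>0. \<forall>t\<ge>0. \<forall>\<tau>. \<forall>X\<in>L2_space M (F \<tau>). \<Phi> (t + s) \<tau> X = \<Phi> t (s + \<tau>) (\<Phi> s \<tau> X))"

definition pullback_universe ::
    "'w measure \<Rightarrow> (real \<Rightarrow> 'w measure) \<Rightarrow> real \<Rightarrow>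
     (real \<Rightarrow> ('w \<Rightarrow> 'h::{real_normed_vector, second_countable_topology}) set set) set" where
  "pullback_universe M F \<kappa> =
     {D. (\<forall>\<tau>. D \<tau> \<subseteq> L2_space M (F \<tau>) \<and> D \<tau> \<noteq> {} \<and> bdd_above (class_norm M ` D \<tau>)) \<and>
         ((\<lambda>\<tau>. exp (\<kappa> * \<tau>) * (SUP X\<in>D \<tau>. class_norm M X)\<^sup>2) \<longlongrightarrow> 0) at_bot}"

definition weakly_attracting ::
    "'w measure \<Rightarrow> (real \<Rightarrow> 'w measure) \<Rightarrow>
     (real \<Rightarrow> ('w \<Rightarrow> 'h::{real_normed_vector, second_countable_topology}) set set) set \<Rightarrow>
     (real \<Rightarrow> real \<Rightarrow> ('w \<Rightarrow> 'h) set \<Rightarrow> ('w \<Rightarrow> 'h) set) \<Rightarrow>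
     (real \<Rightarrow> ('w \<Rightarrow> 'h) set set) \<Rightarrow> bool" where
  "weakly_attracting M F \<DD> \<Phi> \<A> \<longleftrightarrow>
     (\<forall>\<tau>. \<forall>D\<in>\<DD>. \<forall>\<N>.
        (\<exists>O'. openin (weak_topology M (F \<tau>)) O' \<and> \<A> \<tau> \<subseteq> O' \<and> O' \<subseteq> \<N>) \<longrightarrow>
        (\<exists>T>0. \<forall>t\<ge>T. \<Phi> t (\<tau> - t) ` D (\<tau> - t) \<subseteq> \<N>))"

definition weak_pullback_attractor ::
    "'w measure \<Rightarrow> (real \<Rightarrow> 'w measure) \<Rightarrow>
     (real \<Rightarrow> ('w \<Rightarrow> 'h::{real_normed_vector, second_countable_topology}) set set) set \<Rightarrow>
     (real \<Rightarrow> real \<Rightarrow> ('w \<Rightarrow> 'h) set \<Rightarrow> ('w \<Rightarrow> 'h) set) \<Rightarrow>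
     (real \<Rightarrow> ('w \<Rightarrow> 'h) set set) \<Rightarrow> bool" where
  "weak_pullback_attractor M F \<DD> \<Phi> \<A> \<longleftrightarrow>
     \<A> \<in> \<DD> \<and>
     (\<forall>\<tau>. compactin (weak_topology M (F \<tau>)) (\<A> \<tau>)) \<and>
     weakly_attracting M F \<DD> \<Phi> \<A> \<and>
     (\<forall>E\<in>\<DD>. (\<forall>\<tau>. compactin (weak_topology M (F \<tau>)) (E \<tau>)) \<and> weakly_attracting M F \<DD> \<Phi> E \<longrightarrow>
        (\<forall>\<tau>. \<A> \<tau> \<subseteq> E \<tau>))"

definition weakly_compact_absorbing ::
    "'w measure \<Rightarrow> (real \<Rightarrow> 'w measure) \<Rightarrow>
     (real \<Rightarrow> ('w \<Rightarrow> 'h::{real_normed_vector, second_countable_topology}) set set) set \<Rightarrow>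
     (real \<Rightarrow> real \<Rightarrow> ('w \<Rightarrow> 'h) set \<Rightarrow> ('w \<Rightarrow> 'h) set) \<Rightarrow>
     (real \<Rightarrow> ('w \<Rightarrow> 'h) set set) \<Rightarrow> bool" where
  "weakly_compact_absorbing M F \<DD> \<Phi> K \<longleftrightarrow>
     K \<in> \<DD> \<and>
     (\<forall>\<tau>. compactin (weak_topology M (F \<tau>)) (K \<tau>)) \<and>
     (\<forall>\<tau>. \<forall>D\<in>\<DD>. \<exists>T>0. \<forall>t\<ge>T. \<Phi> t (\<tau> - t) ` D (\<tau> - t) \<subseteq> K \<tau>)"

end

theory Submission
  imports Defs
begin

text \<open>
  Closed balls of the Hilbert space \<open>L\<^sup>2(\<Omega>, F\<^sub>\<tau>; H)\<close> are weakly compact, and \<open>K(\<tau>)\<close> is such a ball,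
  so that the omega-limit sets of \<open>K\<close> under a cocycle are nonempty, weakly compact and attracting,
  and they are minimal because the weak topology is Hausdorff.  The cocycle property amounts to
  restarting a solution at a later time: the approximating simple integrands are cut off at the new
  initial time, which subtracts from each stochastic integral its value there, and uniqueness of
  solutions identifies the restarted path with the one chosen by the solution map.
\<close>


section \<open>Weak compactness in \<open>L\<^sup>2\<close>\<close>

text \<open>\<open>L2_space M (F \<tau>)\<close> is a set of almost sure classes that varies with
  \<tau>, not a type, so the Hilbert space arguments are carried out on representatives. It need not
  be separable, so weak compactness is proved for arbitrary open covers and not through sequences or
  coordinates; there a functional is used only through linearity and boundedness, never through a
  representing vector. An attractor is required here to be minimal rather than invariant, so no weak
  continuity of \<Phi> enters: absorption, the cocycle law and compactness suffice. Two details
  shape the restart argument. Elementary integrands live on half-open intervals, so the cut-off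
  integrand agrees with the original one only after the new initial time, and that single time has
  to be discarded as a null set. The values of a random measure can be subtracted only where they
  are finite, which holds almost surely, entry by entry, for the strips of the approximating
  integrands.\<close>

lemma quadratic_nonneg_imp:
  fixes a b d :: real
  assumes quad: "\<And>c. 0 \<le> a + 2 * (c * b) + c\<^sup>2 * d" and d: "0 \<le> d"
  shows "b\<^sup>2 \<le> a * d"
proof (cases "d = 0")
  case True
  have "b = 0"
  proof (rule ccontr)
    assume "b \<noteq> 0"
    \<comment> \<open>For d = 0 the expression is affine in c; with a nonzero slope b this choice of
      c would push it down to -a - 2 < 0.\<close>
    then have "a + 2 * (- (a + 1) / b * b) = - a - 2" by simp
    moreover have "0 \<le> a" using quad[of 0] by simp
    ultimately show False using quad[of "- (a + 1) / b"] True by simp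
  qed
  then show ?thesis using True by simp
next
  case False
  with d have "0 < d" by simp
  \<comment> \<open>The value at the minimiser c = -b/d of the parabola.\<close>
  moreover have "a + 2 * (- b / d * b) + (- b / d)\<^sup>2 * d = a - b\<^sup>2 / d"
    using False by (simp add: power2_eq_square)
  ultimately have "0 < d" "b\<^sup>2 / d \<le> a" using quad[of "- b / d"] by simp_all
  then show ?thesis by (simp add: pos_divide_le_eq)
qed

lemma class_norm_nonneg: "0 \<le> class_norm M X"
  by (simp add: class_norm_def L2_norm_def)

locale prob_subalgebra = prob_space M for M :: "'w measure" +
  fixes F\<^sub>0 :: "'w measure"
  assumes subalg: "subalgebra M F\<^sub>0"
begin

section \<open>Inner product and norm of square integrable random variables\<close>

lemma L2_fun_borel:
  fixes g :: "'w \<Rightarrow> 'h::{real_inner, banach, second_countable_topology}"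
  assumes "g \<in> L2_fun M F\<^sub>0"
  shows "g \<in> borel_measurable M"
  using assms measurable_from_subalg[OF subalg] by (auto simp: L2_fun_def)

lemma L2_fun_integrable:
  fixes g :: "'w \<Rightarrow> 'h::{real_inner, banach, second_countable_topology}"
  assumes "g \<in> L2_fun M F\<^sub>0"
  shows "integrable M (\<lambda>\<omega>. (norm (g \<omega>))\<^sup>2)"
  using assms by (auto simp: L2_fun_def)

lemma L2_fun_inner_integrable:
  fixes g g' :: "'w \<Rightarrow> 'h::{real_inner, banach, second_countable_topology}"
  assumes g: "g \<in> L2_fun M F\<^sub>0" and g': "g' \<in> L2_fun M F\<^sub>0"
  shows "integrable M (\<lambda>\<omega>. g \<omega> \<bullet> g' \<omega>)"
proof (rule Bochner_Integration.integrable_bound)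
  show "integrable M (\<lambda>\<omega>. (norm (g \<omega>))\<^sup>2 + (norm (g' \<omega>))\<^sup>2)"
    using L2_fun_integrable[OF g] L2_fun_integrable[OF g'] by (rule Bochner_Integration.integrable_add)
  show "(\<lambda>\<omega>. g \<omega> \<bullet> g' \<omega>) \<in> borel_measurable M"
    using L2_fun_borel[OF g] L2_fun_borel[OF g'] by (rule borel_measurable_inner)
  have "\<bar>x \<bullet> y\<bar> \<le> (norm x)\<^sup>2 + (norm y)\<^sup>2" for x y :: 'h
  proof -
    have "2 * (norm x * norm y) \<le> (norm x)\<^sup>2 + (norm y)\<^sup>2"
      using sum_squares_bound[of "norm x" "norm y"] by (simp add: mult.assoc)
    moreover have "0 \<le> norm x * norm y" by simp
    ultimately show ?thesis using Cauchy_Schwarz_ineq2[of x y] by linarith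
  qed
  then show "AE \<omega> in M. norm (g \<omega> \<bullet> g' \<omega>) \<le> norm ((norm (g \<omega>))\<^sup>2 + (norm (g' \<omega>))\<^sup>2)"
    by auto
qed

lemma L2_fun_zero: "(\<lambda>_. 0::'h::{real_inner, banach, second_countable_topology}) \<in> L2_fun M F\<^sub>0"
  by (simp add: L2_fun_def)

lemma L2_fun_scaleR:
  fixes g :: "'w \<Rightarrow> 'h::{real_inner, banach, second_countable_topology}"
  assumes "g \<in> L2_fun M F\<^sub>0"
  shows "(\<lambda>\<omega>. c *\<^sub>R g \<omega>) \<in> L2_fun M F\<^sub>0"
proof -
  have "(\<lambda>\<omega>. c *\<^sub>R g \<omega>) \<in> borel_measurable F\<^sub>0"
    using assms by (auto simp: L2_fun_def)
  moreover have "integrable M (\<lambda>\<omega>. c\<^sup>2 * (norm (g \<omega>))\<^sup>2)"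
    using L2_fun_integrable[OF assms] by (rule integrable_mult_right)
  ultimately show ?thesis by (simp add: L2_fun_def power_mult_distrib)
qed

lemma L2_fun_add:
  fixes g g' :: "'w \<Rightarrow> 'h::{real_inner, banach, second_countable_topology}"
  assumes g: "g \<in> L2_fun M F\<^sub>0" and g': "g' \<in> L2_fun M F\<^sub>0"
  shows "(\<lambda>\<omega>. g \<omega> + g' \<omega>) \<in> L2_fun M F\<^sub>0"
proof -
  have "(norm (g \<omega> + g' \<omega>))\<^sup>2 = (norm (g \<omega>))\<^sup>2 + 2 * (g \<omega> \<bullet> g' \<omega>) + (norm (g' \<omega>))\<^sup>2" for \<omega>
    by (simp add: power2_norm_eq_inner inner_add inner_commute)
  then show ?thesis
    using L2_fun_inner_integrable[OF g g'] g g' by (auto simp: L2_fun_def)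
qed

lemma L2_fun_diff:
  fixes g g' :: "'w \<Rightarrow> 'h::{real_inner, banach, second_countable_topology}"
  assumes "g \<in> L2_fun M F\<^sub>0" and "g' \<in> L2_fun M F\<^sub>0"
  shows "(\<lambda>\<omega>. g \<omega> - g' \<omega>) \<in> L2_fun M F\<^sub>0"
  using L2_fun_add[OF assms(1) L2_fun_scaleR[OF assms(2), of "-1"]] by simp

lemma L2_norm_nonneg: "0 \<le> L2_norm M (g :: 'w \<Rightarrow> 'h::real_normed_vector)"
  by (simp add: L2_norm_def)

lemma L2_norm_square: "(L2_norm M (g :: 'w \<Rightarrow> 'h::real_normed_vector))\<^sup>2 = (\<integral>\<omega>. (norm (g \<omega>))\<^sup>2 \<partial>M)"
  by (simp add: L2_norm_def)

lemma L2_norm_scaleR: "L2_norm M (\<lambda>\<omega>. c *\<^sub>R (g \<omega> :: 'h::real_normed_vector)) = \<bar>c\<bar> * L2_norm M g"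
  by (simp add: L2_norm_def power_mult_distrib real_sqrt_mult)

lemma L2_norm_minus_commute: "L2_norm M (\<lambda>\<omega>. g \<omega> - g' \<omega> :: 'h::real_normed_vector) = L2_norm M (\<lambda>\<omega>. g' \<omega> - g \<omega>)"
  by (simp add: L2_norm_def norm_minus_commute)

lemma L2_norm_add_square:
  fixes g g' :: "'w \<Rightarrow> 'h::{real_inner, banach, second_countable_topology}"
  assumes g: "g \<in> L2_fun M F\<^sub>0" and g': "g' \<in> L2_fun M F\<^sub>0"
  shows "(L2_norm M (\<lambda>\<omega>. g \<omega> + g' \<omega>))\<^sup>2 =
    (L2_norm M g)\<^sup>2 + 2 * (\<integral>\<omega>. g \<omega> \<bullet> g' \<omega> \<partial>M) + (L2_norm M g')\<^sup>2"
proof -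
  have "(norm (g \<omega> + g' \<omega>))\<^sup>2 = (norm (g \<omega>))\<^sup>2 + 2 * (g \<omega> \<bullet> g' \<omega>) + (norm (g' \<omega>))\<^sup>2" for \<omega>
    by (simp add: power2_norm_eq_inner inner_add inner_commute)
  then show ?thesis
    using L2_fun_inner_integrable[OF g g'] L2_fun_integrable[OF g] L2_fun_integrable[OF g']
    by (simp add: L2_norm_square)
qed

text \<open>Solved for the difference, because it serves to show that two almost norm-minimal
  elements of a convex set are close.\<close>

lemma L2_parallelogram:
  fixes g g' :: "'w \<Rightarrow> 'h::{real_inner, banach, second_countable_topology}"
  assumes g: "g \<in> L2_fun M F\<^sub>0" and g': "g' \<in> L2_fun M F\<^sub>0"
  shows "(L2_norm M (\<lambda>\<omega>. g \<omega> - g' \<omega>))\<^sup>2 =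
    2 * (L2_norm M g)\<^sup>2 + 2 * (L2_norm M g')\<^sup>2 - (L2_norm M (\<lambda>\<omega>. g \<omega> + g' \<omega>))\<^sup>2"
  using L2_norm_add_square[OF assms] L2_norm_add_square[OF g L2_fun_scaleR[OF g', of "-1"]]
    L2_norm_scaleR[of "-1" g']
  by simp

text \<open>The discriminant bound for the nonnegative quadratic polynomial c \<mapsto> ||g + c
  g'||^2.\<close>

lemma L2_Cauchy_Schwarz:
  fixes g g' :: "'w \<Rightarrow> 'h::{real_inner, banach, second_countable_topology}"
  assumes g: "g \<in> L2_fun M F\<^sub>0" and g': "g' \<in> L2_fun M F\<^sub>0"
  shows "\<bar>\<integral>\<omega>. g \<omega> \<bullet> g' \<omega> \<partial>M\<bar> \<le> L2_norm M g * L2_norm M g'"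
proof -
  let ?a = "(L2_norm M g)\<^sup>2" and ?b = "\<integral>\<omega>. g \<omega> \<bullet> g' \<omega> \<partial>M" and ?d = "(L2_norm M g')\<^sup>2"
  have quad: "0 \<le> ?a + 2 * (c * ?b) + c\<^sup>2 * ?d" for c
  proof -
    have "0 \<le> (L2_norm M (\<lambda>\<omega>. g \<omega> + c *\<^sub>R g' \<omega>))\<^sup>2" by simp
    also have "\<dots> = ?a + 2 * (c * ?b) + c\<^sup>2 * ?d"
      using L2_norm_add_square[OF g L2_fun_scaleR[OF g', of c]]
      by (simp add: L2_norm_scaleR power_mult_distrib)
    finally show ?thesis .
  qed
  have "?b\<^sup>2 \<le> ?a * ?d"
    by (rule quadratic_nonneg_imp) (use quad in auto)
  then have "\<bar>?b\<bar>\<^sup>2 \<le> (L2_norm M g * L2_norm M g')\<^sup>2" by (simp add: power_mult_distrib)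
  then show ?thesis
    by (rule power2_le_imp_le) (simp add: L2_norm_nonneg)
qed

lemma L2_norm_triangle:
  fixes g g' :: "'w \<Rightarrow> 'h::{real_inner, banach, second_countable_topology}"
  assumes g: "g \<in> L2_fun M F\<^sub>0" and g': "g' \<in> L2_fun M F\<^sub>0"
  shows "L2_norm M (\<lambda>\<omega>. g \<omega> + g' \<omega>) \<le> L2_norm M g + L2_norm M g'"
proof (rule power2_le_imp_le)
  show "(L2_norm M (\<lambda>\<omega>. g \<omega> + g' \<omega>))\<^sup>2 \<le> (L2_norm M g + L2_norm M g')\<^sup>2"
    using L2_Cauchy_Schwarz[OF assms] L2_norm_add_square[OF assms] by (simp add: power2_sum)
qed (simp add: L2_norm_nonneg)

text \<open>Cauchy-Schwarz against the constant 1, whose norm is 1 on a probability space. This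
  bound turns geometric decay of L^2 norms into pointwise summability in
  \<open>L2_complete\<close>.\<close>

lemma L2_fun_integrable_norm:
  fixes g :: "'w \<Rightarrow> 'h::{real_inner, banach, second_countable_topology}"
  assumes g: "g \<in> L2_fun M F\<^sub>0"
  shows "integrable M (\<lambda>\<omega>. norm (g \<omega>))" "(\<integral>\<omega>. norm (g \<omega>) \<partial>M) \<le> L2_norm M g"
proof -
  have n: "(\<lambda>\<omega>. norm (g \<omega>)) \<in> L2_fun M F\<^sub>0" and one: "(\<lambda>\<omega>. 1::real) \<in> L2_fun M F\<^sub>0"
    using g by (auto simp: L2_fun_def)
  show "integrable M (\<lambda>\<omega>. norm (g \<omega>))"
    using L2_fun_inner_integrable[OF n one] by simp
  show "(\<integral>\<omega>. norm (g \<omega>) \<partial>M) \<le> L2_norm M g"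
    using L2_Cauchy_Schwarz[OF n one] by (simp add: L2_norm_def prob_space)
qed

lemma L2_norm_AE_cong:
  fixes g g' :: "'w \<Rightarrow> 'h::{real_normed_vector, second_countable_topology}"
  assumes "g \<in> borel_measurable M" "g' \<in> borel_measurable M" "AE \<omega> in M. g \<omega> = g' \<omega>"
  shows "L2_norm M g = L2_norm M g'"
  unfolding L2_norm_def
  by (intro arg_cong[of _ _ sqrt] integral_cong_AE) (use assms in auto)

text \<open>The Riesz-Fischer argument: a rapidly Cauchy subsequence converges almost surely, and
  Fatou's lemma identifies its limit as the norm limit of the whole sequence.\<close>

lemma L2_complete:
  fixes g :: "nat \<Rightarrow> 'w \<Rightarrow> 'h::{real_inner, banach, second_countable_topology}"
  assumes g: "\<And>n. g n \<in> L2_fun M F\<^sub>0"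
    and Cauchy: "\<And>e. e > 0 \<Longrightarrow> \<exists>N. \<forall>m\<ge>N. \<forall>n\<ge>N. L2_norm M (\<lambda>\<omega>. g m \<omega> - g n \<omega>) < e"
  shows "\<exists>g\<^sub>0\<in>L2_fun M F\<^sub>0. (\<lambda>n. L2_norm M (\<lambda>\<omega>. g n \<omega> - g\<^sub>0 \<omega>)) \<longlonglongrightarrow> 0"
proof -
  have gM[measurable]: "g n \<in> borel_measurable M" for n by (rule L2_fun_borel[OF g])
  have "\<forall>k. \<exists>N. \<forall>m\<ge>N. \<forall>n\<ge>N. L2_norm M (\<lambda>\<omega>. g m \<omega> - g n \<omega>) < (1/2) ^ k"
    using Cauchy by simp
  then obtain N where N: "\<And>k m n. m \<ge> N k \<Longrightarrow> n \<ge> N k \<Longrightarrow> L2_norm M (\<lambda>\<omega>. g m \<omega> - g n \<omega>) < (1/2) ^ k"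
    by metis
  \<comment> \<open>The running maximum makes the indices monotone and keeps each of them beyond its
    own threshold \<open>N k\<close>.\<close>
  define r where "r k = Max (N ` {..k})" for k
  have rN: "r k \<ge> N k" for k unfolding r_def by (intro Max_ge) auto
  have r_mono: "r k \<le> r l" if "k \<le> l" for k l
    unfolding r_def using that by (intro Max_mono) auto
  define d where "d k \<omega> = g (r (Suc k)) \<omega> - g (r k) \<omega>" for k \<omega>
  have dL2: "d k \<in> L2_fun M F\<^sub>0" for k
    unfolding d_def[abs_def] by (rule L2_fun_diff[OF g g])
  have d_bound: "(\<integral>\<omega>. norm (d k \<omega>) \<partial>M) \<le> (1/2) ^ k" for k
  proof -
    have "(\<integral>\<omega>. norm (d k \<omega>) \<partial>M) \<le> L2_norm M (d k)" by (rule L2_fun_integrable_norm[OF dL2])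
    also have "\<dots> \<le> (1/2) ^ k"
      using N[of k "r (Suc k)" "r k"] rN[of k] r_mono[of k "Suc k"] by (simp add: d_def[abs_def])
    finally show ?thesis .
  qed
  have dM[measurable]: "d k \<in> borel_measurable M" for k by (rule L2_fun_borel[OF dL2])
  have "(\<integral>\<^sup>+\<omega>. (\<Sum>k. ennreal (norm (d k \<omega>))) \<partial>M) = (\<Sum>k. \<integral>\<^sup>+\<omega>. ennreal (norm (d k \<omega>)) \<partial>M)"
    by (rule nn_integral_suminf) measurable
  also have "\<dots> \<le> (\<Sum>k. ennreal ((1/2) ^ k))"
  proof (rule suminf_le)
    show "(\<integral>\<^sup>+\<omega>. ennreal (norm (d k \<omega>)) \<partial>M) \<le> ennreal ((1/2) ^ k)" for k
      using d_bound[of k] nn_integral_eq_integral[OF L2_fun_integrable_norm(1)[OF dL2[of k]]]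
      by (simp add: ennreal_leI)
  qed auto
  also have "\<dots> = ennreal (\<Sum>k. (1/2) ^ k)"
    by (rule suminf_ennreal2) (auto intro: summable_geometric)
  finally have "(\<integral>\<^sup>+\<omega>. (\<Sum>k. ennreal (norm (d k \<omega>))) \<partial>M) \<noteq> \<infinity>"
    by (auto simp: top_unique)
  then have "AE \<omega> in M. (\<Sum>k. ennreal (norm (d k \<omega>))) \<noteq> \<infinity>"
    by (rule nn_integral_PInf_AE[rotated]) measurable
  then have "AE \<omega> in M. (\<lambda>k. g (r k) \<omega>) \<longlonglongrightarrow> lim (\<lambda>k. g (r k) \<omega>)"
  proof eventually_elim
    case (elim \<omega>)
    have "summable (\<lambda>k. norm (d k \<omega>))"
      using elim by (intro summable_suminf_not_top) auto
    then have "summable (\<lambda>k. d k \<omega>)" by (rule summable_norm_cancel)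
    then have "convergent (\<lambda>n. \<Sum>k<n. d k \<omega>)" by (simp add: summable_iff_convergent)
    then have "convergent (\<lambda>n. g (r n) \<omega> - g (r 0) \<omega>)"
      using sum_lessThan_telescope[of "\<lambda>n. g (r n) \<omega>"] by (simp add: d_def)
    then have "convergent (\<lambda>n. (g (r n) \<omega> - g (r 0) \<omega>) + g (r 0) \<omega>)"
      by (intro convergent_add convergent_const)
    then show ?case by (simp add: convergent_LIMSEQ_iff)
  qed
  \<comment> \<open>Taking \<open>lim\<close> at every point, with its fixed default value where the
    sequence diverges, keeps the limit measurable for the smaller \<sigma>-algebra without
    modification on a null set.\<close>
  moreover define g\<^sub>0 where "g\<^sub>0 \<omega> = lim (\<lambda>k. g (r k) \<omega>)" for \<omega>
  ultimately have lim: "AE \<omega> in M. (\<lambda>k. g (r k) \<omega>) \<longlonglongrightarrow> g\<^sub>0 \<omega>" by simp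
  have g0F: "g\<^sub>0 \<in> borel_measurable F\<^sub>0"
    unfolding g\<^sub>0_def[abs_def] using g by (intro borel_measurable_lim_metric) (auto simp: L2_fun_def)
  then have g0M[measurable]: "g\<^sub>0 \<in> borel_measurable M" by (rule measurable_from_subalg[OF subalg])
  \<comment> \<open>Here n is any index beyond \<open>N k\<close>, not only one of the subsequence:
    Fatou's lemma is applied in l to the differences with \<open>g (r l)\<close>.\<close>
  have Fatou: "(\<integral>\<^sup>+\<omega>. ennreal ((norm (g n \<omega> - g\<^sub>0 \<omega>))\<^sup>2) \<partial>M) \<le> ennreal (((1/2) ^ k)\<^sup>2)" if n: "n \<ge> N k" for n k
  proof -
    have "(\<integral>\<^sup>+\<omega>. ennreal ((norm (g n \<omega> - g\<^sub>0 \<omega>))\<^sup>2) \<partial>M)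
        = (\<integral>\<^sup>+\<omega>. liminf (\<lambda>l. ennreal ((norm (g n \<omega> - g (r l) \<omega>))\<^sup>2)) \<partial>M)"
    proof (rule nn_integral_cong_AE)
      show "AE \<omega> in M. ennreal ((norm (g n \<omega> - g\<^sub>0 \<omega>))\<^sup>2) = liminf (\<lambda>l. ennreal ((norm (g n \<omega> - g (r l) \<omega>))\<^sup>2))"
        using lim
      proof eventually_elim
        case (elim \<omega>)
        have "(\<lambda>l. ennreal ((norm (g n \<omega> - g (r l) \<omega>))\<^sup>2)) \<longlonglongrightarrow> ennreal ((norm (g n \<omega> - g\<^sub>0 \<omega>))\<^sup>2)"
          by (intro tendsto_ennrealI tendsto_power tendsto_norm tendsto_diff tendsto_const elim)
        then show ?case by (rule lim_imp_Liminf[OF trivial_limit_sequentially, symmetric])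
      qed
    qed
    also have "\<dots> \<le> liminf (\<lambda>l. \<integral>\<^sup>+\<omega>. ennreal ((norm (g n \<omega> - g (r l) \<omega>))\<^sup>2) \<partial>M)"
      by (rule nn_integral_liminf) measurable
    also have "\<dots> \<le> liminf (\<lambda>l::nat. ennreal (((1/2) ^ k)\<^sup>2))"
    proof (rule Liminf_mono)
      have "(\<integral>\<^sup>+\<omega>. ennreal ((norm (g n \<omega> - g (r l) \<omega>))\<^sup>2) \<partial>M) \<le> ennreal (((1/2) ^ k)\<^sup>2)" if "l \<ge> k" for l
      proof -
        have "r l \<ge> N k" using rN[of k] r_mono[OF that] by linarith
        then have "(L2_norm M (\<lambda>\<omega>. g n \<omega> - g (r l) \<omega>))\<^sup>2 \<le> ((1/2) ^ k)\<^sup>2"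
          using N[OF n, of "r l"] by (intro power_mono) (auto simp: L2_norm_nonneg)
        then show ?thesis
          using nn_integral_eq_integral[OF L2_fun_integrable[OF L2_fun_diff[OF g[of n] g[of "r l"]]]]
          by (simp add: L2_norm_square ennreal_leI)
      qed
      then show "\<forall>\<^sub>F l in sequentially. (\<integral>\<^sup>+\<omega>. ennreal ((norm (g n \<omega> - g (r l) \<omega>))\<^sup>2) \<partial>M) \<le> ennreal (((1/2) ^ k)\<^sup>2)"
        by (auto simp: eventually_sequentially)
    qed
    also have "\<dots> = ennreal (((1/2) ^ k)\<^sup>2)"
      by (rule Liminf_const) simp
    finally show ?thesis .
  qed
  have diffL2: "(\<lambda>\<omega>. g n \<omega> - g\<^sub>0 \<omega>) \<in> L2_fun M F\<^sub>0" if "n \<ge> N k" for n k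
  proof -
    have "integrable M (\<lambda>\<omega>. (norm (g n \<omega> - g\<^sub>0 \<omega>))\<^sup>2)"
      using Fatou[OF that] by (intro integrableI_bounded) (auto simp: less_top[symmetric] top_unique)
    moreover have "(\<lambda>\<omega>. g n \<omega> - g\<^sub>0 \<omega>) \<in> borel_measurable F\<^sub>0"
      using g[of n] g0F by (intro borel_measurable_diff) (auto simp: L2_fun_def)
    ultimately show ?thesis by (simp add: L2_fun_def)
  qed
  \<comment> \<open>The limit is a member of the sequence minus a square integrable difference,
    hence square integrable itself.\<close>
  have "g\<^sub>0 \<in> L2_fun M F\<^sub>0"
    using L2_fun_diff[OF g[of "N 0"] diffL2[of 0 "N 0"]] by simp
  moreover have "(\<lambda>n. L2_norm M (\<lambda>\<omega>. g n \<omega> - g\<^sub>0 \<omega>)) \<longlonglongrightarrow> 0"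
  proof (rule LIMSEQ_I)
    fix e :: real assume "e > 0"
    then obtain k where k: "(1/2) ^ k < e" using real_arch_pow_inv[of e "1/2"] by auto
    have "norm (L2_norm M (\<lambda>\<omega>. g n \<omega> - g\<^sub>0 \<omega>) - 0) < e" if n: "n \<ge> N k" for n
    proof -
      have "ennreal ((L2_norm M (\<lambda>\<omega>. g n \<omega> - g\<^sub>0 \<omega>))\<^sup>2) \<le> ennreal (((1/2) ^ k)\<^sup>2)"
        using Fatou[OF n] nn_integral_eq_integral[OF L2_fun_integrable[OF diffL2[OF n]]]
        by (simp add: L2_norm_square)
      then have "(L2_norm M (\<lambda>\<omega>. g n \<omega> - g\<^sub>0 \<omega>))\<^sup>2 \<le> ((1/2) ^ k)\<^sup>2"
        by (subst (asm) ennreal_le_iff) auto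
      then have "L2_norm M (\<lambda>\<omega>. g n \<omega> - g\<^sub>0 \<omega>) \<le> (1/2) ^ k"
        by (rule power2_le_imp_le) simp
      then show ?thesis using k by (simp add: L2_norm_nonneg)
    qed
    then show "\<exists>n\<^sub>0. \<forall>n\<ge>n\<^sub>0. norm (L2_norm M (\<lambda>\<omega>. g n \<omega> - g\<^sub>0 \<omega>) - 0) < e" by blast
  qed
  ultimately show ?thesis by blast
qed

section \<open>Bounded linear functionals on representatives\<close>

lemma L2_functional_add:
  assumes "L2_functional M F\<^sub>0 \<psi>" "g \<in> L2_fun M F\<^sub>0" "g' \<in> L2_fun M F\<^sub>0"
  shows "\<psi> (\<lambda>\<omega>. g \<omega> + g' \<omega>) = \<psi> g + \<psi> g'"
proof -
  have "\<forall>g\<in>L2_fun M F\<^sub>0. \<forall>g'\<in>L2_fun M F\<^sub>0. \<psi> (\<lambda>\<omega>. g \<omega> + g' \<omega>) = \<psi> g + \<psi> g'"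
    using assms(1) unfolding L2_functional_def by (elim conjE)
  from bspec[OF bspec[OF this assms(2)] assms(3)] show ?thesis .
qed

lemma L2_functional_scaleR:
  assumes "L2_functional M F\<^sub>0 \<psi>" "g \<in> L2_fun M F\<^sub>0"
  shows "\<psi> (\<lambda>\<omega>. c *\<^sub>R g \<omega>) = c * \<psi> g"
proof -
  have "\<forall>c. \<forall>g\<in>L2_fun M F\<^sub>0. \<psi> (\<lambda>\<omega>. c *\<^sub>R g \<omega>) = c * \<psi> g"
    using assms(1) unfolding L2_functional_def by (elim conjE)
  from bspec[OF spec[OF this] assms(2)] show ?thesis .
qed

lemma L2_functional_diff:
  fixes g g' :: "'w \<Rightarrow> 'h::{real_inner, banach, second_countable_topology}"
  assumes "L2_functional M F\<^sub>0 \<psi>" "g \<in> L2_fun M F\<^sub>0" "g' \<in> L2_fun M F\<^sub>0"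
  shows "\<psi> (\<lambda>\<omega>. g \<omega> - g' \<omega>) = \<psi> g - \<psi> g'"
  using L2_functional_add[OF assms(1,2) L2_fun_scaleR[OF assms(3), of "-1"]]
    L2_functional_scaleR[OF assms(1,3), of "-1"] by simp

lemma L2_functional_bound:
  assumes "L2_functional M F\<^sub>0 \<psi>"
  shows "\<exists>C. \<forall>g\<in>L2_fun M F\<^sub>0. \<bar>\<psi> g\<bar> \<le> C * L2_norm M g"
  using assms unfolding L2_functional_def by (elim conjE)

text \<open>Lets an upper bound \<psi> < b be written as -\<psi> > -b, so that half-spaces of a
  single kind describe the weak topology.\<close>

lemma L2_functional_uminus:
  fixes \<psi> :: "('w \<Rightarrow> 'h::{real_inner, banach, second_countable_topology}) \<Rightarrow> real"
  assumes \<psi>: "L2_functional M F\<^sub>0 \<psi>"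
  shows "L2_functional M F\<^sub>0 (\<lambda>g. - \<psi> g)"
proof -
  from L2_functional_bound[OF \<psi>]
  obtain C where C: "\<forall>g\<in>L2_fun M F\<^sub>0. \<bar>\<psi> g\<bar> \<le> C * L2_norm M g" ..
  show ?thesis
    unfolding L2_functional_def
  proof (intro conjI ballI allI exI)
    fix g g' :: "'w \<Rightarrow> 'h" assume g: "g \<in> L2_fun M F\<^sub>0"
    show "\<bar>- \<psi> g\<bar> \<le> C * L2_norm M g" using bspec[OF C g] by (simp only: abs_minus_cancel)
    show "- \<psi> (\<lambda>\<omega>. c *\<^sub>R g \<omega>) = c * - \<psi> g" for c
      by (simp only: L2_functional_scaleR[OF \<psi> g] mult_minus_right)
    assume g': "g' \<in> L2_fun M F\<^sub>0"
    show "- \<psi> (\<lambda>\<omega>. g \<omega> + g' \<omega>) = - \<psi> g + - \<psi> g'"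
      by (simp only: L2_functional_add[OF \<psi> g g'] minus_add_distrib)
  qed
qed

text \<open>The difference has norm 0 and boundedness annihilates it. Functionals therefore descend
  to classes.\<close>

lemma L2_functional_AE_cong:
  fixes g g' :: "'w \<Rightarrow> 'h::{real_inner, banach, second_countable_topology}"
  assumes \<psi>: "L2_functional M F\<^sub>0 \<psi>" and g: "g \<in> L2_fun M F\<^sub>0" "g' \<in> L2_fun M F\<^sub>0"
    and eq: "AE \<omega> in M. g \<omega> = g' \<omega>"
  shows "\<psi> g = \<psi> g'"
proof -
  from L2_functional_bound[OF \<psi>]
  obtain C where C: "\<forall>g\<in>L2_fun M F\<^sub>0. \<bar>\<psi> g\<bar> \<le> C * L2_norm M g" ..
  from bspec[OF C L2_fun_diff[OF g]] have "\<bar>\<psi> g - \<psi> g'\<bar> \<le> C * L2_norm M (\<lambda>\<omega>. g \<omega> - g' \<omega>)"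
    by (simp add: L2_functional_diff[OF \<psi> g])
  also have "L2_norm M (\<lambda>\<omega>. g \<omega> - g' \<omega>) = L2_norm M (\<lambda>_. 0::'h)"
    using eq g by (intro L2_norm_AE_cong L2_fun_borel[OF L2_fun_diff]) auto
  finally show ?thesis by (simp add: L2_norm_def)
qed

text \<open>The easy half of the Riesz representation; it supplies enough functionals to separate
  classes.\<close>

lemma L2_functional_inner:
  fixes g' :: "'w \<Rightarrow> 'h::{real_inner, banach, second_countable_topology}"
  assumes g': "g' \<in> L2_fun M F\<^sub>0"
  shows "L2_functional M F\<^sub>0 (\<lambda>g. \<integral>\<omega>. g \<omega> \<bullet> g' \<omega> \<partial>M)"
  unfolding L2_functional_def
proof (intro conjI ballI allI exI)
  fix g g2 :: "'w \<Rightarrow> 'h" assume g: "g \<in> L2_fun M F\<^sub>0"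
  show "\<bar>\<integral>\<omega>. g \<omega> \<bullet> g' \<omega> \<partial>M\<bar> \<le> L2_norm M g' * L2_norm M g"
    using L2_Cauchy_Schwarz[OF g g'] by (simp add: mult.commute)
  show "(\<integral>\<omega>. (c *\<^sub>R g \<omega>) \<bullet> g' \<omega> \<partial>M) = c * (\<integral>\<omega>. g \<omega> \<bullet> g' \<omega> \<partial>M)" for c
    by simp
  assume g2: "g2 \<in> L2_fun M F\<^sub>0"
  show "(\<integral>\<omega>. (g \<omega> + g2 \<omega>) \<bullet> g' \<omega> \<partial>M) = (\<integral>\<omega>. g \<omega> \<bullet> g' \<omega> \<partial>M) + (\<integral>\<omega>. g2 \<omega> \<bullet> g' \<omega> \<partial>M)"
    using L2_fun_inner_integrable[OF g g'] L2_fun_inner_integrable[OF g2 g'] by (simp add: inner_add)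
qed

lemma L2_functional_tendsto:
  fixes g :: "nat \<Rightarrow> 'w \<Rightarrow> 'h::{real_inner, banach, second_countable_topology}"
  assumes \<psi>: "L2_functional M F\<^sub>0 \<psi>" and g: "\<And>n. g n \<in> L2_fun M F\<^sub>0" "g\<^sub>0 \<in> L2_fun M F\<^sub>0"
    and lim: "(\<lambda>n. L2_norm M (\<lambda>\<omega>. g n \<omega> - g\<^sub>0 \<omega>)) \<longlonglongrightarrow> 0"
  shows "(\<lambda>n. \<psi> (g n)) \<longlonglongrightarrow> \<psi> g\<^sub>0"
proof -
  from L2_functional_bound[OF \<psi>]
  obtain C where C: "\<forall>g\<in>L2_fun M F\<^sub>0. \<bar>\<psi> g\<bar> \<le> C * L2_norm M g" ..
  have *: "norm (\<psi> (g n) - \<psi> g\<^sub>0) \<le> C * L2_norm M (\<lambda>\<omega>. g n \<omega> - g\<^sub>0 \<omega>)" for n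
    unfolding real_norm_def L2_functional_diff[OF \<psi> g(1)[of n] g(2), symmetric]
    using C L2_fun_diff[OF g(1)[of n] g(2)] by (rule bspec)
  have "(\<lambda>n. C * L2_norm M (\<lambda>\<omega>. g n \<omega> - g\<^sub>0 \<omega>)) \<longlonglongrightarrow> 0"
    using tendsto_mult_left[OF lim, of C] by simp
  with * have "(\<lambda>n. \<psi> (g n) - \<psi> g\<^sub>0) \<longlonglongrightarrow> 0"
    by (rule Lim_null_comparison[OF always_eventually[OF allI]])
  then show ?thesis by (rule LIM_zero_cancel)
qed

text \<open>
  Near-minimal elements of the finite intersections form a Cauchy sequence by the parallelogram law,
  because midpoints stay in the intersection.  Perturbing that sequence by one more half-space does
  not change its limit, which therefore lies in all of them.
\<close>

lemma L2_halfspaces_finite_intersection: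
  fixes I :: "'i set" and \<psi> :: "'i \<Rightarrow> ('w \<Rightarrow> 'h::{real_inner, banach, second_countable_topology}) \<Rightarrow> real"
    and a :: "'i \<Rightarrow> real"
  assumes I: "\<And>i. i \<in> I \<Longrightarrow> L2_functional M F\<^sub>0 (\<psi> i)" and r: "0 \<le> r"
    and fin: "\<And>J. finite J \<Longrightarrow> J \<subseteq> I \<Longrightarrow> \<exists>g\<in>L2_fun M F\<^sub>0. L2_norm M g \<le> r \<and> (\<forall>i\<in>J. \<psi> i g \<le> a i)"
  shows "\<exists>g\<in>L2_fun M F\<^sub>0. L2_norm M g \<le> r \<and> (\<forall>i\<in>I. \<psi> i g \<le> a i)"
proof -
  define C where "C J = {g \<in> L2_fun M F\<^sub>0. \<forall>i\<in>J. \<psi> i g \<le> a i}" for J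
  \<comment> \<open>The squared distance of the convex set \<open>C J\<close> from the origin. It
    grows with \<open>J\<close> and stays below r^2 for finite \<open>J\<close>, so the supremum
    \<open>s\<close> is a genuine one.\<close>
  define d where "d J = Inf ((\<lambda>g. (L2_norm M g)\<^sup>2) ` C J)" for J
  define \<F> where "\<F> = {J. finite J \<and> J \<subseteq> I}"
  define s where "s = Sup (d ` \<F>)"
  have bdd: "bdd_below ((\<lambda>g. (L2_norm M g)\<^sup>2) ` C J)" for J by (rule bdd_belowI[of _ 0]) auto
  have d_le: "d J \<le> (L2_norm M g)\<^sup>2" if "g \<in> C J" for g J
    unfolding d_def using that bdd by (intro cInf_lower) auto
  have C_ne: "\<exists>g\<in>C J. (L2_norm M g)\<^sup>2 \<le> r\<^sup>2" if "J \<in> \<F>" for J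
  proof -
    have J: "finite J" "J \<subseteq> I" using that by (auto simp: \<F>_def)
    obtain g where g: "g \<in> L2_fun M F\<^sub>0" "L2_norm M g \<le> r" "\<forall>i\<in>J. \<psi> i g \<le> a i"
      using fin[OF J] by blast
    then have "g \<in> C J" unfolding C_def by blast
    then show ?thesis using power_mono[OF g(2) L2_norm_nonneg, of 2] by blast
  qed
  have d_r: "d J \<le> r\<^sup>2" if "J \<in> \<F>" for J
    using C_ne[OF that] d_le order_trans by blast
  have bdds: "bdd_above (d ` \<F>)" using d_r by (intro bdd_aboveI[of _ "r\<^sup>2"]) auto
  have Fne: "{} \<in> \<F>" by (simp add: \<F>_def)
  have d_s: "d J \<le> s" if "J \<in> \<F>" for J
    unfolding s_def using that bdds by (intro cSUP_upper)
  have s_r: "s \<le> r\<^sup>2" unfolding s_def using Fne d_r by (intro cSUP_least) auto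
  have near: "\<exists>g\<in>C J. (L2_norm M g)\<^sup>2 \<le> s + e" if "J \<in> \<F>" "e > 0" for J e
  proof -
    have "d J < s + e" using d_s[OF that(1)] that(2) by linarith
    moreover have "(\<lambda>g. (L2_norm M g)\<^sup>2) ` C J \<noteq> {}" using C_ne[OF that(1)] by blast
    ultimately have "\<exists>y\<in>(\<lambda>g. (L2_norm M g)\<^sup>2) ` C J. y < s + e"
      unfolding d_def by (intro cInf_lessD)
    then obtain g where "g \<in> C J" "(L2_norm M g)\<^sup>2 < s + e" by (elim bexE imageE) simp
    then show ?thesis by (intro bexI[of _ g]) simp_all
  qed
  have C_mono: "C J \<subseteq> C J'" if "J' \<subseteq> J" for J J' using that unfolding C_def by blast
  have d_mono: "d J' \<le> d J" if "J' \<subseteq> J" "J \<in> \<F>" for J J'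
    unfolding d_def using C_ne[OF that(2)] C_mono[OF that(1)] bdd
    by (intro cInf_superset_mono) auto
  \<comment> \<open>The midpoint lies in \<open>C J\<close>, so ||g + g'||^2 is at least 4 (s - e),
    and the parallelogram law leaves 4 (s + e) - 4 (s - e) = 8 e.\<close>
  have close: "(L2_norm M (\<lambda>\<omega>. g \<omega> - g' \<omega>))\<^sup>2 \<le> 8 * e"
    if J: "J \<in> \<F>" "s - e \<le> d J" and g: "g \<in> C J" "(L2_norm M g)\<^sup>2 \<le> s + e"
      and g': "g' \<in> C J" "(L2_norm M g')\<^sup>2 \<le> s + e" for J e g g'
  proof -
    have L2: "g \<in> L2_fun M F\<^sub>0" "g' \<in> L2_fun M F\<^sub>0" using g(1) g'(1) unfolding C_def by blast+
    have sum: "(\<lambda>\<omega>. g \<omega> + g' \<omega>) \<in> L2_fun M F\<^sub>0" by (rule L2_fun_add[OF L2])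
    have "(\<lambda>\<omega>. (1/2) *\<^sub>R (g \<omega> + g' \<omega>)) \<in> C J"
    proof -
      have "\<psi> i (\<lambda>\<omega>. (1/2) *\<^sub>R (g \<omega> + g' \<omega>)) \<le> a i" if "i \<in> J" for i
      proof -
        have \<psi>: "L2_functional M F\<^sub>0 (\<psi> i)" using I J(1) that by (auto simp: \<F>_def)
        have "\<psi> i g \<le> a i" "\<psi> i g' \<le> a i" using g(1) g'(1) that unfolding C_def by blast+
        then show ?thesis
          unfolding L2_functional_scaleR[OF \<psi> sum] L2_functional_add[OF \<psi> L2] by simp
      qed
      then show ?thesis using L2_fun_scaleR[OF sum] unfolding C_def by blast
    qed
    from d_le[OF this] have "d J \<le> (1/4) * (L2_norm M (\<lambda>\<omega>. g \<omega> + g' \<omega>))\<^sup>2"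
      by (simp add: L2_norm_scaleR[of "1/2"] power_mult_distrib power2_eq_square)
    then show ?thesis
      using L2_parallelogram[OF L2] J(2) g(2) g'(2) by linarith
  qed
  define e :: "nat \<Rightarrow> real" where "e n = 1 / Suc n" for n
  have e: "e n > 0" "e \<longlonglongrightarrow> 0" "n \<le> m \<Longrightarrow> e m \<le> e n" for n m
    using LIMSEQ_inverse_real_of_nat by (auto simp: e_def[abs_def] inverse_eq_divide frac_le)
  have "\<exists>J\<in>\<F>. s - e n < d J" for n
    using less_cSUP_iff[of \<F> d "s - e n"] bdds Fne e(1)[of n] unfolding s_def by auto
  then obtain J\<^sub>0 where J0: "\<And>n. J\<^sub>0 n \<in> \<F>" "\<And>n. s - e n < d (J\<^sub>0 n)" by metis
  \<comment> \<open>Unions make the index sets increasing, so each later \<open>g m\<close> still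
    lies in \<open>C (J n)\<close>. \<open>I\<close> may be uncountable; countably many indices are
    enough to produce the limit.\<close>
  define J where "J n = (\<Union>k\<le>n. J\<^sub>0 k)" for n
  have J: "J n \<in> \<F>" for n using J0(1) by (auto simp: J_def \<F>_def)
  have Jd: "s - e n \<le> d (J n)" for n
    using J0(2)[of n] d_mono[of "J\<^sub>0 n" "J n"] J[of n] by (force simp: J_def)
  have J_mono: "J n \<subseteq> J m" if "n \<le> m" for n m using that by (force simp: J_def)
  have "\<forall>n. \<exists>x. x \<in> C (J n) \<and> (L2_norm M x)\<^sup>2 \<le> s + e n"
    using near[OF J e(1)] by blast
  from choice[OF this] obtain g where "\<forall>n. g n \<in> C (J n) \<and> (L2_norm M (g n))\<^sup>2 \<le> s + e n" ..
  then have g: "\<And>n. g n \<in> C (J n)" "\<And>n. (L2_norm M (g n))\<^sup>2 \<le> s + e n" by simp_all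
  have gL2: "g n \<in> L2_fun M F\<^sub>0" for n using g(1)[of n] unfolding C_def by blast
  have "\<exists>N. \<forall>m\<ge>N. \<forall>n\<ge>N. L2_norm M (\<lambda>\<omega>. g m \<omega> - g n \<omega>) < \<epsilon>" if "\<epsilon> > 0" for \<epsilon>
  proof -
    have "(\<lambda>n. 8 * e n) \<longlonglongrightarrow> 0" using tendsto_mult_left[OF e(2), of 8] by simp
    then have "\<forall>\<^sub>F n in sequentially. 8 * e n < \<epsilon>\<^sup>2"
      by (rule order_tendstoD(2)) (use that in simp)
    then obtain N where N: "8 * e N < \<epsilon>\<^sup>2"
      using eventually_happens'[OF sequentially_bot] by blast
    have "L2_norm M (\<lambda>\<omega>. g m \<omega> - g n \<omega>) < \<epsilon>" if "m \<ge> N" "n \<ge> N" for m n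
    proof -
      have "(L2_norm M (\<lambda>\<omega>. g m \<omega> - g n \<omega>))\<^sup>2 \<le> 8 * e N"
      proof (rule close[OF J Jd])
        show "g m \<in> C (J N)" "g n \<in> C (J N)" using g(1) C_mono[OF J_mono] that by blast+
        show "(L2_norm M (g m))\<^sup>2 \<le> s + e N" "(L2_norm M (g n))\<^sup>2 \<le> s + e N"
          using g(2)[of m] g(2)[of n] e(3)[OF that(1)] e(3)[OF that(2)] by linarith+
      qed
      with N have "(L2_norm M (\<lambda>\<omega>. g m \<omega> - g n \<omega>))\<^sup>2 < \<epsilon>\<^sup>2" by linarith
      then show ?thesis by (rule power2_less_imp_less) (use \<open>\<epsilon> > 0\<close> in simp)
    qed
    then show ?thesis by blast
  qed
  from L2_complete[OF gL2 this] obtain g\<^sub>0 where g0: "g\<^sub>0 \<in> L2_fun M F\<^sub>0"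
      and lim: "(\<lambda>n. L2_norm M (\<lambda>\<omega>. g n \<omega> - g\<^sub>0 \<omega>)) \<longlonglongrightarrow> 0" by blast
  have "L2_norm M g\<^sub>0 \<le> sqrt (s + e n) + L2_norm M (\<lambda>\<omega>. g n \<omega> - g\<^sub>0 \<omega>)" for n
    using L2_norm_triangle[OF gL2[of n] L2_fun_diff[OF g0 gL2[of n]]]
      real_le_rsqrt[OF g(2)[of n]] L2_norm_minus_commute[of "g n" g\<^sub>0] by simp
  moreover have "(\<lambda>n. sqrt (s + e n) + L2_norm M (\<lambda>\<omega>. g n \<omega> - g\<^sub>0 \<omega>)) \<longlonglongrightarrow> sqrt (s + 0) + 0"
    by (intro tendsto_intros e(2) lim)
  ultimately have "L2_norm M g\<^sub>0 \<le> sqrt s"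
    by (intro LIMSEQ_le_const[of _ "sqrt s"]) auto
  also have "\<dots> \<le> r" using s_r r by (simp add: real_le_lsqrt real_sqrt_le_iff)
  finally have norm: "L2_norm M g\<^sub>0 \<le> r" .
  have "\<psi> i g\<^sub>0 \<le> a i" if i: "i \<in> I" for i
  proof -
    have Ji: "insert i (J n) \<in> \<F>" for n using J[of n] i by (auto simp: \<F>_def)
    \<comment> \<open>Since \<open>s\<close> also dominates \<open>d (insert i (J n))\<close>,
      near-minimal elements exist below the same level \<open>s + e n\<close>, and
      \<open>close\<close> compares them with \<open>g n\<close> inside
      \<open>C (J n)\<close>.\<close>
    have "\<forall>n. \<exists>x. x \<in> C (insert i (J n)) \<and> (L2_norm M x)\<^sup>2 \<le> s + e n"
      using near[OF Ji e(1)] by blast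
    from choice[OF this] obtain h where "\<forall>n. h n \<in> C (insert i (J n)) \<and> (L2_norm M (h n))\<^sup>2 \<le> s + e n" ..
    then have h: "\<And>n. h n \<in> C (insert i (J n))" "\<And>n. (L2_norm M (h n))\<^sup>2 \<le> s + e n" by simp_all
    have hL2: "h n \<in> L2_fun M F\<^sub>0" and ha: "\<psi> i (h n) \<le> a i" for n using h(1)[of n] unfolding C_def by blast+
    have hC: "h n \<in> C (J n)" for n using h(1)[of n] C_mono[OF subset_insertI] by blast
    have "L2_norm M (\<lambda>\<omega>. h n \<omega> - g\<^sub>0 \<omega>) \<le> sqrt (8 * e n) + L2_norm M (\<lambda>\<omega>. g n \<omega> - g\<^sub>0 \<omega>)" for n
      using L2_norm_triangle[OF L2_fun_diff[OF hL2[of n] gL2[of n]] L2_fun_diff[OF gL2[of n] g0]]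
        real_le_rsqrt[OF close[OF J Jd hC h(2) g(1) g(2), of n]] by simp
    note bound = this
    have "(\<lambda>n. sqrt (8 * e n) + L2_norm M (\<lambda>\<omega>. g n \<omega> - g\<^sub>0 \<omega>)) \<longlonglongrightarrow> sqrt (8 * 0) + 0"
      by (intro tendsto_intros e(2) lim)
    then have "(\<lambda>n. sqrt (8 * e n) + L2_norm M (\<lambda>\<omega>. g n \<omega> - g\<^sub>0 \<omega>)) \<longlonglongrightarrow> 0"
      unfolding real_sqrt_zero mult_zero_right add_0_right .
    then have "(\<lambda>n. L2_norm M (\<lambda>\<omega>. h n \<omega> - g\<^sub>0 \<omega>)) \<longlonglongrightarrow> 0"
      by (rule tendsto_sandwich[OF always_eventually always_eventually tendsto_const, rotated -1])
        (intro allI L2_norm_nonneg bound)+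
    from L2_functional_tendsto[OF I[OF i] hL2 g0 this] show ?thesis
      by (rule LIMSEQ_le_const2) (intro exI allI impI ha)
  qed
  then show ?thesis using g0 norm by blast
qed

section \<open>Almost sure classes and their weak topology\<close>

lemma ae_class_eq_iff:
  fixes g g' :: "'w \<Rightarrow> 'h::{real_inner, banach, second_countable_topology}"
  assumes [measurable]: "g \<in> borel_measurable M" "g' \<in> borel_measurable M"
  shows "ae_class M g = ae_class M g' \<longleftrightarrow> (AE \<omega> in M. g \<omega> = g' \<omega>)"
proof
  assume "ae_class M g = ae_class M g'"
  moreover have "g \<in> ae_class M g" by (simp add: ae_class_def)
  ultimately show "AE \<omega> in M. g \<omega> = g' \<omega>" by (simp add: ae_class_def)
next
  assume eq: "AE \<omega> in M. g \<omega> = g' \<omega>"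
  have "(AE \<omega> in M. g2 \<omega> = g \<omega>) \<longleftrightarrow> (AE \<omega> in M. g2 \<omega> = g' \<omega>)" for g2
  proof
    assume "AE \<omega> in M. g2 \<omega> = g \<omega>"
    with eq show "AE \<omega> in M. g2 \<omega> = g' \<omega>" by eventually_elim simp
  next
    assume "AE \<omega> in M. g2 \<omega> = g' \<omega>"
    with eq show "AE \<omega> in M. g2 \<omega> = g \<omega>" by eventually_elim simp
  qed
  then show "ae_class M g = ae_class M g'" by (simp add: ae_class_def)
qed

text \<open>Whatever representative \<open>SOME\<close> picks, it is almost surely equal to
  \<open>g\<close> and has the same norm.\<close>

lemma class_norm_ae_class:
  fixes g :: "'w \<Rightarrow> 'h::{real_inner, banach, second_countable_topology}"
  assumes g: "g \<in> borel_measurable M"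
  shows "class_norm M (ae_class M g) = L2_norm M g"
proof -
  have "g \<in> ae_class M g" using g by (simp add: ae_class_def)
  then have "(SOME g'. g' \<in> ae_class M g) \<in> ae_class M g" unfolding some_in_eq by blast
  then show ?thesis
    unfolding class_norm_def using g by (intro L2_norm_AE_cong) (auto simp: ae_class_def)
qed

lemma L2_spaceE:
  assumes "X \<in> L2_space M F\<^sub>0"
  obtains g where "g \<in> L2_fun M F\<^sub>0" "X = ae_class M g"
  using assms unfolding L2_space_def by (elim imageE) simp

text \<open>Subbasic open sets are images of sets of representatives. Functionals are constant on
  classes, so membership can be tested on any one representative.\<close>

lemma ae_class_image_iff:
  fixes g :: "'w \<Rightarrow> 'h::{real_inner, banach, second_countable_topology}"
  assumes \<psi>: "L2_functional M F\<^sub>0 \<psi>" and g: "g \<in> L2_fun M F\<^sub>0"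
  shows "ae_class M g \<in> ae_class M ` {g \<in> L2_fun M F\<^sub>0. \<psi> g \<in> E} \<longleftrightarrow> \<psi> g \<in> E"
proof
  assume "ae_class M g \<in> ae_class M ` {g \<in> L2_fun M F\<^sub>0. \<psi> g \<in> E}"
  then obtain g' where eq: "ae_class M g = ae_class M g'" and "g' \<in> {g \<in> L2_fun M F\<^sub>0. \<psi> g \<in> E}"
    by (rule imageE)
  then have g': "g' \<in> L2_fun M F\<^sub>0" "\<psi> g' \<in> E" by simp_all
  have "\<psi> g = \<psi> g'"
    using eq ae_class_eq_iff[OF L2_fun_borel[OF g] L2_fun_borel[OF g'(1)]]
    by (intro L2_functional_AE_cong[OF \<psi> g g'(1)]) simp
  with g'(2) show "\<psi> g \<in> E" by simp
qed (use g in simp)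

lemma L2_functional_zero: "L2_functional M F\<^sub>0 (\<lambda>_. 0)"
  unfolding L2_functional_def by (auto intro: exI[of _ 0])

lemma openin_weak_halfspace:
  assumes "L2_functional M F\<^sub>0 \<psi>" "open E"
  shows "openin (weak_topology M F\<^sub>0) (ae_class M ` {g \<in> L2_fun M F\<^sub>0. \<psi> g \<in> E})"
  unfolding weak_topology_def using assms by (intro topology_generated_by_Basis) auto

lemma topspace_weak_topology:
  "topspace (weak_topology M F\<^sub>0 :: ('w \<Rightarrow> 'h::{real_inner, banach, second_countable_topology}) set topology)
     = L2_space M F\<^sub>0"
proof -
  have "openin (weak_topology M F\<^sub>0) (L2_space M F\<^sub>0 :: ('w \<Rightarrow> 'h) set set)"
    using openin_weak_halfspace[OF L2_functional_zero open_UNIV] by (simp add: L2_space_def)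
  then have "L2_space M F\<^sub>0 \<subseteq> topspace (weak_topology M F\<^sub>0 :: ('w \<Rightarrow> 'h) set topology)"
    by (rule openin_subset)
  moreover have "topspace (weak_topology M F\<^sub>0 :: ('w \<Rightarrow> 'h) set topology) \<subseteq> L2_space M F\<^sub>0"
    unfolding weak_topology_def topology_generated_by_topspace L2_space_def by (intro Union_least) auto
  ultimately show ?thesis by (rule equalityI[rotated])
qed

text \<open>The functional given by the inner product with g - g' takes values at g and g' that
  differ by ||g - g'||^2 > 0; the two open half-spaces bounded by the mean value \<open>c\<close>
  separate the classes.\<close>

lemma Hausdorff_weak_topology:
  "Hausdorff_space (weak_topology M F\<^sub>0 :: ('w \<Rightarrow> 'h::{real_inner, banach, second_countable_topology}) set topology)"
  unfolding Hausdorff_space_def topspace_weak_topology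
proof (intro allI impI)
  fix X Y :: "('w \<Rightarrow> 'h) set"
  assume "X \<in> L2_space M F\<^sub>0 \<and> Y \<in> L2_space M F\<^sub>0 \<and> X \<noteq> Y"
  then have X: "X \<in> L2_space M F\<^sub>0" and Y: "Y \<in> L2_space M F\<^sub>0" and ne: "X \<noteq> Y" by simp_all
  obtain g where g: "g \<in> L2_fun M F\<^sub>0" "X = ae_class M g" using X by (rule L2_spaceE)
  obtain g' where g': "g' \<in> L2_fun M F\<^sub>0" "Y = ae_class M g'" using Y by (rule L2_spaceE)
  define \<psi> where "\<psi> k = (\<integral>\<omega>. k \<omega> \<bullet> (g \<omega> - g' \<omega>) \<partial>M)" for k
  have d: "(\<lambda>\<omega>. g \<omega> - g' \<omega>) \<in> L2_fun M F\<^sub>0" by (rule L2_fun_diff[OF g(1) g'(1)])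
  have \<psi>: "L2_functional M F\<^sub>0 \<psi>" unfolding \<psi>_def[abs_def] by (rule L2_functional_inner[OF d])
  have diff: "\<psi> g - \<psi> g' = (\<integral>\<omega>. (norm (g \<omega> - g' \<omega>))\<^sup>2 \<partial>M)"
    unfolding L2_functional_diff[OF \<psi> g(1) g'(1), symmetric] by (simp add: \<psi>_def power2_norm_eq_inner)
  have "\<not> (AE \<omega> in M. g \<omega> = g' \<omega>)"
    using ne g g' ae_class_eq_iff[OF L2_fun_borel[OF g(1)] L2_fun_borel[OF g'(1)]] by simp
  then have "(\<integral>\<omega>. (norm (g \<omega> - g' \<omega>))\<^sup>2 \<partial>M) \<noteq> 0"
    using integral_nonneg_eq_0_iff_AE[OF L2_fun_integrable[OF d]] by simp
  moreover have "0 \<le> (\<integral>\<omega>. (norm (g \<omega> - g' \<omega>))\<^sup>2 \<partial>M)" by simp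
  ultimately have lt: "\<psi> g' < \<psi> g" using diff by linarith
  define c where "c = (\<psi> g + \<psi> g') / 2"
  let ?U = "\<lambda>E. ae_class M ` {g \<in> L2_fun M F\<^sub>0. \<psi> g \<in> E}"
  have "X \<in> ?U {c<..}" "Y \<in> ?U {..<c}"
    using lt unfolding g(2) g'(2) ae_class_image_iff[OF \<psi> g(1)] ae_class_image_iff[OF \<psi> g'(1)]
    by (simp_all add: c_def)
  moreover have "disjnt (?U {c<..}) (?U {..<c})"
    unfolding disjnt_iff
  proof (intro allI notI, elim conjE)
    fix Z assume Z: "Z \<in> ?U {c<..}" "Z \<in> ?U {..<c}"
    from Z(1) obtain k where k: "Z = ae_class M k" "k \<in> {g \<in> L2_fun M F\<^sub>0. \<psi> g \<in> {c<..}}" by (rule imageE)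
    then have kL2: "k \<in> L2_fun M F\<^sub>0" by simp
    show False using Z unfolding k(1) ae_class_image_iff[OF \<psi> kL2] by simp
  qed
  moreover have "openin (weak_topology M F\<^sub>0) (?U {c<..})" "openin (weak_topology M F\<^sub>0) (?U {..<c})"
    by (intro openin_weak_halfspace[OF \<psi>] open_greaterThan open_lessThan)+
  ultimately show "\<exists>U V. openin (weak_topology M F\<^sub>0) U \<and> openin (weak_topology M F\<^sub>0) V \<and> X \<in> U \<and> Y \<in> V \<and> disjnt U V"
    by (intro exI[of _ "?U {c<..}"] exI[of _ "?U {..<c}"] conjI)
qed

text \<open>
  By Alexander's lemma only covers by half-spaces \<open>{\<psi> > a}\<close> matter; their complements are the
  half-spaces of the finite intersection property above.
\<close>

lemma compactin_weak_topology_ball: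
  assumes r: "0 \<le> r"
  shows "compactin (weak_topology M F\<^sub>0)
    {X \<in> L2_space M F\<^sub>0 :: ('w \<Rightarrow> 'h::{real_inner, banach, second_countable_topology}) set set. class_norm M X \<le> r}"
    (is "compactin ?T ?ball")
proof -
  define H where "H p = ?ball \<inter> ae_class M ` {g \<in> L2_fun M F\<^sub>0. fst p g \<in> {snd p<..}}"
    for p :: "(('w \<Rightarrow> 'h) \<Rightarrow> real) \<times> real"
  define P where "P = {p :: (('w \<Rightarrow> 'h) \<Rightarrow> real) \<times> real. L2_functional M F\<^sub>0 (fst p)}"
  \<comment> \<open>The topology on the ball that has only the half-spaces as subbase.
    \<open>openX\<close> below shows that every weakly open set has an \<open>X\<close>-open trace
    on the ball, so compactness of \<open>X\<close> is enough.\<close>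
  define X where "X = topology (arbitrary union_of (finite intersection_of (\<lambda>U. U \<in> H ` P) relative_to \<Union>(H ` P)))"
  have H_iff: "ae_class M g \<in> H p \<longleftrightarrow> L2_norm M g \<le> r \<and> snd p < fst p g"
    if "p \<in> P" "g \<in> L2_fun M F\<^sub>0" for p g
  proof -
    have p: "L2_functional M F\<^sub>0 (fst p)" using that(1) by (simp add: P_def)
    have "ae_class M g \<in> L2_space M F\<^sub>0" using that(2) by (simp add: L2_space_def)
    then show ?thesis
      unfolding H_def Int_iff ae_class_image_iff[OF p that(2)]
      by (simp add: class_norm_ae_class[OF L2_fun_borel[OF that(2)]])
  qed
  have ballE: "\<exists>g\<in>L2_fun M F\<^sub>0. Y = ae_class M g \<and> L2_norm M g \<le> r" if "Y \<in> ?ball" for Y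
  proof -
    have Y: "Y \<in> L2_space M F\<^sub>0" "class_norm M Y \<le> r" using that by simp_all
    obtain g where g: "g \<in> L2_fun M F\<^sub>0" "Y = ae_class M g" using Y(1) by (rule L2_spaceE)
    then show ?thesis
      using Y(2) class_norm_ae_class[OF L2_fun_borel[OF g(1)]] by (intro bexI[of _ g]) simp_all
  qed
  have union: "\<Union>(H ` P) = ?ball"
  proof (rule equalityI)
    show "\<Union>(H ` P) \<subseteq> ?ball" unfolding H_def by (rule UN_least) (rule Int_lower1)
    \<comment> \<open>The zero functional with threshold -1 gives the trivial half-space, so that
      the subbase covers the ball.\<close>
    have "((\<lambda>_. 0), -1) \<in> P" using L2_functional_zero by (simp add: P_def)
    moreover have "?ball \<subseteq> H ((\<lambda>_. 0), -1)"
      unfolding H_def L2_space_def by simp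
    ultimately show "?ball \<subseteq> \<Union>(H ` P)" by (rule SUP_upper2)
  qed
  have topX: "topspace X = ?ball" unfolding X_def topspace_subbase union ..
  have openH: "openin X (H p)" if "p \<in> P" for p
    unfolding X_def openin_subbase
  proof (rule arbitrary_union_of_inc)
    have "(finite intersection_of (\<lambda>U. U \<in> H ` P)) (H p)"
      by (rule finite_intersection_of_inc) (use that in simp)
    moreover have "?ball \<inter> H p = H p" unfolding H_def by (rule Int_absorb1) (rule Int_lower1)
    ultimately show "((finite intersection_of (\<lambda>U. U \<in> H ` P)) relative_to \<Union>(H ` P)) (H p)"
      unfolding relative_to_def union by (intro exI[of _ "H p"] conjI)
  qed
  have "compact_space X"
  proof (rule Alexander_subbase[OF X_def[symmetric]])
    fix C assume C: "C \<subseteq> H ` P" "\<Union>C = topspace X"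
    define I where "I = {p \<in> P. H p \<in> C}"
    show "\<exists>C'. finite C' \<and> C' \<subseteq> C \<and> \<Union>C' = topspace X"
    proof (rule ccontr)
      assume no: "\<not> (\<exists>C'. finite C' \<and> C' \<subseteq> C \<and> \<Union>C' = topspace X)"
      have "\<exists>g\<in>L2_fun M F\<^sub>0. L2_norm M g \<le> r \<and> (\<forall>p\<in>I. fst p g \<le> snd p)"
      proof (rule L2_halfspaces_finite_intersection[OF _ r])
        show "L2_functional M F\<^sub>0 (fst p)" if "p \<in> I" for p using that by (simp add: I_def P_def)
        fix J assume J: "finite J" "J \<subseteq> I"
        \<comment> \<open>A finite subfamily does not cover the ball, and a missed point satisfies
          all the reversed inequalities of that subfamily.\<close>
        have sub: "H ` J \<subseteq> C" using J(2) by (auto simp: I_def)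
        have "\<Union>(H ` J) \<noteq> ?ball"
        proof
          assume "\<Union>(H ` J) = ?ball"
          with sub J(1) have "\<exists>C'. finite C' \<and> C' \<subseteq> C \<and> \<Union>C' = topspace X"
            by (intro exI[of _ "H ` J"] conjI finite_imageI) (simp_all only: topX)
          with no show False ..
        qed
        moreover have "\<Union>(H ` J) \<subseteq> ?ball" using Union_mono[OF sub] unfolding C(2) topX .
        ultimately have "\<Union>(H ` J) \<subset> ?ball" by (rule psubsetI[rotated])
        from psubset_imp_ex_mem[OF this] obtain Y where "Y \<in> ?ball - \<Union>(H ` J)" ..
        then have Y: "Y \<in> ?ball" "\<forall>p\<in>J. Y \<notin> H p" by simp_all
        from ballE[OF Y(1)] obtain g where g: "g \<in> L2_fun M F\<^sub>0" "Y = ae_class M g \<and> L2_norm M g \<le> r" ..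
        have "fst p g \<le> snd p" if "p \<in> J" for p
        proof -
          have "p \<in> P" using that J(2) by (auto simp: I_def)
          from H_iff[OF this g(1)] show ?thesis using Y(2) that g(2) by simp
        qed
        then show "\<exists>g\<in>L2_fun M F\<^sub>0. L2_norm M g \<le> r \<and> (\<forall>p\<in>J. fst p g \<le> snd p)"
          using g by (intro bexI[of _ g]) simp_all
      qed
      then obtain g where g: "g \<in> L2_fun M F\<^sub>0" "L2_norm M g \<le> r \<and> (\<forall>p\<in>I. fst p g \<le> snd p)" ..
      have "ae_class M g \<in> ?ball"
        using g class_norm_ae_class[OF L2_fun_borel[OF g(1)]] by (simp add: L2_space_def)
      then have "ae_class M g \<in> \<Union>C" unfolding C(2) topX .
      then obtain U where U: "ae_class M g \<in> U" "U \<in> C" by (rule UnionE)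
      from U(2) C(1) obtain p where p: "U = H p" "p \<in> P" by blast
      then have "p \<in> I" using U(2) by (simp add: I_def)
      then show False using U(1) g(2) H_iff[OF p(2) g(1)] unfolding p(1) by (simp add: not_less[symmetric])
    qed
  qed
  then have compX: "compactin X ?ball" unfolding compact_space_def topX .
  have openX: "openin X (U \<inter> ?ball)" if "openin ?T U" for U
  proof -
    from that have "generate_topology_on
        {ae_class M ` {g \<in> L2_fun M F\<^sub>0. \<psi> g \<in> E} | \<psi> E. L2_functional M F\<^sub>0 \<psi> \<and> open E} U"
      unfolding weak_topology_def by (rule openin_topology_generated_by)
    then show ?thesis
    proof (induction rule: generate_topology_on.induct)
      case Empty
      show ?case by simp
    next
      case (Int a b)
      have "a \<inter> b \<inter> ?ball = (a \<inter> ?ball) \<inter> (b \<inter> ?ball)" by (simp only: Int_ac Int_absorb Int_left_absorb)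
      then show ?case using openin_Int[OF Int.IH] by simp
    next
      case (UN K)
      have "openin X (\<Union>k\<in>K. k \<inter> ?ball)" using UN.IH by (intro openin_Union) auto
      then show ?case by (simp only: Int_Union2)
    next
      case (Basis U)
      then obtain \<psi> E where U: "U = ae_class M ` {g \<in> L2_fun M F\<^sub>0. \<psi> g \<in> E}"
        and \<psi>: "L2_functional M F\<^sub>0 \<psi>" and E: "open (E :: real set)" by blast
      show ?case
      proof (subst openin_subopen, intro ballI)
        fix Y assume Y: "Y \<in> U \<inter> ?ball"
        then obtain g where g: "g \<in> L2_fun M F\<^sub>0" "Y = ae_class M g \<and> L2_norm M g \<le> r"
          using ballE by blast
        have "\<psi> g \<in> E" using Y g(2) ae_class_image_iff[OF \<psi> g(1)] unfolding U by simp
        then obtain e where e: "e > 0" "ball (\<psi> g) e \<subseteq> E" using E openE by blast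
        \<comment> \<open>The preimage of the interval from \<open>a\<close> to \<open>b\<close>
          inside \<open>E\<close> is the intersection of two half-spaces, the upper bound being
          expressed through -\<psi>.\<close>
        define a where "a = \<psi> g - e"
        define b where "b = \<psi> g + e"
        have P: "(\<psi>, a) \<in> P" "((\<lambda>g. - \<psi> g), - b) \<in> P"
          using \<psi> L2_functional_uminus[OF \<psi>] by (simp_all add: P_def)
        let ?V = "H (\<psi>, a) \<inter> H ((\<lambda>g. - \<psi> g), - b)"
        have "openin X ?V" using openH P by blast
        moreover have "Y \<in> ?V"
          using H_iff[OF P(1) g(1)] H_iff[OF P(2) g(1)] g(2) e(1) by (simp add: a_def b_def)
        moreover have "?V \<subseteq> U \<inter> ?ball"
        proof
          fix Z assume Z: "Z \<in> ?V"
          then have Zb: "Z \<in> ?ball" by (simp add: H_def)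
          from ballE[OF this] obtain k where k: "k \<in> L2_fun M F\<^sub>0" "Z = ae_class M k \<and> L2_norm M k \<le> r" ..
          have "a < \<psi> k" "\<psi> k < b"
            using Z H_iff[OF P(1) k(1)] H_iff[OF P(2) k(1)] k(2) by simp_all
          then have "\<psi> k \<in> E" using e(2) by (auto simp: a_def b_def dist_real_def subset_iff)
          then have "Z \<in> U" using ae_class_image_iff[OF \<psi> k(1)] k(2) unfolding U by simp
          with Zb show "Z \<in> U \<inter> ?ball" by blast
        qed
        ultimately show "\<exists>V. openin X V \<and> Y \<in> V \<and> V \<subseteq> U \<inter> ?ball" by (intro exI[of _ ?V] conjI)
      qed
    qed
  qed
  show ?thesis
    unfolding compactin_def
  proof (intro conjI allI impI)
    show "?ball \<subseteq> topspace ?T" unfolding topspace_weak_topology by (rule Collect_restrict)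
    fix \<U> assume \<U>: "Ball \<U> (openin ?T) \<and> ?ball \<subseteq> \<Union>\<U>"
    define \<V> where "\<V> = (\<lambda>U. U \<inter> ?ball) ` \<U>"
    have "\<forall>V\<in>\<V>. openin X V" using \<U> openX by (simp add: \<V>_def)
    moreover have "?ball \<subseteq> \<Union>\<V>" using \<U> unfolding \<V>_def by blast
    ultimately obtain \<F> where \<F>: "finite \<F>" "\<F> \<subseteq> \<V>" "?ball \<subseteq> \<Union>\<F>"
      using compX unfolding compactin_def by blast
    from finite_subset_image[OF \<F>(1,2)[unfolded \<V>_def]] obtain \<G>
      where \<G>: "\<G> \<subseteq> \<U>" "finite \<G>" "\<F> = (\<lambda>U. U \<inter> ?ball) ` \<G>" by blast
    have "?ball \<subseteq> \<Union>\<G>" using \<F>(3) unfolding \<G>(3) by blast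
    then show "\<exists>\<F>. finite \<F> \<and> \<F> \<subseteq> \<U> \<and> ?ball \<subseteq> \<Union>\<F>"
      using \<G> by (intro exI[of _ \<G>] conjI)
  qed
qed

end


section \<open>Restarting solutions\<close>

text \<open>Intervals before \<tau> collapse to empty ones instead of being removed, so lists are
  changed entry by entry and inductions stay simple. The component \<open>c\<close> is left
  polymorphic so that both kinds of noise are covered.\<close>

definition restart_simple :: "real \<Rightarrow> (real \<times> real \<times> 'c) list \<Rightarrow> (real \<times> real \<times> 'c) list" where
  "restart_simple \<tau> = map (\<lambda>(a, b, c). (max a \<tau>, max b \<tau>, c))"

text \<open>The event of an entry remains measurable at the later left end point because the
  filtration increases.\<close>

lemma wiener_simple_restart:
  assumes "wiener_simple F \<tau> L" "filtration \<Omega> F"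
  shows "wiener_simple F \<tau>' (restart_simple \<tau>' L)"
proof -
  interpret filtration \<Omega> F by fact
  show ?thesis
    using assms(1) sets_F_mono[OF max.cobounded1]
    by (fastforce simp: wiener_simple_def restart_simple_def)
qed

lemma poisson_simple_restart:
  assumes "poisson_simple F \<nu> \<tau> L" "filtration \<Omega> F"
  shows "poisson_simple F \<nu> \<tau>' (restart_simple \<tau>' L)"
proof -
  interpret filtration \<Omega> F by fact
  show ?thesis
    using assms(1) sets_F_mono[OF max.cobounded1]
    by (fastforce simp: poisson_simple_def restart_simple_def)
qed

text \<open>The strict inequality matters: for a < \<tau> \<le> b the cut-off interval no longer
  contains \<tau>, while the original one does.\<close>

lemma indicator_restart:
  "\<tau> < s \<Longrightarrow> indicator {max a \<tau><..max b \<tau>} s = (indicator {a<..b} s :: real)" for a b s \<tau> :: real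
  by (auto simp: indicator_def)

lemma wiener_simple_process_restart:
  "\<tau> < s \<Longrightarrow> wiener_simple_process (restart_simple \<tau> L) s \<omega> = wiener_simple_process L s \<omega>"
  by (induction L) (auto simp: wiener_simple_process_def restart_simple_def indicator_restart)

lemma poisson_simple_process_restart:
  "\<tau> < s \<Longrightarrow> poisson_simple_process (restart_simple \<tau> L) s z \<omega> = poisson_simple_process L s z \<omega>"
  by (induction L) (auto simp: poisson_simple_process_def restart_simple_def indicator_restart)

lemma wiener_simple_integral_restart:
  assumes t: "\<tau> \<le> t"
  shows "wiener_simple_integral W (restart_simple \<tau> L) t \<omega> =
    wiener_simple_integral W L t \<omega> - wiener_simple_integral W L \<tau> \<omega>"
proof (induction L)
  case Nil
  show ?case by (simp add: wiener_simple_integral_def restart_simple_def)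
next
  case (Cons e L)
  obtain a b \<Lambda> x y where e: "e = (a, b, \<Lambda>, x, y)" by (cases e)
  \<comment> \<open>For c \<le> \<tau> both sides are the value at \<tau>; otherwise the last two
    terms cancel. The added value at \<tau> is the same for both end points and disappears from the
    increment.\<close>
  have *: "W (min (max c \<tau>) t) x \<omega> = W (min c t) x \<omega> - W (min c \<tau>) x \<omega> + W \<tau> x \<omega>" for c
    using t by (cases "c \<le> \<tau>") (auto simp: min_def max_def)
  have "(indicator \<Lambda> \<omega> * (W (min (max b \<tau>) t) x \<omega> - W (min (max a \<tau>) t) x \<omega>)) *\<^sub>R y =
    (indicator \<Lambda> \<omega> * (W (min b t) x \<omega> - W (min a t) x \<omega>)) *\<^sub>R y -
    (indicator \<Lambda> \<omega> * (W (min b \<tau>) x \<omega> - W (min a \<tau>) x \<omega>)) *\<^sub>R y"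
    unfolding * scaleR_diff_left[symmetric] by (simp add: algebra_simps)
  then show ?case
    using Cons.IH by (simp add: e wiener_simple_integral_def restart_simple_def)
qed

text \<open>Finiteness matters: \<^const>\<open>measure\<close> takes the junk value 0 on sets of infinite measure.\<close>

lemma measure_rectangle_split:
  fixes n :: "(real \<times> 'z) measure" and a b p q r :: real
  assumes sets: "sets n = sets (lborel \<Otimes>\<^sub>M \<nu>)" and C: "C \<in> sets \<nu>"
    and fin: "emeasure n ({a<..b} \<times> C) < \<infinity>" and p: "a \<le> p" "p \<le> q" "q \<le> r" "r \<le> b"
  shows "measure n ({p<..r} \<times> C) = measure n ({p<..q} \<times> C) + measure n ({q<..r} \<times> C)"
proof -
  have S: "{x<..y} \<times> C \<in> sets n" for x y :: real
    unfolding sets using C by (intro pair_measureI) auto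
  have F: "emeasure n ({x<..y} \<times> C) \<noteq> \<infinity>" if "a \<le> x" "y \<le> b" for x y
  proof -
    have "emeasure n ({x<..y} \<times> C) \<le> emeasure n ({a<..b} \<times> C)"
      using that by (intro emeasure_mono S) auto
    then show ?thesis using fin by (auto simp: top_unique)
  qed
  have "{p<..r} \<times> C = {p<..q} \<times> C \<union> {q<..r} \<times> C" using p by auto
  moreover have "measure n ({p<..q} \<times> C \<union> {q<..r} \<times> C) = measure n ({p<..q} \<times> C) + measure n ({q<..r} \<times> C)"
    using p by (intro measure_Union F S) auto
  ultimately show ?thesis by simp
qed

text \<open>There are no path values to rearrange as for \<open>W\<close>: the compensated mass of
  strips is additive only for ordered end points and finite mass. Hence the cases for the position
  of \<tau> relative to the interval, and the finiteness assumption for the given \<omega>.\<close>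

lemma poisson_simple_integral_restart:
  assumes t: "\<tau> \<le> t" and sets: "sets (N \<omega>) = sets (lborel \<Otimes>\<^sub>M \<nu>)"
    and L: "\<And>a b \<Lambda> C y. (a, b, \<Lambda>, C, y) \<in> set L \<Longrightarrow>
      a \<le> b \<and> C \<in> sets \<nu> \<and> emeasure (N \<omega>) ({a<..b} \<times> C) < \<infinity>"
  shows "poisson_simple_integral \<nu> N (restart_simple \<tau> L) t \<omega> =
    poisson_simple_integral \<nu> N L t \<omega> - poisson_simple_integral \<nu> N L \<tau> \<omega>"
  using L
proof (induction L)
  case Nil
  show ?case by (simp add: poisson_simple_integral_def restart_simple_def)
next
  case (Cons e L)
  obtain a b \<Lambda> C y where e: "e = (a, b, \<Lambda>, C, y)" by (cases e)
  have ab: "a \<le> b" and C: "C \<in> sets \<nu>" and fin: "emeasure (N \<omega>) ({a<..b} \<times> C) < \<infinity>"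
    using Cons.prems[of a b \<Lambda> C y] by (simp_all add: e)
  define m where "m p q = measure (N \<omega>) ({p<..q} \<times> C) - (q - p) * measure \<nu> C" for p q
  have split: "m p r = m p q + m q r" if "a \<le> p" "p \<le> q" "q \<le> r" "r \<le> b" for p q r
    using measure_rectangle_split[OF sets C fin that] by (simp add: m_def algebra_simps)
  have m0: "m p p = 0" for p by (simp add: m_def)
  have "m (min (max a \<tau>) t) (min (max b \<tau>) t) = m (min a t) (min b t) - m (min a \<tau>) (min b \<tau>)"
  proof -
    consider "b \<le> \<tau>" | "a \<le> \<tau>" "\<tau> < b" | "\<tau> < a" by linarith
    then show ?thesis
    proof cases
      case 1
      then show ?thesis using t ab by (simp add: m0 min_absorb1 min_absorb2 max_absorb1 max_absorb2)
    next
      case 2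
      then have "m (min a t) (min b t) = m (min a \<tau>) (min b \<tau>) + m \<tau> (min b t)"
        using t split[of a \<tau> "min b t"] by (simp add: min_absorb1 min_absorb2)
      then show ?thesis using 2 t by (simp add: min_absorb1 min_absorb2 max_absorb1 max_absorb2)
    next
      case 3
      then show ?thesis using t ab by (simp add: m0 min_absorb1 min_absorb2 max_absorb1 max_absorb2)
    qed
  qed
  then have "(indicator \<Lambda> \<omega> * m (min (max a \<tau>) t) (min (max b \<tau>) t)) *\<^sub>R y =
    (indicator \<Lambda> \<omega> * m (min a t) (min b t)) *\<^sub>R y - (indicator \<Lambda> \<omega> * m (min a \<tau>) (min b \<tau>)) *\<^sub>R y"
    by (simp only: right_diff_distrib scaleR_diff_left)
  moreover have "poisson_simple_integral \<nu> N (restart_simple \<tau> L) t \<omega> =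
    poisson_simple_integral \<nu> N L t \<omega> - poisson_simple_integral \<nu> N L \<tau> \<omega>"
    by (rule Cons.IH, rule Cons.prems) (rule list.set_intros(2))
  ultimately show ?case
    by (simp add: e poisson_simple_integral_def restart_simple_def m_def)
qed

section \<open>Integrals under a change of the initial time\<close>

lemma nn_integral_restart_tendsto_0:
  fixes \<phi> \<phi>' :: "nat \<Rightarrow> real \<Rightarrow> ennreal"
  assumes lim: "(\<lambda>n. \<integral>\<^sup>+s\<in>{\<tau>..T}. \<phi> n s \<partial>lborel) \<longlonglongrightarrow> 0" and \<tau>: "\<tau> \<le> \<tau>'"
    and eq: "\<And>n s. \<tau>' < s \<Longrightarrow> \<phi>' n s = \<phi> n s"
  shows "(\<lambda>n. \<integral>\<^sup>+s\<in>{\<tau>'..T}. \<phi>' n s \<partial>lborel) \<longlonglongrightarrow> 0"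
proof (rule tendsto_sandwich[OF always_eventually always_eventually tendsto_const lim]; intro allI)
  fix n
  have "AE s in lborel. s \<noteq> \<tau>'" by (rule AE_lborel_singleton)
  then have "AE s in lborel. \<phi>' n s * indicator {\<tau>'..T} s = \<phi> n s * indicator {\<tau>'..T} s"
    by eventually_elim (auto simp: indicator_def eq)
  then have "(\<integral>\<^sup>+s\<in>{\<tau>'..T}. \<phi>' n s \<partial>lborel) = (\<integral>\<^sup>+s\<in>{\<tau>'..T}. \<phi> n s \<partial>lborel)"
    by (rule nn_integral_cong_AE)
  also have "\<dots> \<le> (\<integral>\<^sup>+s\<in>{\<tau>..T}. \<phi> n s \<partial>lborel)"
    using \<tau> by (intro nn_integral_mono) (auto simp: indicator_def)
  finally show "(\<integral>\<^sup>+s\<in>{\<tau>'..T}. \<phi>' n s \<partial>lborel) \<le> (\<integral>\<^sup>+s\<in>{\<tau>..T}. \<phi> n s \<partial>lborel)" .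
qed simp

text \<open>Convergence at \<tau>' itself is part of the uniform convergence as soon as \<tau>'
  \<le> T; otherwise the interval is empty.\<close>

lemma uniform_limit_restart:
  fixes x :: "nat \<Rightarrow> real \<Rightarrow> 'h::real_normed_vector"
  assumes lim: "uniform_limit {\<tau>..T} x y sequentially" and \<tau>: "\<tau> \<le> \<tau>'"
    and eq: "\<And>n t. \<tau>' \<le> t \<Longrightarrow> x' n t = x n t - x n \<tau>'"
  shows "uniform_limit {\<tau>'..T} x' (\<lambda>t. y t - y \<tau>') sequentially"
proof (cases "\<tau>' \<le> T")
  case True
  have sub: "uniform_limit {\<tau>'..T} x y sequentially"
    by (rule uniform_limit_on_subset[OF lim]) (use \<tau> in auto)
  have "uniform_limit {\<tau>'..T} (\<lambda>n t. x n \<tau>') (\<lambda>t. y \<tau>') sequentially"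
    using sub True by (force simp: uniform_limit_iff elim: eventually_mono)
  from uniform_limit_minus[OF sub this] show ?thesis
    by (rule uniform_limit_cong'[THEN iffD1, rotated 2]) (use eq in auto)
qed simp

lemma has_wiener_integral_restart:
  assumes int: "has_wiener_integral M F W \<tau> X I" and F: "filtration \<Omega> F" and \<tau>: "\<tau> \<le> \<tau>'"
  shows "has_wiener_integral M F W \<tau>' X (\<lambda>t \<omega>. I t \<omega> - I \<tau>' \<omega>)"
proof -
  obtain L where L: "\<forall>n. wiener_simple F \<tau> (L n)"
    and AE: "AE \<omega> in M. \<forall>T\<ge>\<tau>.
           (\<lambda>n. \<integral>\<^sup>+s\<in>{\<tau>..T}. hs_norm_sq (wiener_simple_process (L n) s \<omega> - X s \<omega>) \<partial>lborel)
             \<longlonglongrightarrow> 0 \<and>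
           uniform_limit {\<tau>..T} (\<lambda>n t. wiener_simple_integral W (L n) t \<omega>) (\<lambda>t. I t \<omega>)
             sequentially"
    using int unfolding has_wiener_integral_def by (elim exE conjE)
  show ?thesis
    unfolding has_wiener_integral_def
  proof (intro exI[of _ "\<lambda>n. restart_simple \<tau>' (L n)"] conjI)
    show "\<forall>n. wiener_simple F \<tau>' (restart_simple \<tau>' (L n))"
      by (intro allI) (rule wiener_simple_restart[OF L[THEN spec] F])
    show "AE \<omega> in M. \<forall>T\<ge>\<tau>'.
           (\<lambda>n. \<integral>\<^sup>+s\<in>{\<tau>'..T}. hs_norm_sq (wiener_simple_process (restart_simple \<tau>' (L n)) s \<omega> - X s \<omega>) \<partial>lborel)
             \<longlonglongrightarrow> 0 \<and>
           uniform_limit {\<tau>'..T} (\<lambda>n t. wiener_simple_integral W (restart_simple \<tau>' (L n)) t \<omega>) (\<lambda>t. I t \<omega> - I \<tau>' \<omega>)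
             sequentially"
      using AE
    proof eventually_elim
      case (elim \<omega>)
      show ?case
      proof (intro allI impI conjI)
        fix T assume "\<tau>' \<le> T"
        with \<tau> have "\<tau> \<le> T" by simp
        note lims = elim[rule_format, OF this]
        show "(\<lambda>n. \<integral>\<^sup>+s\<in>{\<tau>'..T}. hs_norm_sq (wiener_simple_process (restart_simple \<tau>' (L n)) s \<omega> - X s \<omega>) \<partial>lborel)
             \<longlonglongrightarrow> 0"
          by (rule nn_integral_restart_tendsto_0[OF conjunct1[OF lims] \<tau>]) (simp add: wiener_simple_process_restart)
        show "uniform_limit {\<tau>'..T} (\<lambda>n t. wiener_simple_integral W (restart_simple \<tau>' (L n)) t \<omega>) (\<lambda>t. I t \<omega> - I \<tau>' \<omega>)
             sequentially"
          by (rule uniform_limit_restart[OF conjunct2[OF lims] \<tau>]) (simp add: wiener_simple_integral_restart)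
      qed
    qed
  qed
qed

text \<open>The Poisson weights add up to exp m * exp (-m) = 1, so almost surely the mass is one of
  the natural numbers.\<close>

lemma poisson_random_measure_AE_finite:
  assumes N: "poisson_random_measure M F \<nu> N" and M: "prob_space M"
    and C: "C \<in> sets (lborel \<Otimes>\<^sub>M \<nu>)" "emeasure (lborel \<Otimes>\<^sub>M \<nu>) C < \<infinity>"
  shows "AE \<omega> in M. emeasure (N \<omega>) C < \<infinity>"
proof -
  interpret prob_space M by fact
  let ?m = "measure (lborel \<Otimes>\<^sub>M \<nu>) C"
  let ?A = "\<lambda>k::nat. {\<omega>\<in>space M. emeasure (N \<omega>) C = of_nat k}"
  have "\<forall>C\<in>sets (lborel \<Otimes>\<^sub>M \<nu>). (\<lambda>\<omega>. emeasure (N \<omega>) C) \<in> borel_measurable M"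
    using N unfolding poisson_random_measure_def by (elim conjE)
  from bspec[OF this C(1)] have [measurable]: "(\<lambda>\<omega>. emeasure (N \<omega>) C) \<in> borel_measurable M" .
  have "\<forall>C\<in>sets (lborel \<Otimes>\<^sub>M \<nu>). emeasure (lborel \<Otimes>\<^sub>M \<nu>) C < \<infinity> \<longrightarrow>
        (\<forall>k::nat. prob {\<omega>\<in>space M. emeasure (N \<omega>) C = of_nat k} =
           measure (lborel \<Otimes>\<^sub>M \<nu>) C ^ k / fact k * exp (- measure (lborel \<Otimes>\<^sub>M \<nu>) C))"
    using N unfolding poisson_random_measure_def by (elim conjE)
  from bspec[OF this C(1), THEN mp, OF C(2)]
  have prob: "prob (?A k) = ?m ^ k / fact k * exp (- ?m)" for k by (rule spec)
  have "(\<lambda>k. ?m ^ k / fact k * exp (- ?m)) sums (exp ?m * exp (- ?m))"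
    using exp_converges[of ?m] by (intro sums_mult2) (simp add: divide_inverse mult.commute)
  then have "(\<lambda>k. prob (?A k)) sums 1" unfolding prob by (simp add: exp_minus_inverse)
  moreover have "(\<lambda>k. prob (?A k)) sums prob (\<Union>k. ?A k)"
    by (intro finite_measure_UNION) (auto simp: disjoint_family_on_def)
  ultimately have "prob (\<Union>k. ?A k) = 1" by (rule sums_unique2[symmetric])
  then have "AE \<omega> in M. \<omega> \<in> (\<Union>k. ?A k)" by (intro prob_eq_1[THEN iffD1]) auto
  then show ?thesis by eventually_elim (auto simp: less_top[symmetric])
qed

lemma has_poisson_integral_restart:
  assumes int: "has_poisson_integral M F \<nu> N \<tau> X J" and F: "filtration \<Omega> F" and \<tau>: "\<tau> \<le> \<tau>'"
    and N: "poisson_random_measure M F \<nu> N" and M: "prob_space M" and \<nu>: "sigma_finite_measure \<nu>"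
  shows "has_poisson_integral M F \<nu> N \<tau>' X (\<lambda>t \<omega>. J t \<omega> - J \<tau>' \<omega>)"
proof -
  interpret \<nu>: sigma_finite_measure \<nu> by fact
  obtain L where L: "\<forall>n. poisson_simple F \<nu> \<tau> (L n)"
    and AE: "AE \<omega> in M. \<forall>T\<ge>\<tau>.
           (\<lambda>n. \<integral>\<^sup>+s\<in>{\<tau>..T}.
                 (\<integral>\<^sup>+z. ennreal ((norm (poisson_simple_process (L n) s z \<omega> - X s z \<omega>))\<^sup>2) \<partial>\<nu>)
                 \<partial>lborel) \<longlonglongrightarrow> 0 \<and>
           uniform_limit {\<tau>..T} (\<lambda>n t. poisson_simple_integral \<nu> N (L n) t \<omega>) (\<lambda>t. J t \<omega>)
             sequentially"
    using int unfolding has_poisson_integral_def by (elim exE conjE)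
  have L': "a \<le> b" "C \<in> sets \<nu>" "emeasure \<nu> C < \<infinity>" if "(a, b, \<Lambda>, C, y) \<in> set (L n)" for a b \<Lambda> C y n
    using L that by (auto simp: poisson_simple_def)
  \<comment> \<open>Additivity is needed for every entry of every list. These are countably many
    strips, each of finite intensity, so a single null set serves all of them.\<close>
  have "AE \<omega> in M. \<forall>n. \<forall>e\<in>set (L n). case e of (a, b, \<Lambda>, C, y) \<Rightarrow> emeasure (N \<omega>) ({a<..b} \<times> C) < \<infinity>"
  proof (intro AE_all_countable[THEN iffD2] allI AE_finite_allI finite_set)
    fix n e assume "e \<in> set (L n)"
    moreover obtain a b \<Lambda> C y where e: "e = (a, b, \<Lambda>, C, y)" by (cases e)
    ultimately have *: "a \<le> b" "C \<in> sets \<nu>" "emeasure \<nu> C < \<infinity>" using L' by simp_all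
    have "AE \<omega> in M. emeasure (N \<omega>) ({a<..b} \<times> C) < \<infinity>"
    proof (rule poisson_random_measure_AE_finite[OF N M])
      show "{a<..b} \<times> C \<in> sets (lborel \<Otimes>\<^sub>M \<nu>)" using * by (intro pair_measureI) auto
      show "emeasure (lborel \<Otimes>\<^sub>M \<nu>) ({a<..b} \<times> C) < \<infinity>"
        using * by (subst \<nu>.emeasure_pair_measure_Times) (auto simp: ennreal_mult_less_top)
    qed
    then show "AE \<omega> in M. case e of (a, b, \<Lambda>, C, y) \<Rightarrow> emeasure (N \<omega>) ({a<..b} \<times> C) < \<infinity>"
      by (simp add: e)
  qed
  moreover have "\<forall>\<omega>\<in>space M. sets (N \<omega>) = sets (lborel \<Otimes>\<^sub>M \<nu>)"
    using N unfolding poisson_random_measure_def by (elim conjE)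
  then have "AE \<omega> in M. sets (N \<omega>) = sets (lborel \<Otimes>\<^sub>M \<nu>)"
    by (intro AE_I2) (rule bspec)
  ultimately have fin: "AE \<omega> in M. sets (N \<omega>) = sets (lborel \<Otimes>\<^sub>M \<nu>) \<and>
      (\<forall>n. \<forall>e\<in>set (L n). case e of (a, b, \<Lambda>, C, y) \<Rightarrow> emeasure (N \<omega>) ({a<..b} \<times> C) < \<infinity>)"
    by eventually_elim simp
  show ?thesis
    unfolding has_poisson_integral_def
  proof (intro exI[of _ "\<lambda>n. restart_simple \<tau>' (L n)"] conjI)
    show "\<forall>n. poisson_simple F \<nu> \<tau>' (restart_simple \<tau>' (L n))"
      by (intro allI) (rule poisson_simple_restart[OF L[THEN spec] F])
    show "AE \<omega> in M. \<forall>T\<ge>\<tau>'.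
           (\<lambda>n. \<integral>\<^sup>+s\<in>{\<tau>'..T}.
                 (\<integral>\<^sup>+z. ennreal ((norm (poisson_simple_process (restart_simple \<tau>' (L n)) s z \<omega> - X s z \<omega>))\<^sup>2) \<partial>\<nu>)
                 \<partial>lborel) \<longlonglongrightarrow> 0 \<and>
           uniform_limit {\<tau>'..T} (\<lambda>n t. poisson_simple_integral \<nu> N (restart_simple \<tau>' (L n)) t \<omega>) (\<lambda>t. J t \<omega> - J \<tau>' \<omega>)
             sequentially"
      using AE fin
    proof eventually_elim
      case (elim \<omega>)
      show ?case
      proof (intro allI impI conjI)
        fix T assume "\<tau>' \<le> T"
        with \<tau> have "\<tau> \<le> T" by simp
        note lims = elim(1)[rule_format, OF this]
        show "(\<lambda>n. \<integral>\<^sup>+s\<in>{\<tau>'..T}.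
                 (\<integral>\<^sup>+z. ennreal ((norm (poisson_simple_process (restart_simple \<tau>' (L n)) s z \<omega> - X s z \<omega>))\<^sup>2) \<partial>\<nu>)
                 \<partial>lborel) \<longlonglongrightarrow> 0"
          by (rule nn_integral_restart_tendsto_0[OF conjunct1[OF lims] \<tau>]) (simp add: poisson_simple_process_restart)
        show "uniform_limit {\<tau>'..T} (\<lambda>n t. poisson_simple_integral \<nu> N (restart_simple \<tau>' (L n)) t \<omega>) (\<lambda>t. J t \<omega> - J \<tau>' \<omega>)
             sequentially"
        proof (rule uniform_limit_restart[OF conjunct2[OF lims] \<tau>])
          fix n t assume t: "\<tau>' \<le> t"
          show "poisson_simple_integral \<nu> N (restart_simple \<tau>' (L n)) t \<omega> =
            poisson_simple_integral \<nu> N (L n) t \<omega> - poisson_simple_integral \<nu> N (L n) \<tau>' \<omega>"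
          proof (rule poisson_simple_integral_restart[OF t])
            show "sets (N \<omega>) = sets (lborel \<Otimes>\<^sub>M \<nu>)" using elim(2) by (rule conjunct1)
            fix a b \<Lambda> C y assume m: "(a, b, \<Lambda>, C, y) \<in> set (L n)"
            with elim(2) have "emeasure (N \<omega>) ({a<..b} \<times> C) < \<infinity>" by fastforce
            then show "a \<le> b \<and> C \<in> sets \<nu> \<and> emeasure (N \<omega>) ({a<..b} \<times> C) < \<infinity>"
              using L'[OF m] by simp
          qed
        qed
      qed
    qed
  qed
qed

text \<open>
  The target need not be second countable, so that a difference of measurable functions need not be
  measurable; one of them has finite range here.
\<close>

lemma borel_measurable_norm_diff_simple:
  fixes g s :: "'a \<Rightarrow> 'b::real_normed_vector"
  assumes g: "g \<in> borel_measurable M" and s: "simple_function M s"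
  shows "(\<lambda>x. norm (g x - s x)) \<in> borel_measurable M"
proof (rule measurable_compose_countable'[where f="\<lambda>y x. norm (g x - y)" and g=s and I="s ` space M"])
  show "(\<lambda>x. norm (g x - y)) \<in> borel_measurable M" for y
    by (rule measurable_compose[OF g]) (intro borel_measurable_continuous_onI continuous_intros)
  show "countable (s ` space M)" using s by (simp add: simple_function_def countable_finite)
  then show "s \<in> measurable M (count_space (s ` space M))"
    using s by (subst measurable_count_space_eq_countable) (auto simp: simple_function_def)
qed

text \<open>The indicators of {\<tau>..t} and {\<tau>..\<tau>'} differ by that of {\<tau>'..t}
  except at \<tau>', and the differences of the two approximating sequences of simple functions
  approximate the difference.\<close>

lemma has_dual_integral_diff:
  fixes g :: "real \<Rightarrow> 'b::real_normed_vector"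
  assumes b: "has_dual_integral g b {\<tau>..t}" and a: "has_dual_integral g a {\<tau>..\<tau>'}"
    and \<tau>: "\<tau> \<le> \<tau>'" "\<tau>' \<le> t"
  shows "has_dual_integral g (b - a) {\<tau>'..t}"
proof -
  let ?g = "\<lambda>I x. indicator I x *\<^sub>R g x"
  obtain s where mb: "?g {\<tau>..t} \<in> borel_measurable lborel"
    and s: "\<forall>i. Bochner_Integration.simple_bochner_integrable lborel (s i)"
      "(\<lambda>i::nat. \<integral>\<^sup>+x. ennreal (norm (?g {\<tau>..t} x - s i x)) \<partial>lborel) \<longlonglongrightarrow> 0"
      "(\<lambda>i. Bochner_Integration.simple_bochner_integral lborel (s i)) \<longlonglongrightarrow> b"
    using b unfolding has_dual_integral_def by (elim exE conjE)
  obtain r where ma: "?g {\<tau>..\<tau>'} \<in> borel_measurable lborel"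
    and r: "\<forall>i. Bochner_Integration.simple_bochner_integrable lborel (r i)"
      "(\<lambda>i::nat. \<integral>\<^sup>+x. ennreal (norm (?g {\<tau>..\<tau>'} x - r i x)) \<partial>lborel) \<longlonglongrightarrow> 0"
      "(\<lambda>i. Bochner_Integration.simple_bochner_integral lborel (r i)) \<longlonglongrightarrow> a"
    using a unfolding has_dual_integral_def by (elim exE conjE)
  have sf: "simple_function lborel (s i)" "simple_function lborel (r i)" for i
    using s(1) r(1) by (auto elim: simple_bochner_integrable.cases)
  show ?thesis
    unfolding has_dual_integral_def
  proof (intro conjI exI[of _ "\<lambda>i x. s i x - r i x"] allI)
    \<comment> \<open>Restricting one measurable function to a measurable set is unproblematic in
      any target, whereas the difference of the two cut-off functions might fail to be
      measurable.\<close>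
    have "(\<lambda>x. if x \<in> {\<tau>'..t} then ?g {\<tau>..t} x else 0) \<in> borel_measurable lborel"
      by (intro measurable_If_set mb) auto
    also have "(\<lambda>x. if x \<in> {\<tau>'..t} then ?g {\<tau>..t} x else 0) = ?g {\<tau>'..t}"
      using \<tau> by (auto simp: indicator_def fun_eq_iff)
    finally show "?g {\<tau>'..t} \<in> borel_measurable lborel" .
    show "Bochner_Integration.simple_bochner_integrable lborel (\<lambda>x. s i x - r i x)" for i
      using s(1) r(1) by (intro simple_bochner_integrable_compose2[of "(-)"]) auto
    show "(\<lambda>i. Bochner_Integration.simple_bochner_integral lborel (\<lambda>x. s i x - r i x)) \<longlonglongrightarrow> b - a"
      using tendsto_diff[OF s(3) r(3)] s(1) r(1) by (simp add: simple_bochner_integral_diff)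
    have lim: "(\<lambda>i. (\<integral>\<^sup>+x. ennreal (norm (?g {\<tau>..t} x - s i x)) \<partial>lborel) +
        (\<integral>\<^sup>+x. ennreal (norm (?g {\<tau>..\<tau>'} x - r i x)) \<partial>lborel)) \<longlonglongrightarrow> 0"
      using tendsto_add[OF s(2) r(2)] by simp
    show "(\<lambda>i. \<integral>\<^sup>+x. ennreal (norm (?g {\<tau>'..t} x - (s i x - r i x))) \<partial>lborel) \<longlonglongrightarrow> 0"
    proof (rule tendsto_sandwich[OF always_eventually always_eventually tendsto_const lim]; intro allI)
      fix i
      have "(\<integral>\<^sup>+x. ennreal (norm (?g {\<tau>'..t} x - (s i x - r i x))) \<partial>lborel) \<le>
        (\<integral>\<^sup>+x. ennreal (norm (?g {\<tau>..t} x - s i x)) + ennreal (norm (?g {\<tau>..\<tau>'} x - r i x)) \<partial>lborel)"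
      proof (rule nn_integral_mono_AE)
        have "AE x in lborel. x \<noteq> \<tau>'" by (rule AE_lborel_singleton)
        then show "AE x in lborel. ennreal (norm (?g {\<tau>'..t} x - (s i x - r i x))) \<le>
            ennreal (norm (?g {\<tau>..t} x - s i x)) + ennreal (norm (?g {\<tau>..\<tau>'} x - r i x))"
        proof eventually_elim
          case (elim x)
          then have "?g {\<tau>'..t} x = ?g {\<tau>..t} x - ?g {\<tau>..\<tau>'} x"
            using \<tau> by (auto simp: indicator_def)
          then have eq: "?g {\<tau>'..t} x - (s i x - r i x) = (?g {\<tau>..t} x - s i x) - (?g {\<tau>..\<tau>'} x - r i x)"
            by (simp only: algebra_simps)
          have "norm (?g {\<tau>'..t} x - (s i x - r i x)) \<le> norm (?g {\<tau>..t} x - s i x) + norm (?g {\<tau>..\<tau>'} x - r i x)"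
            unfolding eq by (rule norm_triangle_ineq4)
          then show ?case
            unfolding ennreal_plus[OF norm_ge_zero norm_ge_zero, symmetric] by (rule ennreal_leI)
        qed
      qed
      also have "\<dots> = (\<integral>\<^sup>+x. ennreal (norm (?g {\<tau>..t} x - s i x)) \<partial>lborel) +
          (\<integral>\<^sup>+x. ennreal (norm (?g {\<tau>..\<tau>'} x - r i x)) \<partial>lborel)"
        using borel_measurable_norm_diff_simple[OF mb sf(1)] borel_measurable_norm_diff_simple[OF ma sf(2)]
        by (intro nn_integral_add measurable_compose[OF _ measurable_ennreal])
      finally show "(\<integral>\<^sup>+x. ennreal (norm (?g {\<tau>'..t} x - (s i x - r i x))) \<partial>lborel) \<le>
          (\<integral>\<^sup>+x. ennreal (norm (?g {\<tau>..t} x - s i x)) \<partial>lborel) +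
          (\<integral>\<^sup>+x. ennreal (norm (?g {\<tau>..\<tau>'} x - r i x)) \<partial>lborel)" .
    qed simp
  qed
qed

section \<open>The integrated equation and the solution map\<close>

lemma H_to_dual_diff: "H_to_dual j (x - y) = H_to_dual j x - H_to_dual j y"
  by (rule blinfun_eqI) (simp add: H_to_dual_def blinfun.diff_left inner_diff_left inner_diff_right)

lemma stochastic_basisD:
  assumes "stochastic_basis M F"
  shows "prob_space M" "filtration (space M) F" "prob_subalgebra M (F t)"
  using assms unfolding stochastic_basis_def prob_subalgebra_def prob_subalgebra_axioms_def by blast+

text \<open>Subtracting the equation at \<tau>' from the equation at t removes the old initial
  value; the path \<open>u\<close> and its V-valued version are kept. With \<tau>' = \<tau> the
  statement still has content: the initial value may be replaced by an almost surely equal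
  one.\<close>

lemma is_solution_restart:
  assumes sol: "is_solution M F W \<nu> N j S \<mu> B f \<epsilon>\<^sub>1 h \<epsilon>\<^sub>2 G \<tau> \<xi> u" and \<tau>: "\<tau> \<le> \<tau>'"
    and \<xi>': "AE \<omega> in M. \<xi>' \<omega> = u \<tau>' \<omega>"
    and basis: "stochastic_basis M F" and N: "poisson_random_measure M F \<nu> N"
    and \<nu>: "sigma_finite_measure \<nu>"
  shows "is_solution M F W \<nu> N j S \<mu> B f \<epsilon>\<^sub>1 h \<epsilon>\<^sub>2 G \<tau>' \<xi>' u"
proof -
  note M = stochastic_basisD(1)[OF basis] and F = stochastic_basisD(2)[OF basis]
  \<comment> \<open>The clauses of \<open>is_solution\<close> with initial time, initial value and
    stochastic integrals as parameters, so that the same formula serves before and after the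
    restart.\<close>
  let ?E = "\<lambda>\<tau> \<xi> I J \<omega> v t a b c. has_dual_integral (\<lambda>s. A_to_dual j S (v s)) a {\<tau>..t} \<and>
              has_dual_integral (\<lambda>s. B (v s) (v s)) b {\<tau>..t} \<and>
              has_dual_integral f c {\<tau>..t} \<and>
              H_to_dual j (u t \<omega>) + \<mu> *\<^sub>R a + b =
                H_to_dual j (\<xi> \<omega>) + c + \<epsilon>\<^sub>1 *\<^sub>R H_to_dual j (I t \<omega>) + \<epsilon>\<^sub>2 *\<^sub>R H_to_dual j (J t \<omega>)"
  let ?P = "\<lambda>\<tau> \<xi> I J \<omega> v. v \<in> borel_measurable lborel \<and>
           (AE s in lborel. \<tau> \<le> s \<longrightarrow> blinfun_apply j (v s) = u s \<omega>) \<and>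
           (\<forall>T>0. (\<integral>\<^sup>+s\<in>{\<tau>..\<tau> + T}. ennreal ((norm (v s))\<^sup>2) \<partial>lborel) < \<infinity>) \<and>
           (\<forall>t\<ge>\<tau>. \<exists>a b c. ?E \<tau> \<xi> I J \<omega> v t a b c)"
  note sol' = sol[unfolded is_solution_def]
  note adapted = sol'[THEN conjunct1] and cadlag = sol'[THEN conjunct2, THEN conjunct1]
  from sol'[THEN conjunct2, THEN conjunct2, THEN conjunct2]
  obtain I J where I: "has_wiener_integral M F W \<tau> (\<lambda>s \<omega>. h s (u s \<omega>)) I"
    and J: "has_poisson_integral M F \<nu> N \<tau> (\<lambda>s z \<omega>. G (Lim (at_left s) (\<lambda>r. u r \<omega>)) z) J"
    and eq: "AE \<omega> in M. \<exists>v. ?P \<tau> \<xi> I J \<omega> v"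
    by (elim exE conjE)
  let ?I = "\<lambda>t \<omega>. I t \<omega> - I \<tau>' \<omega>" and ?J = "\<lambda>t \<omega>. J t \<omega> - J \<tau>' \<omega>"
  have "AE \<omega> in M. \<exists>v. ?P \<tau>' \<xi>' ?I ?J \<omega> v"
    using eq \<xi>'
  proof eventually_elim
    case (elim \<omega>)
    from elim(1) obtain v where v: "?P \<tau> \<xi> I J \<omega> v" ..
    have sol_v: "\<exists>a b c. ?E \<tau> \<xi> I J \<omega> v t a b c" if "\<tau> \<le> t" for t
      using v[THEN conjunct2, THEN conjunct2, THEN conjunct2, rule_format, OF that] .
    from sol_v[OF \<tau>] obtain a0 b0 c0 where e0: "?E \<tau> \<xi> I J \<omega> v \<tau>' a0 b0 c0" by (elim exE)
    have "\<exists>a b c. ?E \<tau>' \<xi>' ?I ?J \<omega> v t a b c" if t: "\<tau>' \<le> t" for t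
    proof -
      from sol_v[OF order_trans[OF \<tau> t]] obtain a b c where e: "?E \<tau> \<xi> I J \<omega> v t a b c" by (elim exE)
      note 1 = e[THEN conjunct2, THEN conjunct2, THEN conjunct2]
      note 2 = e0[THEN conjunct2, THEN conjunct2, THEN conjunct2]
      have "H_to_dual j (u t \<omega>) + \<mu> *\<^sub>R (a - a0) + (b - b0) =
          (H_to_dual j (u t \<omega>) + \<mu> *\<^sub>R a + b) - (H_to_dual j (u \<tau>' \<omega>) + \<mu> *\<^sub>R a0 + b0) + H_to_dual j (u \<tau>' \<omega>)"
        by (simp add: algebra_simps)
      also have "\<dots> = H_to_dual j (\<xi>' \<omega>) + (c - c0) + \<epsilon>\<^sub>1 *\<^sub>R H_to_dual j (?I t \<omega>) + \<epsilon>\<^sub>2 *\<^sub>R H_to_dual j (?J t \<omega>)"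
        unfolding 1 2 elim(2) H_to_dual_diff by (simp add: algebra_simps)
      finally have "?E \<tau>' \<xi>' ?I ?J \<omega> v t (a - a0) (b - b0) (c - c0)"
        using has_dual_integral_diff[OF e[THEN conjunct1] e0[THEN conjunct1] \<tau> t]
          has_dual_integral_diff[OF e[THEN conjunct2, THEN conjunct1] e0[THEN conjunct2, THEN conjunct1] \<tau> t]
          has_dual_integral_diff[OF e[THEN conjunct2, THEN conjunct2, THEN conjunct1]
            e0[THEN conjunct2, THEN conjunct2, THEN conjunct1] \<tau> t]
        by (intro conjI)
      then show ?thesis by (intro exI)
    qed
    moreover have "AE s in lborel. \<tau>' \<le> s \<longrightarrow> blinfun_apply j (v s) = u s \<omega>"
      using v[THEN conjunct2, THEN conjunct1] by eventually_elim (use \<tau> in simp)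
    moreover have "(\<integral>\<^sup>+s\<in>{\<tau>'..\<tau>' + T}. ennreal ((norm (v s))\<^sup>2) \<partial>lborel) < \<infinity>" if "T > 0" for T
    proof -
      have "(\<integral>\<^sup>+s\<in>{\<tau>'..\<tau>' + T}. ennreal ((norm (v s))\<^sup>2) \<partial>lborel) \<le>
          (\<integral>\<^sup>+s\<in>{\<tau>..\<tau> + (\<tau>' - \<tau> + T)}. ennreal ((norm (v s))\<^sup>2) \<partial>lborel)"
        using \<tau> by (intro nn_integral_mono) (auto simp: indicator_def)
      also have "\<dots> < \<infinity>"
        using v[THEN conjunct2, THEN conjunct2, THEN conjunct1, rule_format, of "\<tau>' - \<tau> + T"] \<tau> that by simp
      finally show ?thesis .
    qed
    ultimately have "?P \<tau>' \<xi>' ?I ?J \<omega> v"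
      using v[THEN conjunct1] by (intro conjI allI impI)
    then show ?case by (intro exI[of _ v])
  qed
  moreover have "AE \<omega> in M. u \<tau>' \<omega> = \<xi>' \<omega>" using \<xi>' by eventually_elim simp
  moreover have "\<forall>t\<ge>\<tau>'. u t \<in> borel_measurable (F t)" using adapted \<tau> by simp
  moreover have "\<forall>\<omega>\<in>space M. cadlag_from \<tau>' (\<lambda>t. u t \<omega>)"
    using cadlag \<tau> by (simp add: cadlag_from_def)
  ultimately show ?thesis
    unfolding is_solution_def
    by (intro conjI exI[of _ ?I] exI[of _ ?J] has_wiener_integral_restart[OF I F \<tau>]
        has_poisson_integral_restart[OF J F \<tau> N M \<nu>])
qed

text \<open>The initial value and the solution chosen by \<open>SOME\<close> may differ from
  \<open>\<xi>\<close> and \<open>u\<close>. A restart at \<tau> itself makes \<open>u\<close> a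
  solution for the chosen initial value, and uniqueness then identifies both paths.\<close>

lemma solution_map_ae_class:
  fixes sol :: "real \<Rightarrow> ('w \<Rightarrow> 'h::{real_inner, banach, second_countable_topology}) \<Rightarrow> (real \<Rightarrow> 'w \<Rightarrow> 'h) \<Rightarrow> bool"
  assumes basis: "stochastic_basis M F" and wp: "well_posed M F sol"
    and restart: "\<And>\<tau> \<tau>' \<xi> \<xi>' u. sol \<tau> \<xi> u \<Longrightarrow> \<tau> \<le> \<tau>' \<Longrightarrow> AE \<omega> in M. \<xi>' \<omega> = u \<tau>' \<omega> \<Longrightarrow> sol \<tau>' \<xi>' u"
    and initial: "\<And>\<tau> \<xi> u. sol \<tau> \<xi> u \<Longrightarrow> AE \<omega> in M. u \<tau> \<omega> = \<xi> \<omega>"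
    and \<xi>: "\<xi> \<in> L2_fun M (F \<tau>)" and u: "sol \<tau> \<xi> u" and t: "0 \<le> t"
  shows "solution_map M F sol t \<tau> (ae_class M \<xi>) = ae_class M (u (t + \<tau>))"
proof -
  interpret prob_subalgebra M "F \<tau>" by (rule stochastic_basisD[OF basis])
  interpret t: prob_subalgebra M "F (t + \<tau>)" by (rule stochastic_basisD[OF basis])
  define \<xi>1 where "\<xi>1 = (SOME \<xi>'. \<xi>' \<in> ae_class M \<xi> \<and> \<xi>' \<in> L2_fun M (F \<tau>))"
  define u1 where "u1 = (SOME u. sol \<tau> \<xi>1 u)"
  have "\<xi> \<in> ae_class M \<xi> \<and> \<xi> \<in> L2_fun M (F \<tau>)"
    using \<xi> L2_fun_borel[OF \<xi>] by (simp add: ae_class_def)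
  then have "\<xi>1 \<in> ae_class M \<xi> \<and> \<xi>1 \<in> L2_fun M (F \<tau>)"
    unfolding \<xi>1_def by (rule someI[of "\<lambda>\<xi>'. \<xi>' \<in> ae_class M \<xi> \<and> \<xi>' \<in> L2_fun M (F \<tau>)"])
  then have \<xi>1: "AE \<omega> in M. \<xi>1 \<omega> = \<xi> \<omega>" "\<xi>1 \<in> L2_fun M (F \<tau>)" by (simp_all add: ae_class_def)
  note wp1 = wp[unfolded well_posed_def, THEN spec, THEN bspec, OF \<xi>1(2)]
  from wp1 have "\<exists>u. sol \<tau> \<xi>1 u" by (rule conjunct1)
  then have u1: "sol \<tau> \<xi>1 u1" unfolding u1_def by (rule someI_ex)
  have "AE \<omega> in M. \<xi>1 \<omega> = u \<tau> \<omega>" using \<xi>1(1) initial[OF u] by eventually_elim simp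
  then have u': "sol \<tau> \<xi>1 u" by (rule restart[OF u order_refl])
  have "AE \<omega> in M. \<forall>t\<ge>\<tau>. u1 t \<omega> = u t \<omega>" using wp1[THEN conjunct2, THEN conjunct1, THEN spec, THEN spec, THEN mp, OF conjI, OF u1 u'] .
  then have eq: "AE \<omega> in M. u1 (t + \<tau>) \<omega> = u (t + \<tau>) \<omega>" by eventually_elim (use t in simp)
  have "u1 (t + \<tau>) \<in> L2_fun M (F (t + \<tau>))" "u (t + \<tau>) \<in> L2_fun M (F (t + \<tau>))"
    using wp1[THEN conjunct2, THEN conjunct2, THEN spec, THEN mp, OF u1]
      wp1[THEN conjunct2, THEN conjunct2, THEN spec, THEN mp, OF u'] t by simp_all
  from ae_class_eq_iff[OF this[THEN t.L2_fun_borel]] eq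
  have "ae_class M (u1 (t + \<tau>)) = ae_class M (u (t + \<tau>))" by (rule iffD2)
  then show ?thesis unfolding solution_map_def Let_def u1_def \<xi>1_def .
qed

text \<open>One path \<open>u\<close> represents everything: at time 0 it returns its initial class,
  and both sides of the cocycle law are the class of its value at t + s + \<tau>, since
  \<open>u\<close> also solves from time s + \<tau>.\<close>

lemma solution_map_mean_random_dynamical_system:
  fixes sol :: "real \<Rightarrow> ('w \<Rightarrow> 'h::{real_inner, banach, second_countable_topology}) \<Rightarrow> (real \<Rightarrow> 'w \<Rightarrow> 'h) \<Rightarrow> bool"
  assumes basis: "stochastic_basis M F" and wp: "well_posed M F sol"
    and restart: "\<And>\<tau> \<tau>' \<xi> \<xi>' u. sol \<tau> \<xi> u \<Longrightarrow> \<tau> \<le> \<tau>' \<Longrightarrow> AE \<omega> in M. \<xi>' \<omega> = u \<tau>' \<omega> \<Longrightarrow> sol \<tau>' \<xi>' u"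
    and initial: "\<And>\<tau> \<xi> u. sol \<tau> \<xi> u \<Longrightarrow> AE \<omega> in M. u \<tau> \<omega> = \<xi> \<omega>"
  shows "mean_random_dynamical_system M F (solution_map M F sol)"
proof -
  have map: "solution_map M F sol t \<tau> (ae_class M \<xi>) = ae_class M (u (t + \<tau>))"
    if "\<xi> \<in> L2_fun M (F \<tau>)" "sol \<tau> \<xi> u" "0 \<le> t" for t \<tau> \<xi> u
  proof (rule solution_map_ae_class[where M=M and F=F and sol=sol and \<tau>=\<tau> and \<xi>=\<xi> and u=u and t=t])
    show "stochastic_basis M F" "well_posed M F sol" by fact+
    show "\<xi> \<in> L2_fun M (F \<tau>)" "sol \<tau> \<xi> u" "0 \<le> t" by fact+
    show "sol \<tau>' \<xi>' u" if "sol \<tau> \<xi> u" "\<tau> \<le> \<tau>'" "AE \<omega> in M. \<xi>' \<omega> = u \<tau>' \<omega>" for \<tau> \<tau>' \<xi> \<xi>' u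
      using that by (rule restart)
    show "AE \<omega> in M. u \<tau> \<omega> = \<xi> \<omega>" if "sol \<tau> \<xi> u" for \<tau> \<xi> u
      using that by (rule initial)
  qed
  note wp' = wp[unfolded well_posed_def, THEN spec, THEN bspec]
  have sols: "\<exists>u. sol \<tau> \<xi> u" "sol \<tau> \<xi> u \<Longrightarrow> \<tau> \<le> t \<Longrightarrow> u t \<in> L2_fun M (F t)"
    if "\<xi> \<in> L2_fun M (F \<tau>)" for \<tau> \<xi> u t
  proof -
    show "\<exists>u. sol \<tau> \<xi> u" using wp'[OF that] by (rule conjunct1)
    show "u t \<in> L2_fun M (F t)" if u: "sol \<tau> \<xi> u" "\<tau> \<le> t"
      using wp'[OF \<open>\<xi> \<in> L2_fun M (F \<tau>)\<close>, THEN conjunct2, THEN conjunct2, THEN spec, THEN mp, OF u(1)] u(2)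
      by simp
  qed
  have rep: "\<exists>\<xi> u. \<xi> \<in> L2_fun M (F \<tau>) \<and> X = ae_class M \<xi> \<and> sol \<tau> \<xi> u" if "X \<in> L2_space M (F \<tau>)" for X \<tau>
  proof -
    from that obtain \<xi> where \<xi>: "X = ae_class M \<xi>" "\<xi> \<in> L2_fun M (F \<tau>)"
      unfolding L2_space_def by (rule imageE)
    from sols(1)[OF \<xi>(2)] obtain u where "sol \<tau> \<xi> u" ..
    with \<xi> show ?thesis by (intro exI conjI)
  qed
  show ?thesis
    unfolding mean_random_dynamical_system_def
  proof (intro conjI allI impI ballI subsetI)
    fix t \<tau> :: real and Y :: "('w \<Rightarrow> 'h) set" assume t: "0 \<le> t" and "Y \<in> solution_map M F sol t \<tau> ` L2_space M (F \<tau>)"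
    then obtain X where X: "Y = solution_map M F sol t \<tau> X" "X \<in> L2_space M (F \<tau>)" by (elim imageE)
    from rep[OF X(2)] obtain \<xi> u where \<xi>: "\<xi> \<in> L2_fun M (F \<tau>)" "X = ae_class M \<xi>" "sol \<tau> \<xi> u" by (elim exE conjE)
    show "Y \<in> L2_space M (F (t + \<tau>))"
      unfolding X(1) \<xi>(2) map[OF \<xi>(1,3) t] L2_space_def using sols(2)[OF \<xi>(1,3)] t by simp
  next
    fix \<tau> :: real and X :: "('w \<Rightarrow> 'h) set" assume "X \<in> L2_space M (F \<tau>)"
    from rep[OF this] obtain \<xi> u where \<xi>: "\<xi> \<in> L2_fun M (F \<tau>)" "X = ae_class M \<xi>" "sol \<tau> \<xi> u" by (elim exE conjE)
    interpret prob_subalgebra M "F \<tau>" by (rule stochastic_basisD[OF basis])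
    have "u \<tau> \<in> L2_fun M (F \<tau>)" using sols(2)[OF \<xi>(1,3)] by simp
    from ae_class_eq_iff[OF L2_fun_borel[OF this] L2_fun_borel[OF \<xi>(1)]] initial[OF \<xi>(3)]
    have "ae_class M (u \<tau>) = ae_class M \<xi>" by (rule iffD2)
    then show "solution_map M F sol 0 \<tau> X = X" using map[OF \<xi>(1,3) order_refl] \<xi>(2) by simp
  next
    fix s t \<tau> :: real and X :: "('w \<Rightarrow> 'h) set" assume s: "0 \<le> s" and t: "0 \<le> t" and "X \<in> L2_space M (F \<tau>)"
    from rep[OF this(3)] obtain \<xi> u where \<xi>: "\<xi> \<in> L2_fun M (F \<tau>)" "X = ae_class M \<xi>" "sol \<tau> \<xi> u" by (elim exE conjE)
    have us: "u (s + \<tau>) \<in> L2_fun M (F (s + \<tau>))" using sols(2)[OF \<xi>(1,3)] s by simp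
    have sol: "sol (s + \<tau>) (u (s + \<tau>)) u" by (rule restart[OF \<xi>(3)]) (use s in simp_all)
    have "solution_map M F sol (t + s) \<tau> X = ae_class M (u (t + (s + \<tau>)))"
      unfolding \<xi>(2) map[OF \<xi>(1,3) add_nonneg_nonneg[OF t s]] add.assoc ..
    also have "\<dots> = solution_map M F sol t (s + \<tau>) (ae_class M (u (s + \<tau>)))"
      by (rule map[OF us sol t, symmetric])
    also have "ae_class M (u (s + \<tau>)) = solution_map M F sol s \<tau> X"
      unfolding \<xi>(2) by (rule map[OF \<xi>(1,3) s, symmetric])
    finally show "solution_map M F sol (t + s) \<tau> X = solution_map M F sol t (s + \<tau>) (solution_map M F sol s \<tau> X)" .
  qed
qed


section \<open>Omega-limit sets\<close>

lemma pullback_universeD: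
  assumes "D \<in> pullback_universe M F \<kappa>"
  shows "D \<tau> \<subseteq> L2_space M (F \<tau>)" "D \<tau> \<noteq> {}" "bdd_above (class_norm M ` D \<tau>)"
    "((\<lambda>\<tau>. exp (\<kappa> * \<tau>) * (SUP X\<in>D \<tau>. class_norm M X)\<^sup>2) \<longlongrightarrow> 0) at_bot"
  using assms unfolding pullback_universe_def by simp_all

text \<open>Real suprema are monotone only over nonempty sets with upper bounds, hence the second
  condition on \<open>A\<close>; norms are nonnegative, so squaring preserves the comparison. This
  places the limit sets, as subsets of \<open>K\<close>, in the universe.\<close>

lemma pullback_universe_subfamily:
  assumes D: "D \<in> pullback_universe M F \<kappa>" and A: "\<And>\<tau>. A \<tau> \<subseteq> D \<tau>" "\<And>\<tau>. A \<tau> \<noteq> {}"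
  shows "A \<in> pullback_universe M F \<kappa>"
proof -
  note D' = pullback_universeD[OF D]
  have bdd: "bdd_above (class_norm M ` A \<tau>)" for \<tau>
    using D'(3) image_mono[OF A(1)] by (rule bdd_above_mono)
  have le: "(SUP X\<in>A \<tau>. class_norm M X)\<^sup>2 \<le> (SUP X\<in>D \<tau>. class_norm M X)\<^sup>2" for \<tau>
  proof (rule power_mono)
    show "(SUP X\<in>A \<tau>. class_norm M X) \<le> (SUP X\<in>D \<tau>. class_norm M X)"
      by (rule cSUP_subset_mono[OF A(2) D'(3) A(1)]) simp
    obtain X where X: "X \<in> A \<tau>" using A(2) by blast
    have "0 \<le> class_norm M X" by (rule class_norm_nonneg)
    also have "\<dots> \<le> (SUP X\<in>A \<tau>. class_norm M X)" by (rule cSUP_upper[OF X bdd])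
    finally show "0 \<le> (SUP X\<in>A \<tau>. class_norm M X)" .
  qed
  have "((\<lambda>\<tau>. exp (\<kappa> * \<tau>) * (SUP X\<in>A \<tau>. class_norm M X)\<^sup>2) \<longlongrightarrow> 0) at_bot"
    by (rule tendsto_sandwich[OF always_eventually always_eventually tendsto_const D'(4)])
       (simp_all add: le)
  then show ?thesis
    unfolding pullback_universe_def using order_trans[OF A(1) D'(1)] A(2) bdd by simp
qed

text \<open>Each attractor is an admissible competitor in the minimality property of the
  other.\<close>

lemma weak_pullback_attractor_unique:
  assumes "weak_pullback_attractor M F \<DD> \<Phi> \<A>" "weak_pullback_attractor M F \<DD> \<Phi> \<A>'"
  shows "\<A>' = \<A>"
proof
  fix \<tau>
  have "\<A> \<tau> \<subseteq> \<A>' \<tau>" "\<A>' \<tau> \<subseteq> \<A> \<tau>"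
    using assms unfolding weak_pullback_attractor_def by blast+
  then show "\<A>' \<tau> = \<A> \<tau>" by (rule equalityI[rotated])
qed

text \<open>The equation is left behind here: what remains is a cocycle and a weakly compact
  absorbing family which, as a member of the universe, also absorbs itself.\<close>

locale weak_pullback_absorbing =
  fixes M :: "'w measure" and F :: "real \<Rightarrow> 'w measure" and \<kappa> :: real
    and \<Phi> :: "real \<Rightarrow> real \<Rightarrow> ('w \<Rightarrow> 'h::{real_inner, banach, second_countable_topology}) set \<Rightarrow> ('w \<Rightarrow> 'h) set"
    and K :: "real \<Rightarrow> ('w \<Rightarrow> 'h) set set"
  assumes basis: "stochastic_basis M F"
    and mrds: "mean_random_dynamical_system M F \<Phi>"
    and absorbing: "weakly_compact_absorbing M F (pullback_universe M F \<kappa>) \<Phi> K"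
begin

definition tail :: "real \<Rightarrow> real \<Rightarrow> ('w \<Rightarrow> 'h) set set" where
  "tail \<tau> s = (\<Union>t\<in>{s..}. \<Phi> t (\<tau> - t) ` K (\<tau> - t))"

definition omega_limit :: "real \<Rightarrow> ('w \<Rightarrow> 'h) set set" where
  "omega_limit \<tau> = (\<Inter>s\<in>{0..}. weak_topology M (F \<tau>) closure_of tail \<tau> s)"

lemma topspace_weak: "topspace (weak_topology M (F \<tau>) :: ('w \<Rightarrow> 'h) set topology) = L2_space M (F \<tau>)"
  by (rule prob_subalgebra.topspace_weak_topology[OF stochastic_basisD(3)[OF basis]])

lemma Hausdorff: "Hausdorff_space (weak_topology M (F \<tau>) :: ('w \<Rightarrow> 'h) set topology)"
  by (rule prob_subalgebra.Hausdorff_weak_topology[OF stochastic_basisD(3)[OF basis]])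

lemma K_universe: "K \<in> pullback_universe M F \<kappa>"
  and K_compact: "compactin (weak_topology M (F \<tau>)) (K \<tau>)"
  and K_absorbing: "D \<in> pullback_universe M F \<kappa> \<Longrightarrow> \<exists>T>0. \<forall>t\<ge>T. \<Phi> t (\<tau> - t) ` D (\<tau> - t) \<subseteq> K \<tau>"
  using absorbing unfolding weakly_compact_absorbing_def by blast+

lemma image_L2_space: "0 \<le> t \<Longrightarrow> \<Phi> t (\<tau> - t) ` L2_space M (F (\<tau> - t)) \<subseteq> L2_space M (F \<tau>)"
  using mrds[unfolded mean_random_dynamical_system_def, THEN conjunct1, rule_format, of t "\<tau> - t"] by simp

lemma tail_antimono: "s \<le> s' \<Longrightarrow> tail \<tau> s' \<subseteq> tail \<tau> s"
  unfolding tail_def by (rule UN_mono) auto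

lemma tail_subset: "0 \<le> s \<Longrightarrow> tail \<tau> s \<subseteq> L2_space M (F \<tau>)"
  unfolding tail_def
proof (rule UN_least)
  fix t assume "0 \<le> s" "t \<in> {s..}"
  then have "0 \<le> t" by simp
  from image_L2_space[OF this] show "\<Phi> t (\<tau> - t) ` K (\<tau> - t) \<subseteq> L2_space M (F \<tau>)"
    by (rule order_trans[OF image_mono[OF pullback_universeD(1)[OF K_universe]]])
qed

lemma tail_closure_nonempty: "0 \<le> s \<Longrightarrow> weak_topology M (F \<tau>) closure_of tail \<tau> s \<noteq> {}"
proof -
  assume s: "0 \<le> s"
  have "tail \<tau> s \<noteq> {}" unfolding tail_def using pullback_universeD(2)[OF K_universe] by fastforce
  then show ?thesis
    using closure_of_subset[of "tail \<tau> s" "weak_topology M (F \<tau>)"] tail_subset[OF s, of \<tau>]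
    unfolding topspace_weak by blast
qed

text \<open>\<open>K\<close> absorbs itself, and its members are weakly closed because compact sets
  in a Hausdorff space are.\<close>

lemma tail_closure_eventually_in_K:
  obtains T where "0 < T" "weak_topology M (F \<tau>) closure_of tail \<tau> T \<subseteq> K \<tau>"
proof -
  obtain T where T: "T > 0" "\<forall>t\<ge>T. \<Phi> t (\<tau> - t) ` K (\<tau> - t) \<subseteq> K \<tau>"
    using K_absorbing[OF K_universe] by blast
  have "tail \<tau> T \<subseteq> K \<tau>" unfolding tail_def using T(2) by (intro UN_least) simp
  then have "weak_topology M (F \<tau>) closure_of tail \<tau> T \<subseteq> K \<tau>"
    by (rule closure_of_minimal[OF _ compactin_imp_closedin[OF Hausdorff K_compact]])
  with T(1) show thesis by (rule that)
qed

lemma omega_limit_subset_K: "omega_limit \<tau> \<subseteq> K \<tau>"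
proof -
  obtain T where T: "0 < T" "weak_topology M (F \<tau>) closure_of tail \<tau> T \<subseteq> K \<tau>"
    by (rule tail_closure_eventually_in_K)
  have "omega_limit \<tau> \<subseteq> weak_topology M (F \<tau>) closure_of tail \<tau> T"
    unfolding omega_limit_def using T(1) by (intro INT_lower) simp
  then show ?thesis using T(2) by (rule order_trans)
qed

lemma omega_limit_compact: "compactin (weak_topology M (F \<tau>)) (omega_limit \<tau>)"
proof (rule closed_compactin[OF K_compact omega_limit_subset_K])
  show "closedin (weak_topology M (F \<tau>)) (omega_limit \<tau>)"
    unfolding omega_limit_def by (intro closedin_Inter) auto
qed

text \<open>If all late closures left \<open>N\<close>, the closed sets obtained by removing
  \<open>N\<close> would have the finite intersection property inside the compact
  \<open>K \<tau>\<close>; a common point would be a limit point outside \<open>N\<close>.\<close>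

lemma tail_closure_in_neighbourhood:
  assumes N: "openin (weak_topology M (F \<tau>)) N" and sub: "omega_limit \<tau> \<subseteq> N"
  obtains s where "0 \<le> s" "weak_topology M (F \<tau>) closure_of tail \<tau> s \<subseteq> N"
proof -
  obtain T where T: "0 < T" "weak_topology M (F \<tau>) closure_of tail \<tau> T \<subseteq> K \<tau>"
    by (rule tail_closure_eventually_in_K)
  let ?cl = "\<lambda>s. weak_topology M (F \<tau>) closure_of tail \<tau> s"
  have anti: "?cl s' \<subseteq> ?cl s" if "s \<le> s'" for s s'
    by (rule closure_of_mono[OF tail_antimono[OF that]])
  have "\<exists>s\<ge>T. ?cl s \<subseteq> N"
  proof (rule ccontr)
    assume no: "\<not> (\<exists>s\<ge>T. ?cl s \<subseteq> N)"
    define \<U> where "\<U> = (\<lambda>s. ?cl s - N) ` {T..}"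
    have "K \<tau> \<inter> \<Inter>\<U> \<noteq> {}"
    proof (rule K_compact[unfolded compactin_fip, THEN conjunct2, rule_format], intro conjI ballI allI impI)
      fix C assume "C \<in> \<U>"
      then obtain s where "C = ?cl s - N" unfolding \<U>_def by (rule imageE)
      then show "closedin (weak_topology M (F \<tau>)) C"
        using closedin_diff[OF closedin_closure_of N] by simp
    next
      fix \<F> assume \<F>: "finite \<F> \<and> \<F> \<subseteq> \<U>"
      then have "finite \<F>" "\<F> \<subseteq> (\<lambda>s. ?cl s - N) ` {T..}" by (simp_all add: \<U>_def)
      from finite_subset_image[OF this] obtain S where S: "S \<subseteq> {T..}" "finite S" "\<F> = (\<lambda>s. ?cl s - N) ` S"
        by (elim exE conjE)
      \<comment> \<open>Closures shrink with time, so the largest index handles the finite family.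
        Inserting \<open>T\<close> covers the empty family and keeps the chosen point in
        \<open>K \<tau>\<close>.\<close>
      define m where "m = Max (insert T S)"
      have m: "T \<le> m" "\<And>s. s \<in> S \<Longrightarrow> s \<le> m" using S(2) by (simp_all add: m_def)
      obtain Y where Y: "Y \<in> ?cl m" "Y \<notin> N" using no m(1) by blast
      have "Y \<in> K \<tau>" using Y(1) anti[OF m(1)] T(2) by blast
      moreover have "Y \<in> \<Inter>\<F>" unfolding S(3) using Y anti[OF m(2)] by blast
      ultimately show "K \<tau> \<inter> \<Inter>\<F> \<noteq> {}" by blast
    qed
    then obtain Y where Y: "\<And>s. T \<le> s \<Longrightarrow> Y \<in> ?cl s - N" unfolding \<U>_def by blast
    have "Y \<in> ?cl s" for s
    proof (cases "T \<le> s")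
      case True
      then show ?thesis using Y by blast
    next
      case False
      then show ?thesis using Y[of T] anti[of s T] by auto
    qed
    then have "Y \<in> omega_limit \<tau>" by (simp add: omega_limit_def)
    then show False using sub Y[of T] by blast
  qed
  then obtain s where "T \<le> s" "?cl s \<subseteq> N" by blast
  with T(1) show thesis by (intro that[of s]) auto
qed

text \<open>The empty set would be an open neighbourhood of an empty limit set and would have to
  contain a closure of a tail.\<close>

lemma omega_limit_nonempty: "omega_limit \<tau> \<noteq> {}"
proof
  assume "omega_limit \<tau> = {}"
  then have "omega_limit \<tau> \<subseteq> {}" by simp
  then obtain s where "0 \<le> s" "weak_topology M (F \<tau>) closure_of tail \<tau> s \<subseteq> {}"
    by (rule tail_closure_in_neighbourhood[OF openin_empty])
  then show False using tail_closure_nonempty by blast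
qed

lemma omega_limit_universe: "omega_limit \<in> pullback_universe M F \<kappa>"
  using K_universe omega_limit_subset_K omega_limit_nonempty by (rule pullback_universe_subfamily)

text \<open>A time shift by \<open>s\<close> lets \<open>K\<close> absorb \<open>D\<close> first; the cocycle property then puts the image of \<open>D\<close> into the
  tail from time \<open>s\<close>.\<close>

lemma omega_limit_attracting: "weakly_attracting M F (pullback_universe M F \<kappa>) \<Phi> omega_limit"
  unfolding weakly_attracting_def
proof (intro allI ballI impI)
  fix \<tau> and D :: "real \<Rightarrow> ('w \<Rightarrow> 'h) set set" and \<N> :: "('w \<Rightarrow> 'h) set set"
  assume D: "D \<in> pullback_universe M F \<kappa>"
    and "\<exists>O'. openin (weak_topology M (F \<tau>)) O' \<and> omega_limit \<tau> \<subseteq> O' \<and> O' \<subseteq> \<N>"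
  then obtain N where N: "openin (weak_topology M (F \<tau>)) N" "omega_limit \<tau> \<subseteq> N" "N \<subseteq> \<N>" by blast
  obtain s where s: "0 \<le> s" "weak_topology M (F \<tau>) closure_of tail \<tau> s \<subseteq> N"
    by (rule tail_closure_in_neighbourhood[OF N(1,2)])
  have tail: "tail \<tau> s \<subseteq> \<N>"
    using closure_of_subset[of "tail \<tau> s" "weak_topology M (F \<tau>)"] tail_subset[OF s(1), of \<tau>] s(2) N(3)
    unfolding topspace_weak by blast
  obtain T where T: "T > 0" "\<forall>t\<ge>T. \<Phi> t (\<tau> - s - t) ` D (\<tau> - s - t) \<subseteq> K (\<tau> - s)"
    using K_absorbing[OF D] by blast
  have "\<Phi> t (\<tau> - t) ` D (\<tau> - t) \<subseteq> \<N>" if t: "t \<ge> T + s" for t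
  proof (rule image_subsetI)
    fix X assume X: "X \<in> D (\<tau> - t)"
    have eq: "\<tau> - s - (t - s) = \<tau> - t" by simp
    have "\<Phi> (t - s) (\<tau> - t) X \<in> K (\<tau> - s)"
      using T(2)[rule_format, of "t - s", unfolded eq] X t by auto
    moreover have "\<Phi> t (\<tau> - t) X = \<Phi> s (\<tau> - s) (\<Phi> (t - s) (\<tau> - t) X)"
      using mrds[unfolded mean_random_dynamical_system_def, THEN conjunct2, THEN conjunct2, rule_format,
          of "t - s" s X "\<tau> - t"] X pullback_universeD(1)[OF D, of "\<tau> - t"] s(1) t T(1) by auto
    ultimately have "\<Phi> t (\<tau> - t) X \<in> tail \<tau> s"
      unfolding tail_def by (intro UN_I[of s]) auto
    then show "\<Phi> t (\<tau> - t) X \<in> \<N>" using tail by blast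
  qed
  then show "\<exists>T>0. \<forall>t\<ge>T. \<Phi> t (\<tau> - t) ` D (\<tau> - t) \<subseteq> \<N>"
    using T(1) s(1) by (intro exI[of _ "T + s"]) simp
qed

text \<open>A point outside the compact \<open>E \<tau>\<close> has a neighbourhood disjoint from
  some neighbourhood of \<open>E \<tau>\<close>. The latter captures a whole tail of
  \<open>K\<close>, so the point cannot lie in the closure of that tail.\<close>

lemma omega_limit_minimal:
  assumes E: "compactin (weak_topology M (F \<tau>)) (E \<tau>)"
    and attr: "weakly_attracting M F (pullback_universe M F \<kappa>) \<Phi> E"
  shows "omega_limit \<tau> \<subseteq> E \<tau>"
proof
  fix Y assume Y: "Y \<in> omega_limit \<tau>"
  show "Y \<in> E \<tau>"
  proof (rule ccontr)
    assume "Y \<notin> E \<tau>"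
    have "Y \<in> topspace (weak_topology M (F \<tau>))"
      using Y compactin_subset_topspace[OF omega_limit_compact] by blast
    then have "compactin (weak_topology M (F \<tau>)) {Y}" by simp
    moreover have "disjnt {Y} (E \<tau>)" using \<open>Y \<notin> E \<tau>\<close> by simp
    ultimately obtain U V where UV: "openin (weak_topology M (F \<tau>)) U" "openin (weak_topology M (F \<tau>)) V"
        "{Y} \<subseteq> U" "E \<tau> \<subseteq> V" "disjnt U V"
      using Hausdorff_space_compact_separation[OF Hausdorff _ E] by metis
    obtain T where T: "T > 0" "\<forall>t\<ge>T. \<Phi> t (\<tau> - t) ` K (\<tau> - t) \<subseteq> V"
      using attr[unfolded weakly_attracting_def, rule_format, OF K_universe, of \<tau> V] UV(2,4) by blast
    have "Y \<in> weak_topology M (F \<tau>) closure_of tail \<tau> T"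
      using Y T(1) unfolding omega_limit_def by simp
    then obtain Z where "Z \<in> tail \<tau> T" "Z \<in> U" using UV(1,3) unfolding in_closure_of by blast
    moreover have "tail \<tau> T \<subseteq> V" unfolding tail_def using T(2) by (intro UN_least) simp
    ultimately show False using UV(5) unfolding disjnt_iff by blast
  qed
qed

lemma weak_pullback_attractor_omega_limit:
  "weak_pullback_attractor M F (pullback_universe M F \<kappa>) \<Phi> omega_limit"
  unfolding weak_pullback_attractor_def
  using omega_limit_universe omega_limit_compact omega_limit_attracting omega_limit_minimal by blast

end


section \<open>The absorbing set and the attractor\<close>

text \<open>This integral is what remains of the forcing term of the radius \<open>R\<close> after
  multiplication by exp (\<kappa> \<tau>).\<close>

lemma set_integral_atMost_tendsto_0:
  fixes \<phi> :: "real \<Rightarrow> real"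
  assumes int: "set_integrable lborel {..a} \<phi>"
  shows "((\<lambda>\<tau>. LINT s:{..\<tau>}|lborel. \<phi> s) \<longlongrightarrow> 0) at_bot"
proof -
  have meas: "(\<lambda>s. indicator {..min a \<tau>} s *\<^sub>R \<phi> s) \<in> borel_measurable lborel" for \<tau>
  proof -
    have "set_integrable lborel {..min a \<tau>} \<phi>" by (rule set_integrable_subset[OF int]) auto
    then show ?thesis unfolding set_integrable_def by (rule borel_measurable_integrable)
  qed
  \<comment> \<open>Dominated convergence after the reflection \<tau> = -t. The truncation at
    \<open>a\<close> gives one dominating function for all t and has no effect once t \<ge>
    -a.\<close>
  have "((\<lambda>t. \<integral>s. indicator {..min a (- t)} s *\<^sub>R \<phi> s \<partial>lborel) \<longlongrightarrow> (\<integral>s. 0 \<partial>(lborel :: real measure))) at_top"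
  proof (rule integral_dominated_convergence_at_top)
    show "(\<lambda>s::real. 0::real) \<in> borel_measurable lborel" by simp
    show "(\<lambda>s. indicator {..min a (- t)} s *\<^sub>R \<phi> s) \<in> borel_measurable lborel" for t by (rule meas)
    show "integrable lborel (\<lambda>s. norm (indicator {..a} s *\<^sub>R \<phi> s))"
      using int unfolding set_integrable_def by (rule integrable_norm)
    show "\<forall>\<^sub>F t in at_top. AE s in lborel. norm (indicator {..min a (- t)} s *\<^sub>R \<phi> s) \<le> norm (indicator {..a} s *\<^sub>R \<phi> s)"
      by (intro always_eventually allI AE_I2) (auto simp: indicator_def)
    show "AE s in lborel. ((\<lambda>t. indicator {..min a (- t)} s *\<^sub>R \<phi> s) \<longlongrightarrow> 0) at_top"
    proof (rule AE_I2)
      fix s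
      have "\<forall>\<^sub>F t in at_top. indicator {..min a (- t)} s *\<^sub>R \<phi> s = 0"
        using eventually_gt_at_top[of "- s"] by eventually_elim (auto simp: indicator_def)
      then show "((\<lambda>t. indicator {..min a (- t)} s *\<^sub>R \<phi> s) \<longlongrightarrow> 0) at_top" by (rule tendsto_eventually)
    qed
  qed
  moreover have "\<forall>\<^sub>F t in at_top. (\<integral>s. indicator {..min a (- t)} s *\<^sub>R \<phi> s \<partial>lborel) = (LINT s:{..- t}|lborel. \<phi> s)"
    using eventually_ge_at_top[of "- a"]
    by eventually_elim (simp add: set_lebesgue_integral_def min_absorb2)
  ultimately have "((\<lambda>t. LINT s:{..- t}|lborel. \<phi> s) \<longlongrightarrow> 0) at_top"
    unfolding Bochner_Integration.integral_zero by (rule Lim_transform_eventually)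
  then show ?thesis by (simp only: filterlim_at_bot_mirror)
qed

text \<open>The norms on \<open>K \<tau>\<close> are bounded by the square root of
  \<open>R \<tau>\<close>, so temperedness reduces to the limit assumed for \<open>R\<close>, and
  compactness is that of closed balls.\<close>

lemma ball_in_pullback_universe:
  fixes R :: "real \<Rightarrow> real" and K :: "real \<Rightarrow> ('w \<Rightarrow> 'h::{real_inner, banach, second_countable_topology}) set set"
  assumes basis: "stochastic_basis M F"
    and R: "\<And>\<tau>. 0 \<le> R \<tau>" "((\<lambda>\<tau>. exp (\<kappa> * \<tau>) * R \<tau>) \<longlongrightarrow> 0) at_bot"
    and K: "K = (\<lambda>\<tau>. {X \<in> L2_space M (F \<tau>). (class_norm M X)\<^sup>2 \<le> R \<tau>})"
  shows "K \<in> pullback_universe M F \<kappa>" "compactin (weak_topology M (F \<tau>)) (K \<tau>)"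
proof -
  note nonneg = class_norm_nonneg
  have K_eq: "K \<tau> = {X \<in> L2_space M (F \<tau>). class_norm M X \<le> sqrt (R \<tau>)}" for \<tau>
  proof -
    have "(class_norm M X)\<^sup>2 \<le> R \<tau> \<longleftrightarrow> class_norm M X \<le> sqrt (R \<tau>)" for X :: "('w \<Rightarrow> 'h) set"
    proof
      show "class_norm M X \<le> sqrt (R \<tau>)" if "(class_norm M X)\<^sup>2 \<le> R \<tau>"
        using that by (rule real_le_rsqrt)
      show "(class_norm M X)\<^sup>2 \<le> R \<tau>" if "class_norm M X \<le> sqrt (R \<tau>)"
        using power_mono[OF that nonneg, of 2] by (simp add: R(1))
    qed
    then show ?thesis by (simp add: K)
  qed
  show "compactin (weak_topology M (F \<tau>)) (K \<tau>)"
    unfolding K_eq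
    by (rule prob_subalgebra.compactin_weak_topology_ball[OF stochastic_basisD(3)[OF basis]])
       (simp add: R(1))
  have bound: "class_norm M X \<le> sqrt (R \<tau>)" if "X \<in> K \<tau>" for X \<tau>
    using that by (simp add: K_eq)
  have bdd: "bdd_above (class_norm M ` K \<tau>)" for \<tau>
    using bound by (intro bdd_aboveI[of _ "sqrt (R \<tau>)"]) auto
  have ne: "K \<tau> \<noteq> {}" for \<tau>
  proof -
    interpret prob_subalgebra M "F \<tau>" by (rule stochastic_basisD(3)[OF basis])
    have "class_norm M (ae_class M (\<lambda>_. 0::'h)) = 0"
      unfolding class_norm_ae_class[OF L2_fun_borel[OF L2_fun_zero]] by (simp add: L2_norm_def)
    moreover have "ae_class M (\<lambda>_. 0::'h) \<in> L2_space M (F \<tau>)"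
      unfolding L2_space_def using L2_fun_zero by (rule imageI)
    ultimately have "ae_class M (\<lambda>_. 0::'h) \<in> K \<tau>"
      using R(1)[of \<tau>] by (simp add: K_eq)
    then show ?thesis by blast
  qed
  have le: "(SUP X\<in>K \<tau>. class_norm M X)\<^sup>2 \<le> R \<tau>" for \<tau>
  proof -
    obtain X where X: "X \<in> K \<tau>" using ne by blast
    have "0 \<le> (SUP X\<in>K \<tau>. class_norm M X)" using nonneg cSUP_upper[OF X bdd] by (rule order_trans)
    moreover have "(SUP X\<in>K \<tau>. class_norm M X) \<le> sqrt (R \<tau>)" by (rule cSUP_least[OF ne bound])
    ultimately have "(SUP X\<in>K \<tau>. class_norm M X)\<^sup>2 \<le> (sqrt (R \<tau>))\<^sup>2" by (intro power_mono)
    then show ?thesis by (simp add: R(1))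
  qed
  have "((\<lambda>\<tau>. exp (\<kappa> * \<tau>) * (SUP X\<in>K \<tau>. class_norm M X)\<^sup>2) \<longlongrightarrow> 0) at_bot"
    by (rule tendsto_sandwich[OF always_eventually always_eventually tendsto_const R(2)])
       (simp_all add: le)
  then show "K \<in> pullback_universe M F \<kappa>"
    unfolding pullback_universe_def using bdd ne by (simp add: K_eq)
qed

theorem theorem4p4:
  fixes M :: "'w measure" and F :: "real \<Rightarrow> 'w measure"
    and DA :: "'h::{real_inner, banach, second_countable_topology} set" and A :: "'h \<Rightarrow> 'h"
    and DS :: "'h set" and S :: "'h \<Rightarrow> 'h"
    and j :: "'v::{real_inner, banach, second_countable_topology} \<Rightarrow>\<^sub>L 'h"
    and iVQ :: "'v \<Rightarrow>\<^sub>L 'q::{banach, second_countable_topology}" and iQH :: "'q \<Rightarrow>\<^sub>L 'h"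
    and B :: "'v \<Rightarrow> 'v \<Rightarrow> ('v \<Rightarrow>\<^sub>L real)"
    and W :: "real \<Rightarrow> 'u::{real_inner, banach, second_countable_topology} \<Rightarrow> 'w \<Rightarrow> real"
    and \<nu> :: "'z::{topological_space, zero} measure" and N :: "'w \<Rightarrow> (real \<times> 'z) measure"
    and h :: "real \<Rightarrow> 'h \<Rightarrow> ('u \<Rightarrow>\<^sub>L 'h)" and G :: "'h \<Rightarrow> 'z \<Rightarrow> 'h"
    and f :: "real \<Rightarrow> ('v \<Rightarrow>\<^sub>L real)"
    and \<mu> lam\<^sub>1 c\<^sub>0 C\<^sub>B L\<^sub>g \<kappa> \<epsilon>\<^sub>0 \<epsilon>\<^sub>1 \<epsilon>\<^sub>2 \<rho>\<^sub>0 :: real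
    and sol :: "real \<Rightarrow> ('w \<Rightarrow> 'h) \<Rightarrow> (real \<Rightarrow> 'w \<Rightarrow> 'h) \<Rightarrow> bool"
    and \<Phi> :: "real \<Rightarrow> real \<Rightarrow> ('w \<Rightarrow> 'h) set \<Rightarrow> ('w \<Rightarrow> 'h) set"
    and \<DD> :: "(real \<Rightarrow> ('w \<Rightarrow> 'h) set set) set"
    and R :: "real \<Rightarrow> real" and K :: "real \<Rightarrow> ('w \<Rightarrow> 'h) set set"
  defines "sol \<equiv> is_solution M F W \<nu> N j S \<mu> B f \<epsilon>\<^sub>1 h \<epsilon>\<^sub>2 G"
    and "\<Phi> \<equiv> solution_map M F sol"
    and "\<DD> \<equiv> pullback_universe M F \<kappa>"
    and "R \<equiv> (\<lambda>\<tau>. \<rho>\<^sub>0 + \<rho>\<^sub>0 * exp (- \<kappa> * \<tau>) * (LINT s:{..\<tau>}|lborel. exp (\<kappa> * s) * (norm (f s))\<^sup>2))"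
    and "K \<equiv> (\<lambda>\<tau>. {X \<in> L2_space M (F \<tau>). (class_norm M X)\<^sup>2 \<le> R \<tau>})"
  assumes mu: "\<mu> > 0"
    \<comment> \<open>the operator and the spaces \<open>V \<subseteq> Q \<subseteq> H\<close>\<close>
    and A: "positive_self_adjoint_op DA A" "compactly_embedded_domain DA A"
    and S: "is_sqrt_op DA A DS S"
    and V: "range (blinfun_apply j) = DS" "\<And>v. norm v = norm (S (blinfun_apply j v))"
    and lam: "lam\<^sub>1 > 0" "\<And>v. lam\<^sub>1 * (norm (blinfun_apply j v))\<^sup>2 \<le> (norm v)\<^sup>2"
    and B_cont: "bounded_bilinear B"
    and B1: "\<And>u v w. blinfun_apply (B u v) w = - blinfun_apply (B u w) v"
    and Q: "reflexive_space TYPE('q)" "inj (blinfun_apply iQH)"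
           "\<And>v. blinfun_apply iQH (blinfun_apply iVQ v) = blinfun_apply j v"
    and B2: "c\<^sub>0 > 0"
            "\<And>v. (norm (blinfun_apply iVQ v))\<^sup>2 \<le> c\<^sub>0 * norm (blinfun_apply j v) * norm v"
    and B3: "C\<^sub>B > 0"
            "\<And>u v w. \<bar>blinfun_apply (B u v) w\<bar>
               \<le> C\<^sub>B * norm (blinfun_apply iVQ u) * norm v * norm (blinfun_apply iVQ w)"
    \<comment> \<open>the noise\<close>
    and basis: "stochastic_basis M F"
    and wiener: "cylindrical_wiener M F W"
    and nu: "sets \<nu> = sets borel" "sigma_finite_measure \<nu>" "{0} \<in> null_sets \<nu>"
    and poisson: "poisson_random_measure M F \<nu> N"
    and indep: "independent_noises M \<nu> W N"
    \<comment> \<open>the coefficients\<close>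
    and h_meas: "(\<lambda>(t, x). h t x) \<in> borel \<Otimes>\<^sub>M borel \<rightarrow>\<^sub>M hs_borel"
    and G_meas: "(\<lambda>(x, z). G x z) \<in> borel_measurable (borel \<Otimes>\<^sub>M \<nu>)"
    and C2: "L\<^sub>g > 0"
            "\<And>t x. hs_norm_sq (h t x) + (\<integral>\<^sup>+z. ennreal ((norm (G x z))\<^sup>2) \<partial>\<nu>)
               \<le> ennreal (L\<^sub>g * (1 + (norm x)\<^sup>2))"
    and C3: "\<And>r. r > 0 \<Longrightarrow> \<exists>L>0. \<forall>t x y. norm x \<le> r \<and> norm y \<le> r \<longrightarrow>
               hs_norm_sq (h t x - h t y) + (\<integral>\<^sup>+z. ennreal ((norm (G x z - G y z))\<^sup>2) \<partial>\<nu>)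
               \<le> ennreal (L * (norm (x - y))\<^sup>2)"
    and kappa: "\<kappa> \<ge> 1" "\<mu> * lam\<^sub>1 / 2 - \<kappa> > 0"
    and f: "f \<in> borel_measurable lborel"
           "\<And>\<tau>. (\<integral>\<^sup>+s\<in>{..\<tau>}. ennreal (exp (\<kappa> * s) * (norm (f s))\<^sup>2) \<partial>lborel) < \<infinity>"
    and eps0: "\<epsilon>\<^sub>0 = min 1 (sqrt (\<mu> * lam\<^sub>1 / (2 * L\<^sub>g)))"
    and eps: "\<epsilon>\<^sub>1 \<in> {0<..\<epsilon>\<^sub>0}" "\<epsilon>\<^sub>2 \<in> {0<..\<epsilon>\<^sub>0}"
    \<comment> \<open>existence and uniqueness of solutions, and the constant of the absorbing set\<close>
    and wp: "well_posed M F sol"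
    and rho0: "\<rho>\<^sub>0 > 0"
              "\<And>\<tau> D. D \<in> \<DD> \<Longrightarrow> \<exists>T>0. \<forall>t\<ge>T. \<forall>\<xi> u.
                 \<xi> \<in> L2_fun M (F (\<tau> - t)) \<and> ae_class M \<xi> \<in> D (\<tau> - t) \<and> sol (\<tau> - t) \<xi> u \<longrightarrow>
                 (\<integral>\<omega>. (norm (u \<tau> \<omega>))\<^sup>2 \<partial>M) \<le> R \<tau>"
  shows "mean_random_dynamical_system M F \<Phi> \<and>
         weakly_compact_absorbing M F \<DD> \<Phi> K \<and>
         (\<exists>\<A>. weak_pullback_attractor M F \<DD> \<Phi> \<A> \<and>
            (\<forall>\<A>'. weak_pullback_attractor M F \<DD> \<Phi> \<A>' \<longrightarrow> \<A>' = \<A>) \<and>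
            (\<forall>\<tau>. \<A> \<tau> = (\<Inter>s\<in>{0..}.
               weak_topology M (F \<tau>) closure_of (\<Union>t\<in>{s..}. \<Phi> t (\<tau> - t) ` K (\<tau> - t)))))"
proof -
  interpret prob_subalgebra M "F \<tau>" for \<tau> by (rule stochastic_basisD(3)[OF basis])
  have restart: "sol \<tau>' \<xi>' u"
    if "sol \<tau> \<xi> u" "\<tau> \<le> \<tau>'" "AE \<omega> in M. \<xi>' \<omega> = u \<tau>' \<omega>" for \<tau> \<tau>' \<xi> \<xi>' u
    using is_solution_restart[OF that(1)[unfolded sol_def] that(2,3) basis poisson nu(2)]
    unfolding sol_def .
  have initial: "AE \<omega> in M. u \<tau> \<omega> = \<xi> \<omega>" if "sol \<tau> \<xi> u" for \<tau> \<xi> u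
    using that[unfolded sol_def is_solution_def, THEN conjunct2, THEN conjunct2, THEN conjunct1] .
  have mrds: "mean_random_dynamical_system M F \<Phi>"
    unfolding \<Phi>_def
  proof (rule solution_map_mean_random_dynamical_system[OF basis wp])
    show "sol \<tau>' \<xi>' u" if "sol \<tau> \<xi> u" "\<tau> \<le> \<tau>'" "AE \<omega> in M. \<xi>' \<omega> = u \<tau>' \<omega>" for \<tau> \<tau>' \<xi> \<xi>' u
      using that by (rule restart)
    show "AE \<omega> in M. u \<tau> \<omega> = \<xi> \<omega>" if "sol \<tau> \<xi> u" for \<tau> \<xi> u
      using that by (rule initial)
  qed
  define \<phi> where "\<phi> s = exp (\<kappa> * s) * (norm (f s))\<^sup>2" for s
  have norm_f: "(\<lambda>s. norm (f s)) \<in> borel_measurable lborel"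
    by (rule measurable_compose[OF f(1)]) (intro borel_measurable_continuous_onI continuous_intros)
  \<comment> \<open>Finiteness of the nonnegative integral ensures that the integral in
    \<open>R\<close> is the true one and not the default value 0 of a nonintegrable
    function.\<close>
  have int: "set_integrable lborel {..\<tau>} \<phi>" for \<tau>
    unfolding set_integrable_def
  proof (rule integrableI_bounded)
    show "(\<lambda>s. indicator {..\<tau>} s *\<^sub>R \<phi> s) \<in> borel_measurable lborel"
      unfolding \<phi>_def using norm_f by measurable
    have "(\<integral>\<^sup>+s. ennreal (norm (indicator {..\<tau>} s *\<^sub>R \<phi> s)) \<partial>lborel)
        = (\<integral>\<^sup>+s\<in>{..\<tau>}. ennreal (exp (\<kappa> * s) * (norm (f s))\<^sup>2) \<partial>lborel)"
      by (rule nn_integral_cong) (simp add: \<phi>_def indicator_def)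
    also have "\<dots> < \<infinity>" by (rule f(2))
    finally show "(\<integral>\<^sup>+s. ennreal (norm (indicator {..\<tau>} s *\<^sub>R \<phi> s)) \<partial>lborel) < \<infinity>" .
  qed
  have R_eq: "R \<tau> = \<rho>\<^sub>0 + \<rho>\<^sub>0 * exp (- \<kappa> * \<tau>) * (LINT s:{..\<tau>}|lborel. \<phi> s)" for \<tau>
    by (simp add: R_def \<phi>_def)
  have "0 \<le> (LINT s:{..\<tau>}|lborel. \<phi> s)" for \<tau>
    unfolding set_lebesgue_integral_def by (rule Bochner_Integration.integral_nonneg) (simp add: \<phi>_def)
  then have R_nonneg: "0 \<le> R \<tau>" for \<tau> using rho0(1) by (simp add: R_eq)
  \<comment> \<open>Multiplying \<open>R\<close> by exp (\<kappa> \<tau>) cancels its factor exp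
    (-\<kappa> \<tau>) and leaves multiples of exp (\<kappa> \<tau>) and of the tail integral. The
    former vanishes at minus infinity because \<kappa> > 0, the latter because the integral
    converges.\<close>
  have "((\<lambda>\<tau>. exp (\<kappa> * \<tau>)) \<longlongrightarrow> 0) at_bot"
    by (rule filterlim_compose[OF exp_at_bot])
       (use kappa(1) in \<open>auto intro!: filterlim_tendsto_pos_mult_at_bot[OF tendsto_const _ filterlim_ident]\<close>)
  then have "((\<lambda>\<tau>. \<rho>\<^sub>0 * exp (\<kappa> * \<tau>) + \<rho>\<^sub>0 * (LINT s:{..\<tau>}|lborel. \<phi> s)) \<longlongrightarrow> \<rho>\<^sub>0 * 0 + \<rho>\<^sub>0 * 0) at_bot"
    by (intro tendsto_intros set_integral_atMost_tendsto_0[OF int[of 0]])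
  moreover have "\<rho>\<^sub>0 * exp (\<kappa> * \<tau>) + \<rho>\<^sub>0 * (LINT s:{..\<tau>}|lborel. \<phi> s) = exp (\<kappa> * \<tau>) * R \<tau>" for \<tau>
    by (simp add: R_eq exp_minus field_simps)
  ultimately have R_lim: "((\<lambda>\<tau>. exp (\<kappa> * \<tau>) * R \<tau>) \<longlongrightarrow> 0) at_bot" by simp
  have K_eq: "K = (\<lambda>\<tau>. {X \<in> L2_space M (F \<tau>). (class_norm M X)\<^sup>2 \<le> R \<tau>})" by (simp only: K_def)
  note K_ball = ball_in_pullback_universe[OF basis R_nonneg R_lim K_eq]
  \<comment> \<open>The energy bound concerns solutions, while absorption concerns classes: any
    solution from any representative computes \<Phi>, and its second moment at \<tau> is the squared
    class norm.\<close>
  have absorb: "\<exists>T>0. \<forall>t\<ge>T. \<Phi> t (\<tau> - t) ` D (\<tau> - t) \<subseteq> K \<tau>" if D: "D \<in> \<DD>" for \<tau> D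
  proof -
    from rho0(2)[OF D, of \<tau>] obtain T where T: "T > 0" and abs: "\<forall>t\<ge>T. \<forall>\<xi> u.
        \<xi> \<in> L2_fun M (F (\<tau> - t)) \<and> ae_class M \<xi> \<in> D (\<tau> - t) \<and> sol (\<tau> - t) \<xi> u \<longrightarrow>
        (\<integral>\<omega>. (norm (u \<tau> \<omega>))\<^sup>2 \<partial>M) \<le> R \<tau>" by (elim exE conjE)
    have "\<Phi> t (\<tau> - t) X \<in> K \<tau>" if t: "T \<le> t" and X: "X \<in> D (\<tau> - t)" for t X
    proof -
      have t0: "0 \<le> t" using T t by simp
      have "X \<in> L2_space M (F (\<tau> - t))"
        using X pullback_universeD(1)[OF D[unfolded \<DD>_def], of "\<tau> - t"] by (rule rev_subsetD)
      then obtain \<xi> where \<xi>: "\<xi> \<in> L2_fun M (F (\<tau> - t))" "X = ae_class M \<xi>" by (rule L2_spaceE)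
      note wp' = wp[unfolded well_posed_def, THEN spec, THEN bspec, OF \<xi>(1)]
      from wp'[THEN conjunct1] obtain u where u: "sol (\<tau> - t) \<xi> u" ..
      have "u \<tau> \<in> L2_fun M (F \<tau>)"
        using wp'[THEN conjunct2, THEN conjunct2, THEN spec, THEN mp, OF u] t0 by simp
      moreover have "(\<integral>\<omega>. (norm (u \<tau> \<omega>))\<^sup>2 \<partial>M) \<le> R \<tau>"
        using abs[THEN spec, THEN mp, OF t, THEN spec, THEN spec, THEN mp, of \<xi> u] \<xi> u X by simp
      moreover have "solution_map M F sol t (\<tau> - t) (ae_class M \<xi>) = ae_class M (u (t + (\<tau> - t)))"
      proof (rule solution_map_ae_class[where M=M and F=F and sol=sol and \<tau>="\<tau> - t" and \<xi>=\<xi> and u=u and t=t])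
        show "sol \<tau>' \<xi>' u" if "sol \<tau> \<xi> u" "\<tau> \<le> \<tau>'" "AE \<omega> in M. \<xi>' \<omega> = u \<tau>' \<omega>" for \<tau> \<tau>' \<xi> \<xi>' u
          using that by (rule restart)
        show "AE \<omega> in M. u \<tau> \<omega> = \<xi> \<omega>" if "sol \<tau> \<xi> u" for \<tau> \<xi> u
          using that by (rule initial)
      qed (fact basis wp \<xi>(1) u t0)+
      then have "\<Phi> t (\<tau> - t) X = ae_class M (u \<tau>)"
        unfolding \<Phi>_def \<xi>(2) by simp
      ultimately show ?thesis
        by (simp add: K_eq L2_space_def class_norm_ae_class[OF L2_fun_borel] L2_norm_square)
    qed
    then have "\<forall>t\<ge>T. \<Phi> t (\<tau> - t) ` D (\<tau> - t) \<subseteq> K \<tau>"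
      by (intro allI impI image_subsetI)
    with T show ?thesis by (intro exI[of _ T] conjI)
  qed
  have absorbing: "weakly_compact_absorbing M F \<DD> \<Phi> K"
    unfolding weakly_compact_absorbing_def
  proof (intro conjI allI ballI)
    show "K \<in> \<DD>" unfolding \<DD>_def by (rule K_ball(1))
    show "compactin (weak_topology M (F \<tau>)) (K \<tau>)" for \<tau> by (rule K_ball(2))
    show "\<exists>T>0. \<forall>t\<ge>T. \<Phi> t (\<tau> - t) ` D (\<tau> - t) \<subseteq> K \<tau>" if "D \<in> \<DD>" for \<tau> D
      using that by (rule absorb)
  qed
  interpret absorbing: weak_pullback_absorbing M F \<kappa> \<Phi> K
    using basis mrds absorbing unfolding \<DD>_def by (rule weak_pullback_absorbing.intro)
  have attractor: "weak_pullback_attractor M F \<DD> \<Phi> absorbing.omega_limit"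
    unfolding \<DD>_def by (rule absorbing.weak_pullback_attractor_omega_limit)
  show ?thesis
  proof (intro conjI exI[of _ absorbing.omega_limit] allI impI mrds absorbing attractor)
    show "\<A>' = absorbing.omega_limit" if "weak_pullback_attractor M F \<DD> \<Phi> \<A>'" for \<A>'
      using attractor that by (rule weak_pullback_attractor_unique)
    show "absorbing.omega_limit \<tau> = (\<Inter>s\<in>{0..}.
        weak_topology M (F \<tau>) closure_of (\<Union>t\<in>{s..}. \<Phi> t (\<tau> - t) ` K (\<tau> - t)))" for \<tau>
      unfolding absorbing.omega_limit_def absorbing.tail_def ..
  qed
qed

end
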